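(* Let $k\ge 3$ and $r\ge 2$ be integers with $k\ge M_r$. Let $T$ be a $k$-vertex tree that satisfies the Erdős–Sós conjecture. Let $F$ be the $(r-2)$-fold enlargement of $T$. Then $\mathcal{K}^F_{k+r-2}$ is $(k+r-3)$-stable.
   Context: An $r$-graph is a finite $r$-uniform hypergraph; $|G|$ denotes the number of edges and $n(G)$ the number of vertices of $G$. $F\subseteq G$ means $G$ contains a (not necessarily induced) copy of $F$ as a subgraph; $G$ is $F$-free if $F\not\subseteq G$, and is free of a family if it contains no member of the family. $\mathrm{ex}(n,F)$ is the maximum number of edges in an $F$-free $r$-graph on $n$ vertices. $[m]_r=m(m-1)\cdots(m-r+1)$ is the falling factorial. A $k$-vertex tree $T$ satisfies the Erdős–Sós conjecture if $\mathrm{ex}(n,T)\le n(k-2)/2$ for all $n$. The $(r-2)$-fold enlargement of a graph $T$ is the $r$-graph $\{e\cup D: e\in E(T)\}$, where $D$ is an $(r-2)$-set of vertices disjoint from $V(T)$ (its vertex set is $V(T)\cup D$). For $r\ge2$ let $f_r(x)=\frac{\prod_{i=1}^{r-1}(x+i-2)}{(x+r-3)^r}$. $M_r$ denotes the last (i.e. rightmost) point of $[2,\infty)$ at which $f_r$ attains its maximum on $[2,\infty)$ (for instance $M_2=M_3=2$, $M_4=2+\sqrt3$). A pair of vertices is covered in a hypergraph if some edge contains both vertices. For an $r$-graph $F$ and an integer $p\ge n(F)$, $\mathcal{K}^F_p$ is the family of all $r$-graphs $H$ that contain a set $C$ of $p$ vertices (called the core) such that the subgraph $H[C]$ induced by $C$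 contains a copy of $F$ and every pair of vertices in $C$ is covered in $H$. For an $r$-graph $G$ on $[t]=\{1,\dots,t\}$, let $p_G(x_1,\dots,x_t)=r!\sum_{e\in E(G)}\prod_{i\in e}x_i$. The Lagrangian of $G$ is $\lambda(G)=\max\{p_G(x): x_i\ge 0\ \forall i,\ \sum_i x_i=1\}$. The Lagrangian density of an $r$-graph $F$ is $\pi_\lambda(F)=\sup\{\lambda(G): G \text{ an } r\text{-graph with } F\not\subseteq G\}$. An $r$-graph is $m$-partite if its vertex set can be partitioned into $m$ parts (possibly empty) such that every edge contains at most one vertex of each part. For integers $m,r\ge2$ and an $r$-graph $F$ on at most $m+1$ vertices with $\pi_\lambda(F)\le\frac{[m]_r}{m^r}$, the family $\mathcal{K}^F_{m+1}$ is called $m$-stable if for every real $\varepsilon>0$ there are a real $\delta_1>0$ and an integer $n_1$ such that every $\mathcal{K}^F_{m+1}$-free $r$-graph $G$ with $n\ge n_1$ vertices and more than $\left(\frac{[m]_r}{m^r}-\delta_1\right)\binom{n}{r}$ edges can be made $m$-partite by deleting at most $\varepsilon n$ vertices. (For integers $k\ge3$ and $r\ge2$ with $k\ge M_r$, $F$ the $(r-2)$-fold enlargement of a $k$-vertex tree that satisfies the Erdős–Sós conjecture, and $m=k+r-3$, the inequality $\pi_\lambda(F)\le\frac{[m]_r}{m^r}$ is a known theorem of Sidorenko: $\pi_\lambda(F)=\frac{[k+r-3]_r}{(k+r-3)^r}$.) *)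

theory Defs
  imports Complex_Main "HOL-Library.Disjoint_Sets"
begin

datatype 'a hypergraph = Hypergraph (verts: "'a set") (edges: "'a set set")

definition r_graph :: "nat \<Rightarrow> 'a hypergraph \<Rightarrow> bool" where
  "r_graph r G \<longleftrightarrow> finite (verts G) \<and> (\<forall>e\<in>edges G. e \<subseteq> verts G \<and> card e = r)"

definition induced :: "'a hypergraph \<Rightarrow> 'a set \<Rightarrow> 'a hypergraph" where
  "induced G C = Hypergraph (verts G \<inter> C) {e \<in> edges G. e \<subseteq> C}"

text \<open>Containment up to isomorphism, as a not necessarily induced subgraph.\<close>

definition has_copy :: "'b hypergraph \<Rightarrow> 'a hypergraph \<Rightarrow> bool" where
  "has_copy F G \<longleftrightarrow>
     (\<exists>f. inj_on f (verts F) \<and> f ` verts F \<subseteq> verts G \<and> (\<forall>e\<in>edges F. f ` e \<in> edges G))"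

definition family_free :: "'b hypergraph set \<Rightarrow> 'a hypergraph \<Rightarrow> bool" where
  "family_free \<F> G \<longleftrightarrow> (\<forall>H\<in>\<F>. \<not> has_copy H G)"

text \<open>Only meaningful if some \<open>F\<close>-free \<open>r\<close>-graph on \<open>n\<close> vertices exists, which is
  the case as soon as \<open>F\<close> has an edge; otherwise this is the maximum of the empty set.\<close>

definition turan_number :: "nat \<Rightarrow> nat \<Rightarrow> 'a hypergraph \<Rightarrow> nat" where
  "turan_number r n F =
     Max {card E |E. r_graph r (Hypergraph {..<n} E) \<and> \<not> has_copy F (Hypergraph {..<n} E)}"

definition connected_graph :: "'a hypergraph \<Rightarrow> bool" where
  "connected_graph G \<longleftrightarrow>
     verts G \<noteq> {} \<and> (\<forall>u\<in>verts G. \<forall>v\<in>verts G. (u, v) \<in> {(x, y). {x, y} \<in> edges G}\<^sup>*)"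

definition is_cycle :: "'a hypergraph \<Rightarrow> 'a list \<Rightarrow> bool" where
  "is_cycle G p \<longleftrightarrow>
     length p \<ge> 3 \<and> distinct p \<and>
     (\<forall>i. Suc i < length p \<longrightarrow> {p ! i, p ! Suc i} \<in> edges G) \<and> {last p, hd p} \<in> edges G"

definition is_tree :: "'a hypergraph \<Rightarrow> bool" where
  "is_tree T \<longleftrightarrow> r_graph 2 T \<and> connected_graph T \<and> (\<nexists>p. is_cycle T p)"

definition satisfies_erdos_sos :: "'a hypergraph \<Rightarrow> bool" where
  "satisfies_erdos_sos T \<longleftrightarrow>
     (\<forall>n. real (turan_number 2 n T) \<le> real n * (real (card (verts T)) - 2) / 2)"

definition enlargement :: "'a hypergraph \<Rightarrow> 'a set \<Rightarrow> 'a hypergraph" where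
  "enlargement T D = Hypergraph (verts T \<union> D) {e \<union> D |e. e \<in> edges T}"

definition f_ratio :: "nat \<Rightarrow> real \<Rightarrow> real" where
  "f_ratio r x = (\<Prod>i=1..r-1. x + real i - 2) / (x + real r - 3) ^ r"

definition M_last :: "nat \<Rightarrow> real" where
  "M_last r = (GREATEST x. x \<ge> 2 \<and> (\<forall>y\<ge>2. f_ratio r y \<le> f_ratio r x))"

definition covered :: "'a hypergraph \<Rightarrow> 'a \<Rightarrow> 'a \<Rightarrow> bool" where
  "covered H u v \<longleftrightarrow> (\<exists>e\<in>edges H. u \<in> e \<and> v \<in> e)"

text \<open>The family \<open>\<K>\<^sup>F\<^sub>p\<close> of \<open>r\<close>-graphs, with \<open>C\<close> the core. The edges covering the pairs of
  \<open>C\<close> need not lie inside \<open>C\<close>.\<close>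

definition core_family :: "nat \<Rightarrow> 'b hypergraph \<Rightarrow> nat \<Rightarrow> 'a hypergraph set" where
  "core_family r F p =
     {H. r_graph r H \<and>
         (\<exists>C\<subseteq>verts H. card C = p \<and> has_copy F (induced H C) \<and>
            (\<forall>u\<in>C. \<forall>v\<in>C. u \<noteq> v \<longrightarrow> covered H u v))}"

definition m_partite :: "nat \<Rightarrow> 'a hypergraph \<Rightarrow> bool" where
  "m_partite m G \<longleftrightarrow>
     (\<exists>P :: nat \<Rightarrow> 'a set. disjoint_family_on P {..<m} \<and> (\<Union>i<m. P i) = verts G \<and>
        (\<forall>e\<in>edges G. \<forall>i<m. card (e \<inter> P i) \<le> 1))"

definition falling_factorial :: "nat \<Rightarrow> nat \<Rightarrow> real" where
  "falling_factorial m r = (\<Prod>i<r. real m - real i)"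

text \<open>Stability of a family of \<open>r\<close>-graphs. Vertices are natural numbers, which loses nothing,
  as every finite hypergraph has an isomorphic copy on natural numbers.

  In the literature the notion is introduced for the families \<open>\<K>\<^sup>F\<^sub>m\<^sub>+\<^sub>1\<close> with \<open>m, r \<ge> 2\<close>, where
  \<open>F\<close> has at most \<open>m + 1\<close> vertices and Lagrangian density at most \<open>[m]\<^sub>r / m\<^sup>r\<close>. These conditions
  delimit where the term is used and are not part of the property, so they are not repeated here.\<close>

definition m_stable :: "nat \<Rightarrow> nat \<Rightarrow> nat hypergraph set \<Rightarrow> bool" where
  "m_stable r m \<F> \<longleftrightarrow>
     (\<forall>\<epsilon>::real. \<epsilon> > 0 \<longrightarrow>
       (\<exists>\<delta>\<^sub>1::real. \<exists>n\<^sub>1::nat. \<delta>\<^sub>1 > 0 \<and>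
         (\<forall>G :: nat hypergraph.
            r_graph r G \<and> family_free \<F> G \<and> card (verts G) \<ge> n\<^sub>1 \<and>
            real (card (edges G)) >
              (falling_factorial m r / real m ^ r - \<delta>\<^sub>1) * real (card (verts G) choose r) \<longrightarrow>
            (\<exists>S\<subseteq>verts G. real (card S) \<le> \<epsilon> * real (card (verts G)) \<and>
               m_partite m (induced G (verts G - S))))))"

end

theory Submission
  imports Defs "HOL-Analysis.Analysis" "HOL-Library.Ramsey"
begin

text \<open>
  Put \<open>m = k + r - 3\<close>. By the Erdos-Sos bound, every \<open>(r - 2)\<close>-set of a hypergraph without a
  copy of the enlarged tree has a sparse link graph (\<open>sparse\<close>), and sparsity passes to links of vertices.
  For graphs, peeling off the smallest weight bounds the sum of \<open>min (x u) (x v)\<close> over the edges;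
  for larger \<open>r\<close> one induces through the link of a vertex of maximal weight in an optimal weighting.
  If that weight is at most \<open>1/m\<close>, this bounds the Lagrangian by a multiple of \<open>f_ratio r\<close> at some
  point to the right of \<open>k\<close>, where \<open>f_ratio r\<close> decreases because \<open>k \<ge> M_last r\<close>; if it is
  larger, the Lagrangian bound for the link suffices. In a nearly optimal weighting the maximal weight
  is therefore close to \<open>1/m\<close> and the link is nearly optimal too, so nearly all the weight
  lies on \<open>m\<close> vertices.

  The Lagrangian bound holds for all core-free hypergraphs, since weight can be shifted between
  uncovered vertices. For stability the same symmetrization is done one vertex at a time, on blow-ups.
  A step changes the edges at a single vertex only, so it can be undone: a vertex of large degree can
  always be added to a large \<open>m\<close>-partite induced subgraph of large minimum degree. When no
  step is possible, all pairs of fibres are covered and the weighted stability applies.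
\<close>

subsection \<open>Edge weight polynomials\<close>

text \<open>Symmetrization may take arbitrarily many steps, so undoing it must not accumulate loss.
  This dictates the form of \<open>partite_improve\<close>: an induced \<open>m\<close>-partite
  subgraph on a share \<open>1 - 2 * \<epsilon>\<close> of the vertices is upgraded to the share
  \<open>1 - \<epsilon>\<close> under a density condition that is the same for every blow-up met on
  the way. Taking back one moved vertex costs at most the margin \<epsilon>, which the upgrade
  restores. \<open>f_ratio\<close> arises from the recursion through links. Each passage to the link
  of a vertex of weight \<open>a\<close> contributes the current total weight as a factor and
  removes \<open>a\<close> from it, until the graph bound \<open>(k - 2) * a * s / 2\<close> ends
  the recursion; at \<open>a = 1/m\<close> the product is the extremal density. The enlarged tree
  has \<open>m + 1\<close> vertices, one more than there are parts. In a nearly complete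
  \<open>m\<close>-partite hypergraph a copy with covered core therefore appears as soon as one
  extra vertex is available: either a second vertex of some part that is covered together with the
  first, or an outer vertex covered with a whole transversal. A tree leaf makes both embeddings
  possible, and excluding them forces a new vertex into one of the parts.\<close>

definition wsum :: "'v set set \<Rightarrow> ('v \<Rightarrow> real) \<Rightarrow> real" where
  "wsum E x = (\<Sum>e\<in>E. \<Prod>i\<in>e. x i)"

definition link :: "'v set set \<Rightarrow> 'v \<Rightarrow> 'v set set" where
  "link E v = {f. v \<notin> f \<and> insert v f \<in> E}"

lemma finite_nsets_sub: "finite S \<Longrightarrow> E \<subseteq> nsets S r \<Longrightarrow> finite E"
  using finite_imp_finite_nsets finite_subset by blast

lemma link_nsets: "E \<subseteq> nsets S (Suc r) \<Longrightarrow> link E v \<subseteq> nsets (S - {v}) r"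
  by (auto simp: link_def nsets_def)

lemma link_commute: "link (link E i) j = link (link E j) i"
  by (auto simp: link_def insert_commute)

lemma link_image: "{e\<in>E. v \<in> e} = insert v ` link E v"
proof
  show "{e\<in>E. v \<in> e} \<subseteq> insert v ` link E v"
  proof
    fix e assume e: "e \<in> {e\<in>E. v \<in> e}"
    then have "e = insert v (e - {v})" "e - {v} \<in> link E v"
      by (auto simp: link_def insert_absorb)
    then show "e \<in> insert v ` link E v" by blast
  qed
qed (auto simp: link_def)

lemma inj_on_insert_link: "inj_on (insert v) (link E v)"
  by (rule inj_on_inverseI[where g = "\<lambda>e. e - {v}"]) (auto simp: link_def)

lemma finite_link: "finite E \<Longrightarrow> finite (link E v)"
  by (rule finite_imageD[OF _ inj_on_insert_link, of v]) (simp flip: link_image)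

lemma wsum_cong:
  assumes "\<And>e i. e \<in> E \<Longrightarrow> i \<in> e \<Longrightarrow> x i = y i"
  shows "wsum E x = wsum E y"
  unfolding wsum_def using assms by (intro sum.cong prod.cong refl) auto

lemma wsum_nonneg:
  assumes "\<And>e i. e \<in> E \<Longrightarrow> i \<in> e \<Longrightarrow> 0 \<le> x i"
  shows "0 \<le> wsum E x"
  unfolding wsum_def using assms by (intro sum_nonneg prod_nonneg) auto

lemma wsum_containing:
  assumes "E \<subseteq> nsets S r"
  shows "(\<Sum>e\<in>{e\<in>E. v \<in> e}. \<Prod>i\<in>e. x i) = x v * wsum (link E v) x"
proof -
  have "(\<Sum>e\<in>{e\<in>E. v \<in> e}. \<Prod>i\<in>e. x i) = (\<Sum>f\<in>link E v. \<Prod>i\<in>insert v f. x i)"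
    unfolding link_image by (subst sum.reindex[OF inj_on_insert_link]) simp
  also have "\<dots> = (\<Sum>f\<in>link E v. x v * (\<Prod>i\<in>f. x i))"
  proof (rule sum.cong[OF refl])
    fix f assume "f \<in> link E v"
    then have "finite f" "v \<notin> f"
      using assms unfolding link_def nsets_def by (auto dest!: subsetD)
    then show "(\<Prod>i\<in>insert v f. x i) = x v * (\<Prod>i\<in>f. x i)" by simp
  qed
  finally show ?thesis by (simp add: wsum_def sum_distrib_left)
qed

lemma wsum_split:
  assumes "finite S" "E \<subseteq> nsets S r"
  shows "wsum E x = x v * wsum (link E v) x + wsum {e\<in>E. v \<notin> e} x"
proof -
  have "finite E" using finite_nsets_sub[OF assms] .
  then have "wsum E x = (\<Sum>e\<in>{e\<in>E. v \<in> e}. \<Prod>i\<in>e. x i) + (\<Sum>e\<in>{e\<in>E. v \<notin> e}. \<Prod>i\<in>e. x i)"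
    unfolding wsum_def by (subst sum.union_disjoint[symmetric]) (auto intro!: sum.cong)
  then show ?thesis using wsum_containing[OF assms(2)] by (simp add: wsum_def)
qed

lemma wsum_link_upd [simp]: "wsum (link E v) (x(v := t)) = wsum (link E v) x"
  by (rule wsum_cong) (auto simp: link_def)

lemma wsum_upd:
  assumes "finite S" "E \<subseteq> nsets S r"
  shows "wsum E (x(v := t)) = wsum E x + (t - x v) * wsum (link E v) x"
proof -
  have "wsum {e\<in>E. v \<notin> e} (x(v := t)) = wsum {e\<in>E. v \<notin> e} x"
    by (rule wsum_cong) auto
  then show ?thesis
    using wsum_split[OF assms, of "x(v := t)" v] wsum_split[OF assms, of x v]
    by (simp add: algebra_simps)
qed

text \<open>\<open>wsum E\<close> is affine in each coordinate, so a transfer of weight changes it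
  by a quadratic polynomial in \<open>t\<close>. The quadratic term counts the edges through both
  \<open>i\<close> and \<open>j\<close>; without such edges the change is linear, which is what
  symmetrization exploits.\<close>

lemma wsum_shift:
  assumes "finite S" "E \<subseteq> nsets S (Suc (Suc r))" "i \<noteq> j"
  shows "wsum E (x(i := x i - t, j := x j + t)) =
    wsum E x + t * (wsum (link E j) x - wsum (link E i) x) - t^2 * wsum (link (link E i) j) x"
proof -
  let ?y = "x(i := x i - t)"
  have "wsum E (?y(j := x j + t)) = wsum E ?y + t * wsum (link E j) ?y"
    using assms(3) by (subst wsum_upd[OF assms(1,2)]) simp
  moreover have "wsum E ?y = wsum E x - t * wsum (link E i) x"
    by (subst wsum_upd[OF assms(1,2)]) simp
  moreover have "wsum (link E j) ?y = wsum (link E j) x - t * wsum (link (link E j) i) x"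
    using link_nsets[OF assms(2), of j] assms(1,3)
    by (subst wsum_upd[of "S - {j}" _ "Suc r"]) auto
  ultimately show ?thesis
    by (simp add: algebra_simps power2_eq_square link_commute[of E i j])
qed

text \<open>Euler's identity for a homogeneous polynomial, the link being the partial derivative. It
  turns a bound on the largest degree into a bound on the whole sum.\<close>

lemma wsum_euler:
  assumes "finite S" "E \<subseteq> nsets S r"
  shows "(\<Sum>v\<in>S. x v * wsum (link E v) x) = real r * wsum E x"
proof -
  have fE: "finite E" using finite_nsets_sub[OF assms] .
  have "(\<Sum>v\<in>S. x v * wsum (link E v) x) = (\<Sum>v\<in>S. \<Sum>e\<in>E. if v \<in> e then \<Prod>i\<in>e. x i else 0)"
    unfolding wsum_containing[OF assms(2), symmetric]
    by (rule sum.cong[OF refl], rule sum.inter_filter[OF fE])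
  also have "\<dots> = (\<Sum>e\<in>E. \<Sum>v\<in>S. if v \<in> e then \<Prod>i\<in>e. x i else 0)"
    by (rule sum.swap)
  also have "\<dots> = (\<Sum>e\<in>E. real r * (\<Prod>i\<in>e. x i))"
  proof (rule sum.cong[OF refl])
    fix e assume "e \<in> E"
    then have e: "e \<subseteq> S" "card e = r" using assms(2) by (auto simp: nsets_def)
    then have "{v \<in> S. v \<in> e} = e" by auto
    then show "(\<Sum>v\<in>S. if v \<in> e then \<Prod>i\<in>e. x i else 0) = real r * (\<Prod>i\<in>e. x i)"
      using e(2) by (subst sum.inter_filter[OF assms(1), symmetric]) simp
  qed
  finally show ?thesis by (simp add: wsum_def sum_distrib_left)
qed

lemma wsum_scale:
  assumes "E \<subseteq> nsets S r"
  shows "wsum E (\<lambda>i. c * x i) = c ^ r * wsum E x"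
  unfolding wsum_def sum_distrib_left
proof (rule sum.cong[OF refl])
  fix e assume "e \<in> E"
  then have "card e = r" using assms by (auto simp: nsets_def)
  then show "(\<Prod>i\<in>e. c * x i) = c ^ r * (\<Prod>i\<in>e. x i)"
    by (simp add: prod.distrib)
qed

lemma wsum_nsets_0: "E \<subseteq> nsets S 0 \<Longrightarrow> wsum E x \<le> 1"
proof -
  assume "E \<subseteq> nsets S 0"
  then have "E \<subseteq> {{}}" by (auto simp: nsets_def)
  then have "E = {} \<or> E = {{}}" by auto
  then show ?thesis by (auto simp: wsum_def)
qed

text \<open>A crude bound, which later controls the quadratic term of a weight shift. Euler's
  identity reduces it to links.\<close>

lemma wsum_le_1:
  assumes "finite S" "E \<subseteq> nsets S r" "\<And>i. i \<in> S \<Longrightarrow> 0 \<le> x i" "sum x S \<le> 1"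
  shows "wsum E x \<le> 1"
  using assms
proof (induction r arbitrary: S E)
  case 0
  then show ?case using wsum_nsets_0 by blast
next
  case (Suc r)
  have "wsum (link E v) x \<le> 1" if "v \<in> S" for v
  proof (rule Suc.IH[of "S - {v}"])
    show "sum x (S - {v}) \<le> 1"
      using Suc.prems sum_mono2[of S "S - {v}" x] by fastforce
  qed (use Suc.prems link_nsets[OF Suc.prems(2), of v] in auto)
  then have "(\<Sum>v\<in>S. x v * wsum (link E v) x) \<le> (\<Sum>v\<in>S. x v * 1)"
    using Suc.prems by (intro sum_mono mult_left_mono) auto
  also have "\<dots> \<le> 1" using Suc.prems by simp
  finally have le: "real (Suc r) * wsum E x \<le> 1"
    unfolding wsum_euler[OF Suc.prems(1,2)] .
  have "0 \<le> wsum E x"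
    by (rule wsum_nonneg) (use Suc.prems in \<open>auto simp: nsets_def\<close>)
  then have "1 * wsum E x \<le> real (Suc r) * wsum E x"
    by (intro mult_right_mono) auto
  with le show ?case by simp
qed

text \<open>The vertex type may be infinite, so compactness is obtained from Tychonoff's theorem in
  the product over the whole type, with all coordinates outside \<open>S\<close> pinned to
  0.\<close>

lemma wsum_maximizer:
  fixes S :: "'v set"
  assumes "finite S" "finite E" "\<And>i. i \<in> S \<Longrightarrow> 0 \<le> z i \<and> z i \<le> a" "E \<subseteq> nsets S r"
  shows "\<exists>y. (\<forall>i\<in>S. 0 \<le> y i \<and> y i \<le> a) \<and> sum y S = sum z S \<and>
    (\<forall>x. (\<forall>i\<in>S. 0 \<le> x i \<and> x i \<le> a) \<longrightarrow> sum x S = sum z S \<longrightarrow> wsum E x \<le> wsum E y)"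
proof -
  define B where "B = (\<lambda>i. if i \<in> S then {0..a} else {0::real})"
  define P where "P = PiE UNIV B"
  have "compactin (product_topology (\<lambda>i::'v. euclidean :: real topology) UNIV) P"
    unfolding P_def compactin_PiE by (auto simp: B_def)
  then have "compact P" by (simp add: euclidean_product_topology)
  moreover have "closed {x. sum x S = sum z S}"
    by (intro closed_Collect_eq continuous_intros continuous_on_product_coordinates)
  ultimately have cK: "compact (P \<inter> {x. sum x S = sum z S})"
    by blast
  define z0 where "z0 = (\<lambda>i. if i \<in> S then z i else 0)"
  have "z0 \<in> P \<inter> {x. sum x S = sum z S}"
    using assms(3) by (auto simp: P_def B_def z0_def)
  then have ne: "P \<inter> {x. sum x S = sum z S} \<noteq> {}" by blast
  have "continuous_on (P \<inter> {x. sum x S = sum z S}) (wsum E)"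
    unfolding wsum_def
    by (intro continuous_on_sum continuous_on_prod continuous_on_subset[OF continuous_on_product_coordinates]) auto
  from continuous_attains_sup[OF cK ne this]
  obtain y where y: "y \<in> P" "sum y S = sum z S"
    "\<And>x. x \<in> P \<Longrightarrow> sum x S = sum z S \<Longrightarrow> wsum E x \<le> wsum E y"
    by auto
  show ?thesis
  proof (intro exI[of _ y] conjI allI impI ballI)
    show "0 \<le> y i" "y i \<le> a" if "i \<in> S" for i
      using PiE_mem[OF y(1)[unfolded P_def], of i] that by (auto simp: B_def)
    show "sum y S = sum z S" by fact
    fix x assume x: "\<forall>i\<in>S. 0 \<le> x i \<and> x i \<le> a" "sum x S = sum z S"
    define x0 where "x0 = (\<lambda>i. if i \<in> S then x i else 0)"
    have "wsum E x = wsum E x0"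
      by (rule wsum_cong) (use assms(4) in \<open>auto simp: x0_def nsets_def\<close>)
    also have "\<dots> \<le> wsum E y"
      by (rule y(3)) (use x in \<open>auto simp: P_def B_def x0_def\<close>)
    finally show "wsum E x \<le> wsum E y" .
  qed
qed

subsection \<open>Sparse hypergraphs\<close>

text \<open>Quantifying over \<open>U\<close> makes the condition hereditary: the link graph of
  \<open>A\<close> has average degree at most \<open>k - 2\<close> on every vertex set, as the
  peeling of weights requires. For \<open>r = 2\<close> and finite \<open>S\<close> only the empty
  \<open>A\<close> occurs.\<close>

definition sparse :: "nat \<Rightarrow> nat \<Rightarrow> 'v set \<Rightarrow> 'v set set \<Rightarrow> bool" where
  "sparse k r S E \<longleftrightarrow> (\<forall>A U. A \<subseteq> S \<longrightarrow> card A = r - 2 \<longrightarrow> U \<subseteq> S - A \<longrightarrow>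
     2 * real (card {g\<in>nsets U 2. A \<union> g \<in> E}) \<le> (real k - 2) * real (card U))"

lemma sparse_link:
  assumes "sparse k (Suc r) S E" "r \<ge> 2" "i \<in> S" "finite S"
  shows "sparse k r (S - {i}) (link E i)"
  unfolding sparse_def
proof (intro allI impI)
  fix A U assume A: "A \<subseteq> S - {i}" "card A = r - 2" and U: "U \<subseteq> S - {i} - A"
  have "finite A" using A(1) assms(4) finite_subset by blast
  moreover have "i \<notin> A" using A by blast
  ultimately have "card (insert i A) = Suc r - 2" using A(2) assms(2) by simp
  moreover have "insert i A \<subseteq> S" "U \<subseteq> S - insert i A" using A U assms(3) by auto
  ultimately have *: "2 * real (card {g\<in>nsets U 2. insert i A \<union> g \<in> E}) \<le> (real k - 2) * real (card U)"
    using assms(1) unfolding sparse_def by blast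
  have "{g\<in>nsets U 2. A \<union> g \<in> link E i} = {g\<in>nsets U 2. insert i A \<union> g \<in> E}"
    using A U by (auto simp: link_def nsets_def)
  then show "2 * real (card {g\<in>nsets U 2. A \<union> g \<in> link E i}) \<le> (real k - 2) * real (card U)"
    using * by simp
qed

text \<open>Lowering all positive weights by the smallest of them changes the minimum by exactly
  that amount on the edges inside the support and not at all on the others, where it is 0. The
  constant is left open: \<open>k - 2\<close> serves sparse graphs, \<open>k - 3\<close> serves
  graphs on at most \<open>k - 2\<close> vertices.\<close>

lemma sum_Min_pairs_le:
  fixes y :: "'v \<Rightarrow> real"
  assumes "finite U" "E \<subseteq> nsets U 2" "\<And>i. i \<in> U \<Longrightarrow> 0 \<le> y i"
    and "\<And>W. W \<subseteq> U \<Longrightarrow> 2 * real (card {e\<in>E. e \<subseteq> W}) \<le> c * real (card W)"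
  shows "2 * (\<Sum>e\<in>E. Min (y ` e)) \<le> c * sum y U"
  using assms
proof (induction "card {i\<in>U. y i > 0}" arbitrary: y rule: less_induct)
  case less
  define W where "W = {i\<in>U. y i > 0}"
  have fE: "finite E" using finite_nsets_sub less.prems(1,2) by blast
  have fW: "finite W" using less.prems(1) by (simp add: W_def)
  have esub: "e \<subseteq> U" "finite e" "e \<noteq> {}" if "e \<in> E" for e
    using that less.prems(2) by (auto simp: nsets_def)
  show ?case
  proof (cases "W = {}")
    case True
    then have y0: "y i = 0" if "i \<in> U" for i
      using less.prems(3)[OF that] that unfolding W_def by force
    have "Min (y ` e) = 0" if "e \<in> E" for e
    proof -
      have "y ` e = {0}" using esub[OF that] y0 by (auto simp: image_iff) blast+
      then show ?thesis by simp
    qed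
    then show ?thesis using y0 by simp
  next
    case False
    define \<mu> where "\<mu> = Min (y ` W)"
    have "\<mu> \<in> y ` W" unfolding \<mu>_def using False fW by (intro Min_in) auto
    then obtain i0 where i0: "i0 \<in> W" "y i0 = \<mu>" by blast
    have \<mu>0: "\<mu> > 0" using i0 by (auto simp: W_def)
    have \<mu>le: "\<mu> \<le> y i" if "i \<in> W" for i
      unfolding \<mu>_def using that fW by simp
    define y' where "y' = (\<lambda>i. if i \<in> W then y i - \<mu> else y i)"
    have y'0: "0 \<le> y' i" if "i \<in> U" for i
      using less.prems(3)[OF that] \<mu>le by (auto simp: y'_def)
    have "{i\<in>U. y' i > 0} \<subset> W"
    proof
      show "{i\<in>U. y' i > 0} \<subseteq> W"
        using less.prems(3) by (auto simp: y'_def W_def split: if_splits)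
      show "{i\<in>U. y' i > 0} \<noteq> W" using i0 by (auto simp: y'_def)
    qed
    then have "card {i\<in>U. y' i > 0} < card {i\<in>U. y i > 0}"
      using fW psubset_card_mono unfolding W_def by blast
    from less.hyps[OF this less.prems(1,2) y'0 less.prems(4)]
    have IH: "2 * (\<Sum>e\<in>E. Min (y' ` e)) \<le> c * sum y' U" by blast
    have "Min (y ` e) \<le> Min (y' ` e) + (if e \<subseteq> W then \<mu> else 0)" if e: "e \<in> E" for e
    proof -
      have ne: "finite (y' ` e)" "y' ` e \<noteq> {}" using esub[OF e] by auto
      obtain j where j: "j \<in> e" "y' j = Min (y' ` e)"
        using Min_in[OF ne] by (metis imageE)
      show ?thesis
      proof (cases "e \<subseteq> W")
        case True
        have "Min (y ` e) \<le> y j" using j(1) esub[OF e] by simp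
        then show ?thesis using True j by (auto simp: y'_def)
      next
        case False
        then obtain l where l: "l \<in> e" "l \<notin> W" by auto
        then have "y l \<le> 0" using esub(1)[OF e] by (auto simp: W_def)
        then have "Min (y ` e) \<le> 0" using l(1) esub(2)[OF e]
          by (meson Min_le finite_imageI image_eqI order_trans)
        moreover have "0 \<le> Min (y' ` e)" using j y'0 esub(1)[OF e] by (metis subsetD)
        ultimately show ?thesis using False by simp
      qed
    qed
    then have "(\<Sum>e\<in>E. Min (y ` e)) \<le> (\<Sum>e\<in>E. Min (y' ` e) + (if e \<subseteq> W then \<mu> else 0))"
      by (rule sum_mono)
    also have "\<dots> = (\<Sum>e\<in>E. Min (y' ` e)) + \<mu> * real (card {e\<in>E. e \<subseteq> W})"
      using fE by (simp add: sum.distrib flip: sum.inter_filter)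
    finally have 1: "(\<Sum>e\<in>E. Min (y ` e)) \<le> (\<Sum>e\<in>E. Min (y' ` e)) + \<mu> * real (card {e\<in>E. e \<subseteq> W})" .
    have "2 * real (card {e\<in>E. e \<subseteq> W}) \<le> c * real (card W)"
      by (rule less.prems(4)) (auto simp: W_def)
    then have 2: "\<mu> * (2 * real (card {e\<in>E. e \<subseteq> W})) \<le> \<mu> * (c * real (card W))"
      using \<mu>0 by (intro mult_left_mono) auto
    have "sum y U = (\<Sum>i\<in>U. y' i + (if i \<in> W then \<mu> else 0))"
      by (rule sum.cong) (auto simp: y'_def)
    also have "\<dots> = sum y' U + \<mu> * real (card {i\<in>U. i \<in> W})"
      using less.prems(1) by (simp add: sum.distrib flip: sum.inter_filter)
    also have "{i\<in>U. i \<in> W} = W" by (auto simp: W_def)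
    finally have 3: "sum y U = sum y' U + \<mu> * real (card W)" .
    have "2 * (\<Sum>e\<in>E. Min (y ` e)) \<le> 2 * (\<Sum>e\<in>E. Min (y' ` e)) + \<mu> * (2 * real (card {e\<in>E. e \<subseteq> W}))"
      using 1 by (simp add: algebra_simps)
    also have "\<dots> \<le> c * sum y' U + \<mu> * (c * real (card W))"
      using IH 2 by linarith
    also have "\<dots> = c * sum y U" unfolding 3 by (simp add: algebra_simps)
    finally show ?thesis .
  qed
qed

lemma prod_pair_le_Min:
  fixes y :: "'v \<Rightarrow> real"
  assumes "e \<in> nsets S 2" "\<And>i. i \<in> S \<Longrightarrow> 0 \<le> y i \<and> y i \<le> a"
  shows "(\<Prod>i\<in>e. y i) \<le> a * Min (y ` e)"
proof -
  obtain u v where e: "e = {u,v}" "u \<noteq> v" "u \<in> S" "v \<in> S"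
    using assms(1) by (auto simp: nsets_def card_2_iff)
  have "y u * y v = max (y u) (y v) * min (y u) (y v)"
    by (simp add: max_def min_def)
  also have "\<dots> \<le> a * min (y u) (y v)"
    using assms(2)[OF e(3)] assms(2)[OF e(4)] by (intro mult_right_mono) auto
  finally show ?thesis using e by simp
qed

lemma wsum_pairs_le:
  fixes y :: "'v \<Rightarrow> real"
  assumes "finite S" "E \<subseteq> nsets S 2" "\<And>i. i \<in> S \<Longrightarrow> 0 \<le> y i \<and> y i \<le> a"
  shows "wsum E y \<le> a * (\<Sum>e\<in>E. Min (y ` e))"
  unfolding wsum_def sum_distrib_left
  by (rule sum_mono, rule prod_pair_le_Min) (use assms in auto)

lemma sparse_2D:
  assumes "sparse k 2 S E" "E \<subseteq> nsets S 2" "W \<subseteq> S"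
  shows "2 * real (card {e\<in>E. e \<subseteq> W}) \<le> (real k - 2) * real (card W)"
proof -
  have "{e\<in>E. e \<subseteq> W} = {g\<in>nsets W 2. {} \<union> g \<in> E}"
    using assms(2) by (auto simp: nsets_def)
  then show ?thesis
    using assms(1)[unfolded sparse_def, rule_format, of "{}" W] assms(3) by simp
qed

section \<open>The comparison function \<open>hprod\<close> and its monotonicity in the weight
  cap\<close>

definition hprod :: "nat \<Rightarrow> real \<Rightarrow> real \<Rightarrow> real" where
  "hprod r a s = a * (\<Prod>j<r-1. s - real j * a)"

text \<open>Equivalent to \<open>f_ratio r\<close> being nonincreasing to the right of \<open>k\<close>: up to sign and a positive
  factor, one minus the left-hand side is the logarithmic derivative of \<open>f_ratio r\<close> at \<open>k\<close>.\<close>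

definition log_deriv_cond :: "real \<Rightarrow> nat \<Rightarrow> bool" where
  "log_deriv_cond k r \<longleftrightarrow> (\<Sum>j<r-1. real j / (k + real r - 3 - real j)) \<le> 1"

text \<open>Shifting the index by one keeps the denominators and raises the numerators, so the
  condition descends to links while \<open>k\<close> stays fixed.\<close>

lemma log_deriv_cond_Suc:
  assumes "log_deriv_cond k (Suc r)" "k \<ge> 2" "r \<ge> 2"
  shows "log_deriv_cond k r"
proof -
  obtain q where r: "r = Suc (Suc q)" using assms(3) by (metis Suc_le_D numeral_2_eq_2 Suc_le_mono)
  have "(\<Sum>j<r-1. real j / (k + real r - 3 - real j)) \<le> (\<Sum>j<r-1. real (Suc j) / (k + real (Suc r) - 3 - real (Suc j)))"
    by (intro sum_mono frac_le) (use assms r in auto)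
  also have "\<dots> = (\<Sum>j<Suc r-1. real j / (k + real (Suc r) - 3 - real j))"
    unfolding r by (simp add: sum.lessThan_Suc_shift algebra_simps del: sum.lessThan_Suc)
  finally show ?thesis using assms(1) unfolding log_deriv_cond_def by linarith
qed

lemma hprod_nonneg:
  assumes "0 \<le> a" "(k + real r - 3) * a \<le> s" "k \<ge> 2" "r \<ge> 2"
  shows "0 \<le> hprod r a s"
  unfolding hprod_def
proof (intro mult_nonneg_nonneg prod_nonneg ballI)
  fix j assume "j \<in> {..<r-1}"
  then have "real j \<le> k + real r - 3" using assms by auto
  then have "real j * a \<le> (k + real r - 3) * a" using assms(1) by (intro mult_right_mono) auto
  then show "0 \<le> s - real j * a" using assms(2) by linarith
qed (use assms in auto)

lemma hprod_deriv:
  assumes "a \<noteq> 0" "\<And>j. j < r - 1 \<Longrightarrow> s - real j * a \<noteq> 0"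
  shows "((\<lambda>a. hprod r a s) has_real_derivative
     (\<Prod>j<r-1. s - real j * a) * (1 - (\<Sum>j<r-1. real j / (s / a - real j)))) (at a)"
proof -
  have d: "((\<lambda>a. \<Prod>j\<in>{..<r-1}. s - real j * a) has_real_derivative
      (\<Sum>j\<in>{..<r-1}. - real j * (\<Prod>i\<in>{..<r-1}-{j}. s - real i * a))) (at a)"
    by (rule has_field_derivative_prod) (auto intro!: derivative_eq_intros)
  have "(\<Sum>j\<in>{..<r-1}. - real j * (\<Prod>i\<in>{..<r-1}-{j}. s - real i * a)) * a
     = (\<Sum>j<r-1. - (real j / (s / a - real j)) * (\<Prod>j<r-1. s - real j * a))"
    unfolding sum_distrib_right
  proof (rule sum.cong[OF refl])
    fix j assume j: "j \<in> {..<r-1}"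
    define d Q where "d = s - real j * a" and "Q = (\<Prod>i\<in>{..<r-1}-{j}. s - real i * a)"
    have 1: "(\<Prod>j<r-1. s - real j * a) = d * Q"
      unfolding d_def Q_def using j by (subst prod.remove[of _ j]) auto
    have 2: "s / a - real j = d / a" using assms(1) by (simp add: d_def field_simps)
    have "d \<noteq> 0" using assms(2) j by (auto simp: d_def)
    then show "- real j * (\<Prod>i\<in>{..<r-1}-{j}. s - real i * a) * a =
       - (real j / (s / a - real j)) * (\<Prod>j<r-1. s - real j * a)"
      unfolding 1 2 Q_def[symmetric] by simp
  qed
  then have eq: "1 * (\<Prod>j<r-1. s - real j * a) + (\<Sum>j\<in>{..<r-1}. - real j * (\<Prod>i\<in>{..<r-1}-{j}. s - real i * a)) * a
     = (\<Prod>j<r-1. s - real j * a) * (1 - (\<Sum>j<r-1. real j / (s / a - real j)))"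
    by (simp add: sum_negf sum_distrib_left sum_distrib_right algebra_simps)
  show ?thesis unfolding hprod_def eq[symmetric]
    by (rule DERIV_mult[OF DERIV_ident d])
qed

text \<open>For \<open>x < a\<close> the ratio \<open>s / x\<close> exceeds
  \<open>k + r - 3\<close>, so the terms with positive \<open>j\<close> in the logarithmic
  derivative drop strictly below those of \<open>log_deriv_cond\<close>, and the derivative is
  positive even if that condition holds with equality. Strictness later provides the gap needed for
  stability.\<close>

lemma hprod_strict_mono:
  assumes "log_deriv_cond k r" "k \<ge> 2" "r \<ge> 2" "0 < b" "b < a" "(k + real r - 3) * a \<le> s"
  shows "hprod r b s < hprod r a s"
proof (rule DERIV_pos_imp_increasing_open[OF assms(5)])
  define m where "m = k + real r - 3"
  have m: "m \<ge> 1" "m \<ge> real r - 1" using assms by (auto simp: m_def)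
  show "\<exists>y. ((\<lambda>a. hprod r a s) has_real_derivative y) (at x) \<and> 0 < y" if x: "b < x" "x < a" for x
  proof -
    have x0: "x > 0" using x assms by linarith
    have mx: "m * x < s" using x m assms(6) unfolding m_def[symmetric]
      by (smt (verit) mult_strict_left_mono)
    then have sx: "m < s / x" using x0 by (simp add: field_simps)
    have jm: "real j < m" if "j < r - 1" for j using that m(2) by auto
    have pos: "0 < s - real j * x" if "j < r - 1" for j
      using mult_strict_right_mono[OF jm[OF that] x0] mx by linarith
    have "(\<Sum>j<r-1. real j / (s / x - real j)) < 1"
    proof (cases "r \<le> 2")
      case True
      then have "r - 1 = 1" using assms(3) by simp
      then show ?thesis by simp
    next
      case False
      have "(\<Sum>j<r-1. real j / (s / x - real j)) < (\<Sum>j<r-1. real j / (m - real j))"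
      proof (rule sum_strict_mono_ex1)
        show "\<forall>j\<in>{..<r-1}. real j / (s / x - real j) \<le> real j / (m - real j)"
        proof
          fix j assume "j \<in> {..<r-1}"
          then have "real j < m" "real j < s / x" using jm sx by (auto intro: order.strict_trans[OF jm])
          then show "real j / (s / x - real j) \<le> real j / (m - real j)"
            using sx by (intro divide_left_mono) auto
        qed
        show "\<exists>j\<in>{..<r-1}. real j / (s / x - real j) < real j / (m - real j)"
          using False jm[of 1] sx order.strict_trans[OF jm[of 1] sx] by (intro bexI[of _ 1] divide_strict_left_mono) (auto intro!: mult_pos_pos)
      qed simp
      then show ?thesis using assms(1) unfolding log_deriv_cond_def m_def by linarith
    qed
    moreover have "0 < (\<Prod>j<r-1. s - real j * x)" using pos by (intro prod_pos) auto
    ultimately show ?thesis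
      using hprod_deriv[of x r s] x0 pos by (intro exI[of _ "(\<Prod>j<r-1. s - real j * x) * (1 - (\<Sum>j<r-1. real j / (s / x - real j)))"])
        (auto simp: less_imp_neq[symmetric])
  qed
  show "continuous_on {b..a} (\<lambda>a. hprod r a s)"
    unfolding hprod_def by (intro continuous_intros)
qed

lemma hprod_mono:
  assumes "log_deriv_cond k r" "k \<ge> 2" "r \<ge> 2" "0 < b" "b \<le> a" "(k + real r - 3) * a \<le> s"
  shows "hprod r b s \<le> hprod r a s"
  using hprod_strict_mono[OF assms(1-4), of a s] assms(5,6) by (cases "b = a") auto

text \<open>The recursion of the link argument: total weight times the bound for a link from which a
  vertex of weight \<open>a\<close> has been removed. The graph case is
  \<open>a * s\<close>.\<close>

lemma hprod_Suc:
  assumes "r \<ge> 2"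
  shows "hprod (Suc r) a s = s * hprod r a (s - a)"
proof -
  obtain q where r: "r = Suc (Suc q)" using assms by (metis Suc_le_D numeral_2_eq_2 Suc_le_mono)
  show ?thesis unfolding hprod_def r
    by (simp add: prod.lessThan_Suc_shift algebra_simps del: prod.lessThan_Suc)
qed

subsection \<open>Bounding the Lagrangian\<close>

text \<open>The number of parts is tied to the uniformity through \<open>m = k + r - 3\<close>:
  passing to a link lowers \<open>r\<close> and \<open>m\<close> together and leaves
  \<open>k\<close> alone.\<close>

definition lam :: "nat \<Rightarrow> nat \<Rightarrow> real" where
  "lam k r = falling_factorial (k + r - 3) r / real (k + r - 3) ^ r"

lemma real_m: "k \<ge> 3 \<Longrightarrow> real (k + r - 3) = real k + real r - 3"
  by (simp add: of_nat_diff)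

lemma lam_1: "k \<ge> 3 \<Longrightarrow> lam k 1 = 1"
  by (simp add: lam_def falling_factorial_def of_nat_diff)

text \<open>With \<open>k + r - 2\<close> the number of parts for \<open>Suc r\<close>, the factor
  is the loss suffered by the link of a vertex of weight exactly \<open>1/m\<close>. The link bound
  is therefore tight at this threshold weight.\<close>

lemma lam_Suc:
  assumes "k \<ge> 3"
  shows "lam k (Suc r) = lam k r * (1 - 1 / (real k + real r - 2)) ^ r"
proof (cases "k + r - 3")
  case 0
  then have "r = 0" "k = 3" using assms by auto
  then show ?thesis by (simp add: lam_def falling_factorial_def)
next
  case (Suc m')
  define m where "m = k + r - 3"
  have m: "k + Suc r - 3 = Suc m" "m > 0" "real k + real r - 2 = real m + 1"
    using assms Suc by (auto simp: m_def of_nat_diff)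
  have "falling_factorial (Suc m) (Suc r) = (real m + 1) * falling_factorial m r"
    unfolding falling_factorial_def by (simp add: prod.lessThan_Suc_shift del: prod.lessThan_Suc)
  moreover have "1 - 1 / (real m + 1) = real m / (real m + 1)" by (simp add: field_simps)
  moreover have "(real m + 1) * c / (real m + 1) ^ Suc r = c / real m ^ r * (real m / (real m + 1)) ^ r" for c
    using m(2) by (simp add: power_divide)
  ultimately show ?thesis
    unfolding lam_def m(1) m(3) m_def[symmetric] by (simp add: add.commute)
qed

text \<open>The factor \<open>k - 2\<close> of the graph bound is the last factor
  \<open>m - (r - 1)\<close> of the falling factorial, so the bound for weights capped by
  \<open>1/m\<close> is exactly the extremal value.\<close>

lemma lam_hprod:
  assumes "k \<ge> 3" "r \<ge> 2"
  shows "lam k r = (real k - 2) * hprod r (1 / (real k + real r - 3)) 1"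
proof -
  define m where "m = real k + real r - 3"
  have m: "m > 0" using assms by (simp add: m_def)
  obtain q where r: "r = Suc q" using assms by (cases r) auto
  have "falling_factorial (k + r - 3) r = (\<Prod>i<r-1. m - real i) * (real k - 2)"
    unfolding falling_factorial_def real_m[OF assms(1)] m_def[symmetric] r
    by (simp add: m_def r)
  moreover have "(\<Prod>j<r-1. 1 - real j * (1 / m)) = (\<Prod>i<r-1. m - real i) / m ^ (r - 1)"
  proof -
    have "(\<Prod>j<r-1. 1 - real j * (1 / m)) = (\<Prod>j<r-1. (m - real j) / m)"
      using m by (intro prod.cong) (auto simp: field_simps)
    then show ?thesis by (simp add: prod_dividef)
  qed
  moreover have "m ^ r = m * m ^ (r - 1)" by (simp add: r)
  ultimately show ?thesis
    unfolding lam_def hprod_def real_m[OF assms(1)] m_def[symmetric] by simp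
qed

lemma lam_pos:
  assumes "k \<ge> 3" "r \<ge> 1"
  shows "lam k r > 0"
  using assms(2)
proof (induction r rule: dec_induct)
  case base
  then show ?case using lam_1[OF assms(1)] by simp
next
  case (step r)
  then have "1 / (real k + real r - 2) < 1" using assms(1) by simp
  then show ?case using step by (simp add: lam_Suc[OF assms(1)])
qed

lemma wsum_zero:
  assumes "E \<subseteq> nsets S r" "r \<ge> 1" "\<And>i. i \<in> S \<Longrightarrow> x i = 0"
  shows "wsum E x = 0"
  unfolding wsum_def
proof (rule sum.neutral, rule ballI)
  fix e assume "e \<in> E"
  then have "e \<subseteq> S" "finite e" "e \<noteq> {}" using assms(1,2) by (auto simp: nsets_def)
  then obtain i where "i \<in> e" "x i = 0" using assms(3) by auto
  then show "prod x e = 0" using \<open>finite e\<close> by (meson prod_zero)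
qed

text \<open>For small \<open>t\<close> the linear gain outweighs the quadratic loss. The cap
  \<open>c\<close> leaves room for whatever constraints the shifted weights must still
  satisfy.\<close>

lemma shift_improves:
  fixes y :: "'v \<Rightarrow> real"
  assumes "finite S" "E \<subseteq> nsets S (Suc (Suc r))" "i \<in> S" "j \<in> S" "i \<noteq> j"
    and "wsum (link E i) y < wsum (link E j) y" "\<And>l. l \<in> S \<Longrightarrow> 0 \<le> y l" "c > 0"
  obtains t where "0 < t" "t \<le> c" "wsum E y < wsum E (y(i := y i - t, j := y j + t))"
proof -
  define A where "A = wsum (link (link E i) j) y"
  define d where "d = wsum (link E j) y - wsum (link E i) y"
  have "A \<ge> 0" unfolding A_def
    by (rule wsum_nonneg) (use assms(2,7) in \<open>auto simp: link_def nsets_def\<close>)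
  have "d > 0" using assms(6) by (simp add: d_def)
  \<comment> \<open>The \<open>+ 1\<close> guards against \<open>A = 0\<close> and makes
    \<open>t * A < d\<close> strict.\<close>
  define t where "t = min c (d / (A + 1))"
  have t: "0 < t" "t \<le> c" using \<open>c > 0\<close> \<open>d > 0\<close> \<open>A \<ge> 0\<close> by (auto simp: t_def)
  have "t \<le> d / (A + 1)" by (simp add: t_def)
  then have "t * (A + 1) \<le> d" using \<open>A \<ge> 0\<close> by (simp add: pos_le_divide_eq)
  then have "t * A < d" using t by (simp add: algebra_simps)
  then have "t * (t * A) < t * d" using t by simp
  then have "wsum E y < wsum E (y(i := y i - t, j := y j + t))"
    unfolding wsum_shift[OF assms(1,2,5)] A_def d_def by (simp add: power2_eq_square algebra_simps)
  with t that show thesis by blast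
qed

lemma sum_shift:
  fixes y :: "'v \<Rightarrow> real"
  assumes "finite S" "i \<in> S" "j \<in> S" "i \<noteq> j"
  shows "sum (y(i := y i - t, j := y j + t)) S = sum y S"
proof -
  have S: "S = insert i (insert j (S - {i,j}))" using assms by auto
  have "sum (y(i := y i - t, j := y j + t)) (S - {i,j}) = sum y (S - {i,j})"
    by (rule sum.cong) auto
  then show ?thesis using assms(1,4) by (subst (1 2) S) (simp add: sum.insert_if)
qed

text \<open>In an optimal weighting of the polytope, some vertex of maximal weight has maximal degree:
  otherwise weight could be moved away from it. Hence the bound passes to its link.\<close>

lemma polytope_bound:
  fixes S :: "'v set"
  assumes "k \<ge> 3" "r \<ge> 2" "log_deriv_cond (real k) r" "finite S" "E \<subseteq> nsets S r" "sparse k r S E"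
    and "\<And>i. i \<in> S \<Longrightarrow> 0 \<le> x i \<and> x i \<le> a" "a > 0" "(real k + real r - 3) * a \<le> sum x S"
  shows "fact r * wsum E x \<le> (real k - 2) * hprod r a (sum x S)"
  using assms(2-)
proof (induction r arbitrary: S E x a rule: dec_induct)
  case base
  have "2 * (\<Sum>e\<in>E. Min (x ` e)) \<le> (real k - 2) * sum x S"
    by (rule sum_Min_pairs_le) (use base sparse_2D in auto)
  then have "a * (2 * (\<Sum>e\<in>E. Min (x ` e))) \<le> a * ((real k - 2) * sum x S)"
    using base by (intro mult_left_mono) auto
  moreover have "wsum E x \<le> a * (\<Sum>e\<in>E. Min (x ` e))"
    by (rule wsum_pairs_le) (use base in auto)
  moreover have "hprod 2 a (sum x S) = a * sum x S" by (simp add: hprod_def)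
  ultimately show ?case by (simp add: algebra_simps)
next
  case (step r)
  note prems = step.prems
  define s where "s = sum x S"
  have fE: "finite E" using finite_nsets_sub prems(2,3) by blast
  obtain y where y: "\<And>i. i \<in> S \<Longrightarrow> 0 \<le> y i \<and> y i \<le> a" and ys: "sum y S = s" and
    ymax': "\<forall>z. (\<forall>i\<in>S. 0 \<le> z i \<and> z i \<le> a) \<longrightarrow> sum z S = s \<longrightarrow> wsum E z \<le> wsum E y"
    using wsum_maximizer[OF prems(2) fE _ prems(3), where z = x and a = a] prems(5)
    unfolding s_def by auto
  have ymax: "wsum E z \<le> wsum E y" if "\<And>i. i \<in> S \<Longrightarrow> 0 \<le> z i \<and> z i \<le> a" "sum z S = s" for z
    using that ymax' by auto
  have xy: "wsum E x \<le> wsum E y" using prems(5) by (intro ymax) (auto simp: s_def)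
  have k2: "real k \<ge> 2" using assms(1) by simp
  have hp: "0 \<le> (real k - 2) * hprod (Suc r) a s"
    using prems(6,7) k2 step.hyps unfolding s_def
    by (intro mult_nonneg_nonneg hprod_nonneg[of _ "real k"]) auto
  have "fact (Suc r) * wsum E y \<le> (real k - 2) * hprod (Suc r) a s"
  proof (cases "\<forall>i\<in>S. y i = 0")
    case True
    then have "wsum E y = 0" using wsum_zero[OF prems(3), of y] by auto
    then show ?thesis using hp by simp
  next
    case False
    then have Sne: "S \<noteq> {}" by auto
    define b where "b = Max (y ` S)"
    have yb: "y i \<le> b" if "i \<in> S" for i using that prems(2) by (simp add: b_def)
    obtain i1 where i1: "i1 \<in> S" "y i1 \<noteq> 0" using False by auto
    have b: "0 < b" using yb[OF i1(1)] y[OF i1(1)] i1(2) by linarith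
    have ba: "b \<le> a" unfolding b_def using prems(2) Sne y by (intro Max.boundedI) auto
    \<comment> \<open>Between two vertices of maximal weight a shift could violate the cap
      \<open>a\<close>, so among these one of largest degree is simply chosen; against lighter
      vertices optimality decides.\<close>
    define B where "B = {i\<in>S. y i = b}"
    have "b \<in> y ` S" unfolding b_def using prems(2) Sne by (intro Max_in) auto
    then have "B \<noteq> {}" "finite B" using prems(2) by (auto simp: B_def)
    then obtain i0 where i0: "i0 \<in> B" "\<And>j. j \<in> B \<Longrightarrow> wsum (link E j) y \<le> wsum (link E i0) y"
    proof -
      let ?D = "\<lambda>j. wsum (link E j) y"
      have "Max (?D ` B) \<in> ?D ` B" using \<open>B \<noteq> {}\<close> \<open>finite B\<close> by (intro Max_in) auto
      then obtain i where "i \<in> B" "?D i = Max (?D ` B)" by fastforce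
      then show thesis using that[of i] \<open>finite B\<close> by simp
    qed
    have i0S: "i0 \<in> S" "y i0 = b" using i0(1) by (auto simp: B_def)
    have deg: "wsum (link E j) y \<le> wsum (link E i0) y" if j: "j \<in> S" for j
    proof (cases "j \<in> B")
      case False
      then have jb: "y j < b" using yb[OF j] j by (auto simp: B_def)
      show ?thesis
      proof (rule ccontr)
        assume "\<not> ?thesis"
        then have gt: "wsum (link E i0) y < wsum (link E j) y" by simp
        have ne: "i0 \<noteq> j" using jb i0S by auto
        obtain q where q: "r = Suc q" using step.hyps by (cases r) auto
        \<comment> \<open>A shift of this size keeps \<open>i0\<close> nonnegative and
          \<open>j\<close> below \<open>b\<close>, hence stays inside the polytope.\<close>
        have "0 < min b (b - y j)" using jb b by simp
        from shift_improves[OF prems(2) prems(3)[unfolded q] i0S(1) j ne gt _ this]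
        obtain t where t: "0 < t" "t \<le> min b (b - y j)"
          "wsum E y < wsum E (y(i0 := y i0 - t, j := y j + t))"
          using y by blast
        have "wsum E (y(i0 := y i0 - t, j := y j + t)) \<le> wsum E y"
        proof (rule ymax)
          show "sum (y(i0 := y i0 - t, j := y j + t)) S = s"
            using sum_shift[OF prems(2) i0S(1) j ne] ys by simp
          show "0 \<le> (y(i0 := y i0 - t, j := y j + t)) i \<and> (y(i0 := y i0 - t, j := y j + t)) i \<le> a"
            if "i \<in> S" for i
            using t(1,2) ba i0S y[OF that] y[OF j] by auto
        qed
        with t(3) show False by simp
      qed
    qed (use i0 in blast)
    have "real (Suc r) * wsum E y = (\<Sum>i\<in>S. y i * wsum (link E i) y)"
      using wsum_euler[OF prems(2,3)] by simp
    also have "\<dots> \<le> (\<Sum>i\<in>S. y i * wsum (link E i0) y)"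
      using y deg by (intro sum_mono mult_left_mono) auto
    also have "\<dots> = s * wsum (link E i0) y" by (simp add: ys flip: sum_distrib_right)
    finally have 1: "real (Suc r) * wsum E y \<le> s * wsum (link E i0) y" .
    have sS: "sum y (S - {i0}) = s - b"
      using sum.remove[OF prems(2) i0S(1), of y] i0S(2) ys by simp
    have mb: "(real k + real (Suc r) - 3) * b \<le> s"
    proof -
      have "(real k + real (Suc r) - 3) * b \<le> (real k + real (Suc r) - 3) * a"
        using ba assms(1) by (intro mult_left_mono) auto
      then show ?thesis using prems(7) unfolding s_def by linarith
    qed
    have "fact r * wsum (link E i0) y \<le> (real k - 2) * hprod r b (sum y (S - {i0}))"
    proof (rule step.IH)
      show "log_deriv_cond (real k) r" using log_deriv_cond_Suc[OF prems(1) k2 step.hyps(1)] .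
      show "finite (S - {i0})" using prems(2) by simp
      show "link E i0 \<subseteq> nsets (S - {i0}) r" using link_nsets[OF prems(3)] .
      show "sparse k r (S - {i0}) (link E i0)"
        using sparse_link[OF prems(4) step.hyps(1) i0S(1) prems(2)] .
      show "0 \<le> y i \<and> y i \<le> b" if "i \<in> S - {i0}" for i using that yb y by auto
      show "(real k + real r - 3) * b \<le> sum y (S - {i0})"
        unfolding sS using mb by (simp add: algebra_simps)
    qed (rule b)
    then have 2: "fact r * wsum (link E i0) y \<le> (real k - 2) * hprod r b (s - b)"
      unfolding sS .
    have s0: "s \<ge> 0" unfolding ys[symmetric] using y by (intro sum_nonneg) auto
    have "fact (Suc r) * wsum E y = fact r * (real (Suc r) * wsum E y)"
      by (simp add: algebra_simps)
    also have "\<dots> \<le> fact r * (s * wsum (link E i0) y)" using 1 by (intro mult_left_mono) auto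
    also have "\<dots> = s * (fact r * wsum (link E i0) y)" by simp
    also have "\<dots> \<le> s * ((real k - 2) * hprod r b (s - b))" using 2 s0 by (intro mult_left_mono) auto
    also have "\<dots> = (real k - 2) * hprod (Suc r) b s" using hprod_Suc[OF step.hyps(1)] by simp
    \<comment> \<open>The link was bounded with the maximum \<open>b\<close> actually attained;
      monotonicity returns to the prescribed cap \<open>a\<close>.\<close>
    also have "\<dots> \<le> (real k - 2) * hprod (Suc r) a s"
      using prems(7) step.hyps k2 unfolding s_def
      by (intro mult_left_mono hprod_mono[OF prems(1) k2 _ b ba]) auto
    finally show ?thesis .
  qed
  moreover have "fact (Suc r) * wsum E x \<le> fact (Suc r) * wsum E y"
    using xy by (intro mult_left_mono) auto
  ultimately show ?case unfolding s_def by linarith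
qed

text \<open>The induction starts at \<open>r = 1\<close>, where the bound is the total weight
  itself. Graphs are then covered by the general step, which is why two hypotheses are conditional
  on \<open>r \<ge> 2\<close>. Homogeneity reduces the step to total weight 1.\<close>

theorem lagrangian_bound:
  fixes S :: "'v set"
  assumes "k \<ge> 3" "r \<ge> 1" "r \<ge> 2 \<Longrightarrow> log_deriv_cond (real k) r" "finite S" "E \<subseteq> nsets S r"
    "r \<ge> 2 \<Longrightarrow> sparse k r S E" "\<And>i. i \<in> S \<Longrightarrow> 0 \<le> x i"
  shows "fact r * wsum E x \<le> lam k r * (sum x S) ^ r"
  using assms(2-)
proof (induction r arbitrary: S E x rule: dec_induct)
  case base
  have "real 1 * wsum E x = (\<Sum>v\<in>S. x v * wsum (link E v) x)"
    using wsum_euler[of S E 1 x] base by simp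
  also have "\<dots> \<le> (\<Sum>v\<in>S. x v * 1)"
  proof (intro sum_mono mult_left_mono)
    show "wsum (link E v) x \<le> 1" for v
      using wsum_nsets_0[of "link E v" "S - {v}" x] link_nsets[of E S 0 v] base by simp
  qed (use base in auto)
  finally show ?case using lam_1[OF assms(1)] by simp
next
  case (step r)
  note prems = step.prems
  have r1: "r \<ge> 1" "Suc r \<ge> 2" using step.hyps by auto
  have fE: "finite E" using finite_nsets_sub prems(2,3) by blast
  have k2: "real k \<ge> 2" using assms(1) by simp
  define M where "M = real k + real r - 2"
  have M: "M \<ge> 2" "M = real k + real (Suc r) - 3" using assms(1) r1 by (auto simp: M_def)
  have unit: "fact (Suc r) * wsum E z \<le> lam k (Suc r)"
    if z: "\<And>i. i \<in> S \<Longrightarrow> 0 \<le> z i" "sum z S = 1" for z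
  proof -
    have z1: "0 \<le> z i \<and> z i \<le> 1" if "i \<in> S" for i
      using z sum_nonneg_leq_bound[OF prems(2) _ z(2) that] that by auto
    obtain y where y: "\<And>i. i \<in> S \<Longrightarrow> 0 \<le> y i \<and> y i \<le> 1" and ys: "sum y S = 1" and
      ymax': "\<forall>z. (\<forall>i\<in>S. 0 \<le> z i \<and> z i \<le> 1) \<longrightarrow> sum z S = 1 \<longrightarrow> wsum E z \<le> wsum E y"
      using wsum_maximizer[OF prems(2) fE _ prems(3), where z = z and a = 1] z1
      unfolding z(2) by auto
    have ymax: "wsum E z \<le> wsum E y" if "\<And>i. i \<in> S \<Longrightarrow> 0 \<le> z i \<and> z i \<le> 1" "sum z S = 1" for z
      using that ymax' by auto
    define b where "b = Max (y ` S)"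
    have Sne: "S \<noteq> {}" using ys by auto
    have yb: "y i \<le> b" if "i \<in> S" for i using that prems(2) by (simp add: b_def)
    have "b \<in> y ` S" unfolding b_def using prems(2) Sne by (intro Max_in) auto
    then obtain i0 where i0: "i0 \<in> S" "y i0 = b" by auto
    have b0: "0 \<le> b" "b \<le> 1" using i0 y by auto
    have "fact (Suc r) * wsum E y \<le> lam k (Suc r)"
    proof (cases "b \<le> 1 / M")
      case True
      have "fact (Suc r) * wsum E y \<le> (real k - 2) * hprod (Suc r) (1 / M) (sum y S)"
      proof (rule polytope_bound[OF assms(1) r1(2) prems(1)[OF r1(2)] prems(2,3) prems(4)[OF r1(2)]])
        show "0 \<le> y i \<and> y i \<le> 1 / M" if "i \<in> S" for i using y yb[OF that] True that by force
      qed (use M ys in auto)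
      also have "\<dots> = lam k (Suc r)" using lam_hprod[OF assms(1) r1(2)] ys M by simp
      finally show ?thesis .
    next
      case False
      then have bpos: "b > 0" using b0 M(1) by (smt (verit) divide_pos_pos)
      \<comment> \<open>The cap is now 1, which nonnegative weights of total 1 respect
        automatically, so weight may be shifted from \<open>i0\<close> to any other vertex.\<close>
      have deg: "wsum (link E j) y \<le> wsum (link E i0) y" if j: "j \<in> S" for j
      proof (rule ccontr)
        assume "\<not> ?thesis"
        then have gt: "wsum (link E i0) y < wsum (link E j) y" by simp
        then have ne: "i0 \<noteq> j" by auto
        obtain q where q: "r = Suc q" using r1 by (cases r) auto
        from shift_improves[OF prems(2) prems(3)[unfolded q] i0(1) j ne gt _ bpos]
        obtain t where t: "0 < t" "t \<le> b"
          "wsum E y < wsum E (y(i0 := y i0 - t, j := y j + t))"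
          using y by blast
        have "wsum E (y(i0 := y i0 - t, j := y j + t)) \<le> wsum E y"
        proof (rule ymax)
          show s1: "sum (y(i0 := y i0 - t, j := y j + t)) S = 1"
            using sum_shift[OF prems(2) i0(1) j ne] ys by simp
          have nn: "0 \<le> (y(i0 := y i0 - t, j := y j + t)) i" if "i \<in> S" for i
            using t(1,2) i0 y[OF that] y[OF j] by auto
          show "0 \<le> (y(i0 := y i0 - t, j := y j + t)) i \<and> (y(i0 := y i0 - t, j := y j + t)) i \<le> 1"
            if "i \<in> S" for i
            using nn[OF that] sum_nonneg_leq_bound[OF prems(2) nn s1 that] by blast
        qed
        with t(3) show False by simp
      qed
      have "real (Suc r) * wsum E y = (\<Sum>i\<in>S. y i * wsum (link E i) y)"
        using wsum_euler[OF prems(2,3)] by simp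
      also have "\<dots> \<le> (\<Sum>i\<in>S. y i * wsum (link E i0) y)"
        using y deg by (intro sum_mono mult_left_mono) auto
      also have "\<dots> = wsum (link E i0) y" by (simp add: ys flip: sum_distrib_right)
      finally have 1: "real (Suc r) * wsum E y \<le> wsum (link E i0) y" .
      have sS: "sum y (S - {i0}) = 1 - b"
        using sum.remove[OF prems(2) i0(1), of y] i0(2) ys by simp
      have 2: "fact r * wsum (link E i0) y \<le> lam k r * (sum y (S - {i0})) ^ r"
      proof (rule step.IH)
        show "log_deriv_cond (real k) r" if "r \<ge> 2" using log_deriv_cond_Suc[OF prems(1)[OF r1(2)] k2 that] .
        show "link E i0 \<subseteq> nsets (S - {i0}) r" using link_nsets[OF prems(3)] .
        show "sparse k r (S - {i0}) (link E i0)" if "r \<ge> 2"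
          using sparse_link[OF prems(4)[OF r1(2)] that i0(1) prems(2)] .
      qed (use prems y in auto)
      have "fact (Suc r) * wsum E y = fact r * (real (Suc r) * wsum E y)"
        by (simp add: algebra_simps)
      also have "\<dots> \<le> fact r * wsum (link E i0) y" using 1 by (intro mult_left_mono) auto
      also have "\<dots> \<le> lam k r * (1 - b) ^ r" using 2 unfolding sS .
      also have "\<dots> \<le> lam k r * (1 - 1 / M) ^ r"
        using False b0 lam_pos[OF assms(1) r1(1)] by (intro mult_left_mono power_mono) auto
      also have "\<dots> = lam k (Suc r)" using lam_Suc[OF assms(1)] by (simp add: M_def)
      finally show ?thesis .
    qed
    moreover have "wsum E z \<le> wsum E y" using ymax[OF z1 z(2)] .
    ultimately show ?thesis by (smt (verit) fact_gt_zero mult_left_mono)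
  qed
  define s where "s = sum x S"
  have s0: "s \<ge> 0" unfolding s_def using prems(5) by (intro sum_nonneg) auto
  show ?case
  proof (cases "s = 0")
    case True
    then have "x i = 0" if "i \<in> S" for i
      using that sum_nonneg_eq_0_iff[OF prems(2), of x] prems(5) unfolding s_def by auto
    then have "wsum E x = 0" by (intro wsum_zero[OF prems(3)]) auto
    then show ?thesis using True by (simp add: s_def)
  next
    case False
    define z where "z = (\<lambda>i. (1 / s) * x i)"
    have "fact (Suc r) * wsum E z \<le> lam k (Suc r)"
    proof (rule unit)
      show "sum z S = 1" unfolding z_def sum_distrib_left[symmetric] s_def[symmetric] using False by simp
    qed (use prems(5) s0 in \<open>auto simp: z_def\<close>)
    moreover have "wsum E z = (1 / s) ^ Suc r * wsum E x" unfolding z_def by (rule wsum_scale[OF prems(3)])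
    ultimately have "fact (Suc r) * wsum E x / s ^ Suc r \<le> lam k (Suc r)"
      by (simp add: power_one_over divide_simps)
    then show ?thesis using False s0 unfolding s_def[symmetric]
      by (simp add: pos_divide_le_eq)
  qed
qed

text \<open>Shifting \<open>t = sqrt \<delta>\<close> away from \<open>i\<close> can gain at most
  the deficit \<open>t * t\<close>, while the quadratic loss is at most \<open>t * t\<close> as
  well. Hence no degree exceeds that of \<open>i\<close> by more than \<open>2 * t\<close>; the
  lower bound on \<open>x i\<close> pays for the shift.\<close>

lemma near_optimal_degree:
  fixes S :: "'v set"
  assumes "finite S" "E \<subseteq> nsets S r" "r \<ge> 2" "\<And>i. i \<in> S \<Longrightarrow> 0 \<le> x i" "sum x S = 1"
    and "\<And>z. (\<And>i. i \<in> S \<Longrightarrow> 0 \<le> z i) \<Longrightarrow> sum z S = 1 \<Longrightarrow> fact r * wsum E z \<le> L"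
    and "L - \<delta> \<le> fact r * wsum E x" "\<delta> > 0" "i \<in> S" "sqrt \<delta> \<le> x i"
  shows "real r * wsum E x \<le> wsum (link E i) x + 2 * sqrt \<delta>"
proof -
  define t where "t = sqrt \<delta>"
  have t: "t > 0" "t * t = \<delta>" using assms(8) by (auto simp: t_def)
  obtain q where q: "r = Suc (Suc q)" using assms(3) by (metis Suc_le_D numeral_2_eq_2 Suc_le_mono)
  have deg: "wsum (link E j) x \<le> wsum (link E i) x + 2 * t" if j: "j \<in> S" for j
  proof (cases "i = j")
    case False
    define A where "A = wsum (link (link E i) j) x"
    have "link (link E i) j \<subseteq> nsets (S - {i} - {j}) q"
      using link_nsets[OF link_nsets[OF assms(2)[unfolded q]]] .
    moreover have "sum x (S - {i} - {j}) \<le> sum x S"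
      using assms(1,4) by (intro sum_mono2) auto
    ultimately have A: "A \<le> 1" unfolding A_def using assms(1,4,5)
      by (intro wsum_le_1[of "S - {i} - {j}" _ q]) auto
    have "fact r * wsum E (x(i := x i - t, j := x j + t)) \<le> L"
    proof (rule assms(6))
      show "sum (x(i := x i - t, j := x j + t)) S = 1"
        using sum_shift[OF assms(1,9) j False] assms(5) by simp
      show "0 \<le> (x(i := x i - t, j := x j + t)) l" if "l \<in> S" for l
        using assms(4)[OF that] assms(4)[OF j] assms(10) t by (auto simp: t_def)
    qed
    then have "fact r * (wsum E (x(i := x i - t, j := x j + t)) - wsum E x) \<le> \<delta>"
      using assms(7) by (simp add: algebra_simps)
    then have "wsum E (x(i := x i - t, j := x j + t)) - wsum E x \<le> \<delta>"
      using assms(8) fact_ge_1[of r] by (smt (verit) mult_le_cancel_right1)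
    then have "t * (wsum (link E j) x - wsum (link E i) x) \<le> t * t + t * t * A"
      unfolding wsum_shift[OF assms(1) assms(2)[unfolded q] False] A_def t(2)[symmetric]
      by (simp add: power2_eq_square)
    also have "\<dots> \<le> t * t + t * t * 1" using A t by (intro add_left_mono mult_left_mono) auto
    finally have "t * (wsum (link E j) x - wsum (link E i) x) \<le> t * (2 * t)" by simp
    then show ?thesis using t(1) by simp
  qed (use t in simp)
  have "real r * wsum E x = (\<Sum>j\<in>S. x j * wsum (link E j) x)"
    using wsum_euler[OF assms(1,2)] by simp
  also have "\<dots> \<le> (\<Sum>j\<in>S. x j * (wsum (link E i) x + 2 * t))"
    using assms(4) deg by (intro sum_mono mult_left_mono) auto
  also have "\<dots> = wsum (link E i) x + 2 * t" by (simp add: assms(5) flip: sum_distrib_right)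
  finally show ?thesis unfolding t_def .
qed

subsection \<open>Stability of the Lagrangian\<close>

text \<open>The weights are cut at height \<tau>, and edge minima add up over the two layers. The
  upper layer lives on at most \<open>k - 2\<close> vertices, where even the complete graph has
  average degree \<open>k - 3\<close>; so it saves its own total weight, which is at least
  \<open>x i0 - \<tau>\<close>.\<close>

lemma sum_Min_pairs_truncate:
  fixes x :: "'v \<Rightarrow> real"
  assumes "finite S" "E \<subseteq> nsets S 2" "sparse k 2 S E" "\<And>i. i \<in> S \<Longrightarrow> 0 \<le> x i" "\<tau> \<ge> 0"
    and "card {i\<in>S. x i > \<tau>} \<le> k - 2" "k \<ge> 3" "i0 \<in> S"
  shows "2 * (\<Sum>e\<in>E. Min (x ` e)) \<le> (real k - 2) * sum x S - (x i0 - \<tau>)"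
proof -
  define W where "W = {i\<in>S. x i > \<tau>}"
  define y z where "y = (\<lambda>i. min (x i) \<tau>)" and "z = (\<lambda>i. max (x i - \<tau>) 0)"
  have W: "W \<subseteq> S" "finite W" using assms(1) by (auto simp: W_def)
  have fE: "finite E" using finite_nsets_sub assms(1,2) by blast
  have Min_split: "Min (x ` e) = Min (y ` e) + (if e \<subseteq> W then Min (z ` e) else 0)" if "e \<in> E" for e
  proof -
    obtain u v where e: "e = {u,v}" "u \<in> S" "v \<in> S"
      using \<open>e \<in> E\<close> assms(2) by (auto simp: nsets_def card_2_iff)
    show ?thesis unfolding e(1) using e(2,3) by (auto simp: y_def z_def W_def)
  qed
  have 1: "2 * (\<Sum>e\<in>E. Min (y ` e)) \<le> (real k - 2) * sum y S"
    by (rule sum_Min_pairs_le[OF assms(1,2)])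
      (use assms(4,5) sparse_2D[OF assms(3,2)] in \<open>auto simp: y_def\<close>)
  have 2: "2 * (\<Sum>e\<in>{e\<in>E. e \<subseteq> W}. Min (z ` e)) \<le> (real k - 3) * sum z W"
  proof (rule sum_Min_pairs_le[OF W(2)])
    show "{e\<in>E. e \<subseteq> W} \<subseteq> nsets W 2" using assms(2) by (auto simp: nsets_def)
    show "2 * real (card {e\<in>{e\<in>E. e \<subseteq> W}. e \<subseteq> W'}) \<le> (real k - 3) * real (card W')" if W': "W' \<subseteq> W" for W'
    proof -
      have fW': "finite W'" using W' W(2) finite_subset by blast
      have "card {e\<in>{e\<in>E. e \<subseteq> W}. e \<subseteq> W'} \<le> card (nsets W' 2)"
        using assms(2) by (intro card_mono finite_imp_finite_nsets fW') (auto simp: nsets_def)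
      also have "\<dots> = card W' choose 2" using fW' by (simp add: card_nsets)
      finally have "2 * card {e\<in>{e\<in>E. e \<subseteq> W}. e \<subseteq> W'} \<le> card W' * (card W' - 1)"
        by (simp add: choose_two)
      also have "\<dots> \<le> card W' * (k - 3)"
        using card_mono[OF W(2) W'] assms(6) unfolding W_def[symmetric] by (intro mult_left_mono) auto
      finally have "real (2 * card {e\<in>{e\<in>E. e \<subseteq> W}. e \<subseteq> W'}) \<le> real (card W' * (k - 3))"
        by (rule of_nat_mono)
      then show ?thesis using assms(7) by (simp add: of_nat_diff mult.commute)
    qed
  qed (auto simp: z_def)
  have "(\<Sum>e\<in>E. Min (x ` e)) = (\<Sum>e\<in>E. Min (y ` e) + (if e \<subseteq> W then Min (z ` e) else 0))"
    by (rule sum.cong[OF refl]) (rule Min_split)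
  also have "\<dots> = (\<Sum>e\<in>E. Min (y ` e)) + (\<Sum>e\<in>{e\<in>E. e \<subseteq> W}. Min (z ` e))"
    using fE by (simp add: sum.distrib sum.inter_filter)
  finally have 3: "2 * (\<Sum>e\<in>E. Min (x ` e)) \<le> (real k - 2) * sum y S + (real k - 3) * sum z W"
    using 1 2 by simp
  have zS: "sum z S = sum z W"
    using W assms(1) by (intro sum.mono_neutral_right) (auto simp: z_def W_def)
  have "sum x S = (\<Sum>i\<in>S. y i + z i)" by (rule sum.cong) (auto simp: y_def z_def)
  then have 4: "sum x S = sum y S + sum z W" by (simp add: sum.distrib zS)
  have "x i0 - \<tau> \<le> z i0" by (simp add: z_def)
  also have "\<dots> \<le> sum z S" using assms(1,8) by (intro member_le_sum) (auto simp: z_def)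
  finally have "x i0 - \<tau> \<le> sum z W" using zS by simp
  moreover have "(real k - 2) * (sum y S + sum z W) = (real k - 2) * sum y S + (real k - 3) * sum z W + sum z W"
    by (simp add: algebra_simps)
  ultimately show ?thesis using 3 unfolding 4 by linarith
qed

definition near_optimal :: "nat \<Rightarrow> nat \<Rightarrow> real \<Rightarrow> 'v set \<Rightarrow> 'v set set \<Rightarrow> ('v \<Rightarrow> real) \<Rightarrow> bool" where
  "near_optimal k r \<delta> S E x \<longleftrightarrow> finite S \<and> E \<subseteq> nsets S r \<and> sparse k r S E \<and> (\<forall>i\<in>S. 0 \<le> x i) \<and>
     sum x S = 1 \<and> lam k r - \<delta> \<le> fact r * wsum E x"

text \<open>If at most \<open>k - 2\<close> weights came within \<theta> of the maximal weight
  \<open>a\<close>, truncation at \<open>a - \<theta>\<close> would cost more than near-optimality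
  permits. So there are \<open>k - 1\<close> such vertices, and as \<open>a\<close> is about
  \<open>1 / (k - 1)\<close> they carry almost everything.\<close>

lemma graph_stability:
  assumes "k \<ge> 3" "\<eta> > 0"
  shows "\<exists>\<delta>>0. \<forall>(S :: 'v set) E x. near_optimal k 2 \<delta> S E x \<longrightarrow>
    (\<exists>B\<subseteq>S. card B \<le> k + 2 - 3 \<and> 1 - \<eta> \<le> sum x B)"
proof -
  define m where "m = real k - 1"
  have m: "m \<ge> 2" using assms(1) by (simp add: m_def)
  have lam2: "lam k 2 = 1 - 1 / m" "lam k 2 = (real k - 2) * (1 / m)"
  proof -
    have "lam k 2 = (real k - 2) * hprod 2 (1 / (real k + real 2 - 3)) 1"
      by (rule lam_hprod) (use assms in auto)
    then show "lam k 2 = (real k - 2) * (1 / m)" by (simp add: hprod_def m_def)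
    then show "lam k 2 = 1 - 1 / m" using m by (simp add: m_def field_simps)
  qed
  \<comment> \<open>The first bound limits the total drop of \<open>m\<close> weights to
    \<open>\<eta> / 2\<close>, the second keeps the threshold \<open>a - \<theta>\<close>
    nonnegative.\<close>
  define \<theta> where "\<theta> = min (\<eta> / (2 * m)) (1 / (4 * m))"
  have th: "\<theta> > 0" "\<theta> \<le> \<eta> / (2 * m)" "\<theta> \<le> 1 / (4 * m)" using m assms(2) by (auto simp: \<theta>_def)
  have "1 / (4 * m) \<le> 1" using m by simp
  then have th1: "\<theta> \<le> 1" using th(3) by linarith
  \<comment> \<open>The deficit will be \<open>t * t\<close>. Truncation loses at least
    \<open>\<theta> / (2 * m)\<close>, twice the total error \<open>3 * k * t\<close>.\<close>
  define t where "t = \<theta> / (12 * m * real k)"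
  have "2 * 3 \<le> m * real k" using m assms(1) by (intro mult_mono) auto
  then have mk: "m * real k \<ge> 6" by simp
  have t0: "t > 0" using th(1) mk by (simp add: t_def)
  have tt: "t * (12 * m * real k) = \<theta>" using m assms(1) by (simp add: t_def)
  have tm: "t * m \<le> \<theta> / 12"
  proof -
    have "t * m * 12 \<le> t * m * 12 * real k" using t0 m assms(1) by simp
    then show ?thesis using tt by (simp add: algebra_simps)
  qed
  have t1: "t \<le> 1"
  proof -
    have "t * 1 \<le> t * m" using t0 m by (intro mult_left_mono) auto
    then show ?thesis using tm th1 by linarith
  qed
  have t2: "t \<le> 1 / (2 * m)"
    using tm th1 m by (simp add: field_simps)
  have d: "t * t \<le> t" using t0 t1 by simp
  show ?thesis
  proof (intro exI[of _ "t * t"] conjI allI impI)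
    show "0 < t * t" using t0 by simp
    fix S :: "'v set" and E x
    assume "near_optimal k 2 (t * t) S E x"
    then have S: "finite S" and E: "E \<subseteq> nsets S 2" and sp: "sparse k 2 S E"
      and x: "\<forall>i\<in>S. 0 \<le> x i" and sx: "sum x S = 1" and near: "lam k 2 - t * t \<le> fact 2 * wsum E x"
      unfolding near_optimal_def by blast+
    have Sne: "S \<noteq> {}" using sx by auto
    define a where "a = Max (x ` S)"
    have xa: "x i \<le> a" if "i \<in> S" for i using that S by (simp add: a_def)
    have "a \<in> x ` S" unfolding a_def using S Sne by (intro Max_in) auto
    then obtain i0 where i0: "i0 \<in> S" "x i0 = a" by auto
    have a0: "a \<ge> 0" using i0 x by auto
    have Minle: "wsum E x \<le> a * (\<Sum>e\<in>E. Min (x ` e))"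
      by (rule wsum_pairs_le[OF S E]) (use x xa in auto)
    have "2 * (\<Sum>e\<in>E. Min (x ` e)) \<le> (real k - 2) * sum x S"
      by (rule sum_Min_pairs_le[OF S E]) (use x sparse_2D[OF sp E] in auto)
    then have "a * (2 * (\<Sum>e\<in>E. Min (x ` e))) \<le> a * (real k - 2)"
      using a0 sx by (intro mult_left_mono) auto
    then have "(real k - 2) * (1 / m) - t * t \<le> (real k - 2) * a"
      using near Minle unfolding lam2(2) by (simp add: algebra_simps)
    then have "(real k - 2) * (1 / m - a) \<le> t * t" by (simp add: algebra_simps)
    moreover have "1 / m - a \<le> (real k - 2) * (1 / m - a) \<or> 1 / m - a \<le> 0"
    proof (cases "1 / m - a \<le> 0")
      case False
      then have "1 * (1 / m - a) \<le> (real k - 2) * (1 / m - a)"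
        using assms(1) by (intro mult_right_mono) auto
      then show ?thesis by simp
    qed simp
    moreover have "0 \<le> t * t" by simp
    ultimately have alow: "1 / m - t * t \<le> a" by linarith
    have half: "1 / (2 * m) \<le> a"
    proof -
      have "1 / m = 1 / (2 * m) + 1 / (2 * m)" by simp
      then show ?thesis using alow d t2 by linarith
    qed
    have sq: "sqrt (t * t) = t" using t0 by simp
    \<comment> \<open>The heaviest vertex has nearly the largest degree, but its degree is at most
      the remaining weight \<open>1 - a\<close>; this bounds \<open>a\<close> from above.\<close>
    have "real 2 * wsum E x \<le> wsum (link E i0) x + 2 * sqrt (t * t)"
    proof (rule near_optimal_degree[OF S E _ _ sx _ near])
      show "fact 2 * wsum E z \<le> lam k 2" if "\<And>i. i \<in> S \<Longrightarrow> 0 \<le> z i" "sum z S = 1" for z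
        using lagrangian_bound[OF assms(1) _ _ S E, of z] sp that
        by (simp add: log_deriv_cond_def lessThan_Suc numeral_2_eq_2)
      show "sqrt (t * t) \<le> x i0" unfolding sq i0(2) using half t2 by linarith
    qed (use x t0 i0 in auto)
    moreover have "wsum (link E i0) x \<le> 1 - a"
    proof -
      have lk: "link E i0 \<subseteq> nsets (S - {i0}) 1"
        using link_nsets[of E S 1 i0] E by (simp add: numeral_2_eq_2)
      have "fact 1 * wsum (link E i0) x \<le> lam k 1 * (sum x (S - {i0})) ^ 1"
        by (rule lagrangian_bound[OF assms(1) _ _ _ lk]) (use S x in auto)
      then have "wsum (link E i0) x \<le> sum x (S - {i0})" using lam_1[OF assms(1)] by simp
      then show ?thesis using sum.remove[OF S i0(1), of x] sx i0(2) by simp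
    qed
    ultimately have aup: "a \<le> 1 / m + t * t + 2 * t"
      using near unfolding lam2(1) sq by simp
    define \<tau> where "\<tau> = a - \<theta>"
    have "1 / (4 * m) \<le> 1 / (2 * m)" using m by (simp add: field_simps)
    then have tau: "\<tau> \<ge> 0" unfolding \<tau>_def using half th(3) by linarith
    define W where "W = {i\<in>S. x i > \<tau>}"
    have "\<not> card W \<le> k - 2"
    proof
      assume "card W \<le> k - 2"
      then have "2 * (\<Sum>e\<in>E. Min (x ` e)) \<le> (real k - 2) * sum x S - (x i0 - \<tau>)"
        using x unfolding W_def by (intro sum_Min_pairs_truncate[OF S E sp _ tau _ assms(1) i0(1)]) auto
      then have "2 * (\<Sum>e\<in>E. Min (x ` e)) \<le> (real k - 2) - \<theta>"
        unfolding i0(2) sx \<tau>_def by simp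
      then have "a * (2 * (\<Sum>e\<in>E. Min (x ` e))) \<le> a * ((real k - 2) - \<theta>)"
        using a0 by (intro mult_left_mono)
      then have 1: "(real k - 2) * (1 / m) - t * t \<le> (real k - 2) * a - a * \<theta>"
        using near Minle unfolding lam2(2) by (simp add: algebra_simps)
      have "(real k - 2) * a \<le> (real k - 2) * (1 / m + t * t + 2 * t)"
        using aup assms(1) by (intro mult_left_mono) auto
      then have 2: "a * \<theta> \<le> t * t + (real k - 2) * (t * t + 2 * t)"
        using 1 by (simp add: algebra_simps)
      also have "\<dots> \<le> t + (real k - 2) * (t + 2 * t)"
        using d assms(1) by (intro add_mono mult_left_mono) auto
      also have "\<dots> \<le> 3 * real k * t" using t0 by (simp add: algebra_simps)
      finally have 3: "a * \<theta> \<le> 3 * real k * t" .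
      have "1 / (2 * m) * \<theta> \<le> a * \<theta>" using half th(1) by (intro mult_right_mono) auto
      then have "1 / (2 * m) * \<theta> \<le> 3 * real k * t" using 3 by linarith
      then have "\<theta> \<le> 6 * m * real k * t" using m by (simp add: field_simps)
      then have "2 * \<theta> \<le> t * (12 * m * real k)" by (simp add: algebra_simps)
      then show False unfolding tt using th(1) by linarith
    qed
    then have "k - 1 \<le> card W" by simp
    then obtain B where B: "B \<subseteq> W" "card B = k - 1" by (meson obtain_subset_with_card_n)
    have fB: "finite B" using B(1) S finite_subset[of B S] by (auto simp: W_def)
    have "m * \<tau> = (\<Sum>i\<in>B. \<tau>)" using B(2) assms(1) by (simp add: m_def of_nat_diff)
    also have "\<dots> \<le> sum x B" using B(1) by (intro sum_mono) (auto simp: W_def)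
    finally have 1: "m * \<tau> \<le> sum x B" .
    have "m * \<tau> \<ge> m * (1 / m - t * t - \<theta>)"
      using m alow by (intro mult_left_mono) (auto simp: \<tau>_def)
    moreover have "m * (1 / m - t * t - \<theta>) = 1 - m * (t * t) - m * \<theta>"
      using m by (simp add: algebra_simps)
    moreover have "m * (t * t) \<le> m * t" using d m by (intro mult_left_mono) auto
    moreover have "m * t \<le> \<theta> / 12" using tm by (simp add: mult.commute)
    moreover have "m * \<theta> \<le> m * (\<eta> / (2 * m))" using th(2) m by (intro mult_left_mono) auto
    moreover have "m * (\<eta> / (2 * m)) = \<eta> / 2" using m by simp
    moreover have "\<theta> \<le> m * \<theta>" using m th(1) by simp
    ultimately have "1 - \<eta> \<le> sum x B" using 1 th(1) by linarith
    then show "\<exists>B\<subseteq>S. card B \<le> k + 2 - 3 \<and> 1 - \<eta> \<le> sum x B"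
      using B by (intro exI[of _ B]) (auto simp: W_def)
  qed
qed

text \<open>The same \<eta> serves at every level: a set carrying the share
  \<open>1 - \<eta>\<close> of the weight outside \<open>i0\<close> carries, together with
  \<open>i0\<close>, at least this share of the whole.\<close>

theorem lagrangian_stability:
  assumes "k \<ge> 3" "r \<ge> 2" "log_deriv_cond (real k) r" "\<eta> > 0"
  shows "\<exists>\<delta>>0. \<forall>(S :: 'v set) E x. near_optimal k r \<delta> S E x \<longrightarrow>
    (\<exists>B\<subseteq>S. card B \<le> k + r - 3 \<and> 1 - \<eta> \<le> sum x B)"
  using assms(2,3)
proof (induction r rule: dec_induct)
  case base
  show ?case using graph_stability[OF assms(1,4)] .
next
  case (step r)
  have r: "r \<ge> 1" "r \<ge> 2" "Suc r \<ge> 2" using step.hyps by auto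
  have k2: "real k \<ge> 2" using assms(1) by simp
  have cr: "log_deriv_cond (real k) r" using log_deriv_cond_Suc[OF step.prems k2 step.hyps(1)] .
  from step.IH[OF cr] obtain \<delta>r where dr: "\<delta>r > 0" and IH: "\<And>(S :: 'v set) E x. near_optimal k r \<delta>r S E x \<Longrightarrow>
     \<exists>B\<subseteq>S. card B \<le> k + r - 3 \<and> 1 - \<eta> \<le> sum x B"
    by blast
  define M where "M = real k + real r - 2"
  have M: "M \<ge> 2" "real k + real (Suc r) - 3 = M" using assms(1) r by (auto simp: M_def)
  have M1: "1 - 1 / M > 0" using M(1) by simp
  define l where "l = lam k (Suc r)"
  have l: "l = lam k r * (1 - 1 / M) ^ r" using lam_Suc[OF assms(1)] by (simp add: l_def M_def)
  have "(1 - 1 / M) ^ r \<noteq> 0" using M1 by (intro power_not_zero) linarith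
  then have ll: "l / (1 - 1 / M + 0) ^ r = lam k r"
    unfolding l add_0_right by (rule nonzero_mult_div_cancel_right)
  \<comment> \<open>\<open>h\<close> is the permitted shortfall of the maximal weight below
    \<open>1 / M\<close>. Rescaling the link by \<open>1 - 1 / M + h\<close> instead of
    \<open>1 - 1 / M\<close> has to cost less than \<open>\<delta>r\<close>, the deficit tolerated
    in the link.\<close>
  have "((\<lambda>h. l / (1 - 1 / M + h) ^ r) \<longlongrightarrow> l / (1 - 1 / M + 0) ^ r) (at_right 0)"
    using M1 by (intro tendsto_intros) auto
  then have "eventually (\<lambda>h. l / (1 - 1 / M + h) ^ r > lam k r - \<delta>r) (at_right 0)"
    unfolding ll by (rule order_tendstoD) (use dr in simp)
  moreover have "eventually (\<lambda>h. h < 1 / (2 * M)) (at_right 0)"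
    using M(1) by (intro order_tendstoD(2)[OF tendsto_ident_at]) auto
  moreover have "eventually (\<lambda>h. h > (0::real)) (at_right 0)" by (rule eventually_at_right_less)
  ultimately have "eventually (\<lambda>h. l / (1 - 1 / M + h) ^ r > lam k r - \<delta>r \<and> h < 1 / (2 * M) \<and> h > 0) (at_right 0)"
    by eventually_elim auto
  then obtain h where h: "l / (1 - 1 / M + h) ^ r > lam k r - \<delta>r" "h < 1 / (2 * M)" "h > 0"
    using eventually_happens'[OF trivial_limit_at_right_real] by blast
  have hM: "1 / M = 1 / (2 * M) + 1 / (2 * M)" by simp
  have gap: "(real k - 2) * hprod (Suc r) (1 / M - h) 1 < l"
  proof -
    have "hprod (Suc r) (1 / M - h) 1 < hprod (Suc r) (1 / M) 1"
      using h M by (intro hprod_strict_mono[OF step.prems k2 r(3)]) (auto simp: field_simps)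
    then have "(real k - 2) * hprod (Suc r) (1 / M - h) 1 < (real k - 2) * hprod (Suc r) (1 / M) 1"
      using assms(1) by (intro mult_strict_left_mono) auto
    also have "\<dots> = l" unfolding l_def lam_hprod[OF assms(1) r(3)] M(2) ..
    finally show ?thesis .
  qed
  \<comment> \<open>The deficit \<open>d\<close> has three tasks: the rescaled link stays within
    \<open>\<delta>r\<close> of its optimum, a maximal weight of at most \<open>1 / M - h\<close>
    becomes impossible, and \<open>sqrt d\<close> stays below the maximal weight, as
    \<open>near_optimal_degree\<close> requires.\<close>
  have l0: "((\<lambda>d. (l - d - fact r * (2 * sqrt d)) / (1 - 1 / M + h) ^ r) \<longlongrightarrow>
      (l - 0 - fact r * (2 * sqrt 0)) / (1 - 1 / M + h) ^ r) (at_right 0)"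
    using M1 h(3) by (intro tendsto_intros) auto
  have "eventually (\<lambda>d. (l - d - fact r * (2 * sqrt d)) / (1 - 1 / M + h) ^ r > lam k r - \<delta>r) (at_right 0)"
    by (rule order_tendstoD(1)[OF l0]) (use h(1) in simp)
  moreover have "((\<lambda>d. l - d) \<longlongrightarrow> l - 0) (at_right 0)" by (intro tendsto_intros)
  then have "eventually (\<lambda>d. l - d > (real k - 2) * hprod (Suc r) (1 / M - h) 1) (at_right 0)"
    by (rule order_tendstoD(1)) (use gap in simp)
  moreover have "((\<lambda>d. sqrt d) \<longlongrightarrow> sqrt 0) (at_right 0)" by (intro tendsto_intros)
  then have "eventually (\<lambda>d. sqrt d < 1 / (2 * M)) (at_right 0)"
    by (rule order_tendstoD(2)) (use M in simp)
  moreover have "eventually (\<lambda>h. h > (0::real)) (at_right 0)" by (rule eventually_at_right_less)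
  ultimately have "eventually (\<lambda>d. (l - d - fact r * (2 * sqrt d)) / (1 - 1 / M + h) ^ r > lam k r - \<delta>r \<and>
     l - d > (real k - 2) * hprod (Suc r) (1 / M - h) 1 \<and> sqrt d < 1 / (2 * M) \<and> d > 0) (at_right 0)"
    by eventually_elim auto
  then obtain d where d: "(l - d - fact r * (2 * sqrt d)) / (1 - 1 / M + h) ^ r > lam k r - \<delta>r"
     "l - d > (real k - 2) * hprod (Suc r) (1 / M - h) 1" "sqrt d < 1 / (2 * M)" "d > 0"
    using eventually_happens'[OF trivial_limit_at_right_real] by blast
  show ?case
  proof (intro exI[of _ d] conjI allI impI)
    fix S :: "'v set" and E x
    assume "near_optimal k (Suc r) d S E x"
    then have S: "finite S" and E: "E \<subseteq> nsets S (Suc r)" and sp: "sparse k (Suc r) S E"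
      and x: "\<forall>i\<in>S. 0 \<le> x i" and sx: "sum x S = 1" and near: "lam k (Suc r) - d \<le> fact (Suc r) * wsum E x"
      unfolding near_optimal_def by blast+
    have Sne: "S \<noteq> {}" using sx by auto
    define a where "a = Max (x ` S)"
    have xa: "x i \<le> a" if "i \<in> S" for i using that S by (simp add: a_def)
    have "a \<in> x ` S" unfolding a_def using S Sne by (intro Max_in) auto
    then obtain i0 where i0: "i0 \<in> S" "x i0 = a" by auto
    have sr: "sum x (S - {i0}) = 1 - a" using sum.remove[OF S i0(1), of x] sx i0(2) by simp
    have a1: "a \<le> 1"
      using sum_nonneg[of "S - {i0}" x] x sr by simp
    have alow: "a > 1 / M - h"
    proof (rule ccontr)
      assume "\<not> ?thesis"
      then have "fact (Suc r) * wsum E x \<le> (real k - 2) * hprod (Suc r) (1 / M - h) (sum x S)"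
      proof (intro polytope_bound[OF assms(1) r(3) step.prems S E sp])
        show "0 \<le> x i \<and> x i \<le> 1 / M - h" if "i \<in> S" for i
          using x xa[OF that] \<open>\<not> 1 / M - h < a\<close> that by fastforce
        have "0 < 1 / (2 * M)" using M(1) by simp
        then show "1 / M - h > 0" using h(2) hM by linarith
        have "M * (1 / M - h) = 1 - M * h" using M(1) by (simp add: algebra_simps)
        moreover have "0 \<le> M * h" using M(1) h(3) by simp
        ultimately show "(real k + real (Suc r) - 3) * (1 / M - h) \<le> sum x S"
          unfolding M(2) sx by linarith
      qed
      then show False using d(2) near unfolding sx l_def by simp
    qed
    then have half: "a > 1 / (2 * M)" using h(2) hM by linarith
    define D where "D = wsum (link E i0) x"
    have D0: "D \<ge> 0" unfolding D_def
      by (rule wsum_nonneg) (use E x in \<open>auto simp: link_def nsets_def\<close>)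
    have "real (Suc r) * wsum E x \<le> D + 2 * sqrt d" unfolding D_def
    proof (rule near_optimal_degree[OF S E _ _ sx _ near])
      show "fact (Suc r) * wsum E z \<le> lam k (Suc r)" if "\<And>i. i \<in> S \<Longrightarrow> 0 \<le> z i" "sum z S = 1" for z
        using lagrangian_bound[OF assms(1) _ step.prems S E sp, of z] that by simp
      show "sqrt d \<le> x i0" unfolding i0(2) using half d(3) by linarith
    qed (use x i0 r d in auto)
    then have "fact r * (real (Suc r) * wsum E x) \<le> fact r * (D + 2 * sqrt d)"
      by (intro mult_left_mono) auto
    then have D1: "l - d - fact r * (2 * sqrt d) \<le> fact r * D"
      using near unfolding l_def by (simp add: algebra_simps)
    show "\<exists>B\<subseteq>S. card B \<le> k + Suc r - 3 \<and> 1 - \<eta> \<le> sum x B"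
    proof (cases "a = 1")
      \<comment> \<open>All weight sits on \<open>i0\<close>, and its link cannot be rescaled to
        total weight 1.\<close>
      case True
      then show ?thesis using i0 assms(1,4) by (intro exI[of _ "{i0}"]) auto
    next
      case False
      then have a1': "1 - a > 0" using a1 by simp
      define y where "y = (\<lambda>i. (1 / (1 - a)) * x i)"
      have lk: "link E i0 \<subseteq> nsets (S - {i0}) r" by (rule link_nsets[OF E])
      have "\<exists>B\<subseteq>S - {i0}. card B \<le> k + r - 3 \<and> 1 - \<eta> \<le> sum y B"
      proof (rule IH, unfold near_optimal_def, intro conjI lk)
        show "sparse k r (S - {i0}) (link E i0)" by (rule sparse_link[OF sp r(2) i0(1) S])
        show "\<forall>i\<in>S - {i0}. 0 \<le> y i" using x a1' by (simp add: y_def)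
        show "sum y (S - {i0}) = 1" unfolding y_def sum_distrib_left[symmetric] sr using a1' by simp
        have "lam k r - \<delta>r \<le> (l - d - fact r * (2 * sqrt d)) / (1 - 1 / M + h) ^ r" using d(1) by simp
        also have "\<dots> \<le> (fact r * D) / (1 - 1 / M + h) ^ r"
          using D1 M1 h(3) by (intro divide_right_mono) auto
        also have "\<dots> \<le> (fact r * D) / (1 - a) ^ r"
        proof (rule divide_left_mono)
          show "(1 - a) ^ r \<le> (1 - 1 / M + h) ^ r" using alow a1' by (intro power_mono) auto
        qed (use D0 M1 h(3) a1' in auto)
        also have "\<dots> = fact r * wsum (link E i0) y"
          unfolding y_def wsum_scale[OF lk] D_def by (simp add: power_one_over divide_simps)
        finally show "lam k r - \<delta>r \<le> fact r * wsum (link E i0) y" .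
      qed (use S lk in auto)
      then obtain B where B: "B \<subseteq> S - {i0}" "card B \<le> k + r - 3" "1 - \<eta> \<le> sum y B" by blast
      have fB: "finite B" using B(1) S by (meson finite_Diff finite_subset)
      have "sum x (insert i0 B) = a + sum x B" using B(1) fB i0(2) by (subst sum.insert) auto
      also have "sum x B = (1 - a) * sum y B" unfolding y_def sum_distrib_left[symmetric] using a1' by simp
      also have "a + \<dots> \<ge> a + (1 - a) * (1 - \<eta>)" using B(3) a1' by (intro add_left_mono mult_left_mono) auto
      finally have "a + (1 - a) * (1 - \<eta>) \<le> sum x (insert i0 B)" .
      moreover have "a + (1 - a) * (1 - \<eta>) = 1 - \<eta> + a * \<eta>" by (simp add: algebra_simps)
      moreover have "a \<ge> 0" using x i0 by auto
      then have "a * \<eta> \<ge> 0" using assms(4) by simp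
      moreover have "card (insert i0 B) \<le> k + Suc r - 3"
        using B(2) assms(1) card_insert_le_m1[of "k + Suc r - 3" B i0] by simp
      ultimately show ?thesis using B(1) i0(1) by (intro exI[of _ "insert i0 B"]) auto
    qed
  qed (rule d)
qed

section \<open>From the maximizer \<open>M_last\<close> to the derivative condition\<close>

lemma f_ratio_hprod:
  assumes "x \<ge> 2" "r \<ge> 2"
  shows "f_ratio r x = hprod r (1 / (x + real r - 3)) 1"
proof -
  define N where "N = x + real r - 3"
  have N: "N > 0" using assms by (simp add: N_def)
  have "(\<Prod>i=1..r-1. x + real i - 2) = (\<Prod>j<r-1. N - real j)"
    using assms(2)
    by (intro prod.reindex_bij_witness[of _ "\<lambda>j. r - 1 - j" "\<lambda>i. r - 1 - i"])
      (auto simp: N_def of_nat_diff)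
  moreover have "(\<Prod>j<r-1. 1 - real j * (1 / N)) = (\<Prod>j<r-1. N - real j) / N ^ (r - 1)"
  proof -
    have "(\<Prod>j<r-1. 1 - real j * (1 / N)) = (\<Prod>j<r-1. (N - real j) / N)"
      using N by (intro prod.cong) (auto simp: field_simps)
    then show ?thesis by (simp add: prod_dividef)
  qed
  moreover have "N ^ r = N * N ^ (r - 1)" using assms(2) by (cases r) auto
  ultimately show ?thesis unfolding f_ratio_def hprod_def N_def[symmetric] by simp
qed

lemma f_ratio_bounds:
  assumes "x \<ge> 2" "r \<ge> 2"
  shows "0 < f_ratio r x" "f_ratio r x \<le> 1 / (x - 1)"
proof -
  define N where "N = x + real r - 3"
  have N: "N \<ge> x - 1" "x - 1 > 0" using assms by (auto simp: N_def)
  have fac: "0 < 1 - real j * (1 / N)" "1 - real j * (1 / N) \<le> 1" if "j < r - 1" for j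
    using that assms N by (auto simp: N_def field_simps)
  have "0 < (\<Prod>j<r-1. 1 - real j * (1 / N))" using fac by (intro prod_pos) auto
  moreover have "(\<Prod>j<r-1. 1 - real j * (1 / N)) \<le> 1"
    using fac by (intro prod_le_1) (auto intro: less_imp_le)
  ultimately have "0 < hprod r (1 / N) 1" "hprod r (1 / N) 1 \<le> 1 / N"
    unfolding hprod_def using N by (auto simp: divide_simps)
  moreover have "1 / N \<le> 1 / (x - 1)" using N by (intro divide_left_mono) auto
  ultimately show "0 < f_ratio r x" "f_ratio r x \<le> 1 / (x - 1)"
    unfolding f_ratio_hprod[OF assms] N_def[symmetric] by auto
qed

text \<open>\<open>GREATEST\<close> is meaningful only if a largest maximizer exists. The bound
  \<open>1 / (x - 1)\<close> pushes \<open>f_ratio\<close> below its value at 2 beyond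
  \<open>X\<close>, so the maximizers form a nonempty closed subset of a compact interval.\<close>

lemma M_last_maximizes:
  assumes "r \<ge> 2"
  shows "M_last r \<ge> 2 \<and> (\<forall>y\<ge>2. f_ratio r y \<le> f_ratio r (M_last r))"
proof -
  let ?f = "f_ratio r"
  have f2: "?f 2 > 0" using f_ratio_bounds(1)[OF _ assms] by simp
  define X where "X = 2 + 1 / ?f 2"
  have X: "X \<ge> 2" using f2 by (simp add: X_def)
  have beyond: "?f y < ?f 2" if "y > X" for y
  proof -
    have y: "y \<ge> 2" "y - 1 > 1 / ?f 2" using that X unfolding X_def by linarith+
    have "?f y \<le> 1 / (y - 1)" using f_ratio_bounds(2)[OF y(1) assms] .
    also have "\<dots> < ?f 2" using y f2 by (simp add: field_simps)
    finally show ?thesis .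
  qed
  have cont: "continuous_on {2..X} ?f"
    unfolding f_ratio_def using assms by (intro continuous_intros) auto
  obtain x0 where x0: "x0 \<in> {2..X}" "\<And>y. y \<in> {2..X} \<Longrightarrow> ?f y \<le> ?f x0"
    using continuous_attains_sup[OF _ _ cont] X by auto
  have x0max: "?f y \<le> ?f x0" if "y \<ge> 2" for y
    using x0(2)[of y] x0(2)[of 2] beyond[of y] X that by fastforce
  define K where "K = {x\<in>{2..X}. ?f x = ?f x0}"
  have "closed K" unfolding K_def
    using continuous_closed_preimage_constant[OF cont] by simp
  then have "compact ({2..X} \<inter> K)" by (rule compact_Int_closed[OF compact_Icc])
  moreover have "{2..X} \<inter> K = K" by (auto simp: K_def)
  ultimately have "compact K" by simp
  have "K \<noteq> {}" using x0(1) unfolding K_def by blast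
  from compact_attains_sup[OF \<open>compact K\<close> this]
  obtain s where s: "s \<in> K" "\<And>t. t \<in> K \<Longrightarrow> t \<le> s" by auto
  have sP: "s \<ge> 2 \<and> (\<forall>y\<ge>2. ?f y \<le> ?f s)" using s(1) x0max by (auto simp: K_def)
  have "M_last r = s" unfolding M_last_def
  proof (rule Greatest_equality)
    show "s \<ge> 2 \<and> (\<forall>y\<ge>2. ?f y \<le> ?f s)" by (rule sP)
    fix y assume y: "y \<ge> 2 \<and> (\<forall>z\<ge>2. ?f z \<le> ?f y)"
    then have "?f y = ?f x0" using x0max[of y] x0(1) by (simp add: order_antisym)
    moreover have "y \<le> X" using beyond[of y] y by force
    ultimately show "y \<le> s" using s(2)[of y] y by (simp add: K_def)
  qed
  then show ?thesis using sP by simp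
qed

text \<open>If the condition failed at \<open>M\<close>, a slightly smaller
  \<open>a = 1 / N\<close>, that is a point slightly to the right of \<open>M\<close>, would
  increase \<open>f_ratio\<close>. Only moves to the right occur, so the boundary case
  \<open>M = 2\<close> is included. From \<open>M\<close> to \<open>k\<close> the denominators
  grow.\<close>

lemma log_deriv_cond_M_last:
  assumes "r \<ge> 2" "k \<ge> M_last r"
  shows "log_deriv_cond k r"
proof -
  define M where "M = M_last r"
  have M: "M \<ge> 2" "\<And>y. y \<ge> 2 \<Longrightarrow> f_ratio r y \<le> f_ratio r M"
    using M_last_maximizes[OF assms(1)] by (auto simp: M_def)
  define N where "N = M + real r - 3"
  have N: "N > 0" "\<And>j. j < r - 1 \<Longrightarrow> real j < N" using M(1) assms(1) by (auto simp: N_def)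
  have "log_deriv_cond M r"
  proof (rule ccontr)
    assume "\<not> log_deriv_cond M r"
    then have gt: "(\<Sum>j<r-1. real j / (N - real j)) > 1" unfolding log_deriv_cond_def N_def by simp
    have pos: "0 < 1 - real j * (1 / N)" if "j < r - 1" for j using N(1) N(2)[OF that] by simp
    define D where "D = (\<Prod>j<r-1. 1 - real j * (1 / N)) * (1 - (\<Sum>j<r-1. real j / (N - real j)))"
    have "0 < (\<Prod>j<r-1. 1 - real j * (1 / N))" using pos by (intro prod_pos) auto
    then have "D < 0" unfolding D_def using gt by (intro mult_pos_neg) auto
    moreover have "((\<lambda>a. hprod r a 1) has_real_derivative D) (at (1 / N))"
      using hprod_deriv[of "1 / N" r 1] N(1) pos unfolding D_def by (force simp: less_imp_neq[symmetric])
    ultimately obtain d where d: "d > 0" "\<And>h. h > 0 \<Longrightarrow> h < d \<Longrightarrow> hprod r (1 / N) 1 < hprod r (1 / N - h) 1"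
      using DERIV_neg_dec_left by blast
    define h where "h = min (d / 2) (1 / (2 * N))"
    have h: "h > 0" "h < d" "h \<le> 1 / (2 * N)" using d(1) N(1) by (auto simp: h_def)
    define a where "a = 1 / N - h"
    have "1 / N = 1 / (2 * N) + 1 / (2 * N)" by simp
    moreover have "1 / (2 * N) > 0" using N(1) by simp
    ultimately have a: "0 < a" "a < 1 / N" using h unfolding a_def by linarith+
    define y where "y = 1 / a - real r + 3"
    have "N < 1 / a" using a N(1) by (simp add: field_simps)
    then have y: "y \<ge> 2" using M(1) by (simp add: y_def N_def)
    have "f_ratio r y = hprod r a 1" unfolding f_ratio_hprod[OF y assms(1)] by (simp add: y_def)
    moreover have "f_ratio r M = hprod r (1 / N) 1" unfolding f_ratio_hprod[OF M(1) assms(1)] N_def ..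
    ultimately show False using M(2)[OF y] d(2)[OF h(1,2)] unfolding a_def by linarith
  qed
  moreover have "(\<Sum>j<r-1. real j / (k + real r - 3 - real j)) \<le> (\<Sum>j<r-1. real j / (M + real r - 3 - real j))"
    using N(2) assms(2) unfolding M_def[symmetric] N_def by (intro sum_mono divide_left_mono mult_pos_pos) force+
  ultimately show ?thesis unfolding log_deriv_cond_def by linarith
qed

subsection \<open>Embedding the enlarged tree\<close>

definition cov :: "'v set set \<Rightarrow> 'v \<Rightarrow> 'v \<Rightarrow> bool" where
  "cov E u v \<longleftrightarrow> (\<exists>e\<in>E. u \<in> e \<and> v \<in> e)"

text \<open>The core has as many vertices as the enlarged tree, so it is the image of the copy. The
  host appears as its edge set alone: once there are two vertices, coverage places every image in an
  edge.\<close>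

definition core_copy :: "'b hypergraph \<Rightarrow> 'v set set \<Rightarrow> bool" where
  "core_copy F E \<longleftrightarrow> (\<exists>f. inj_on f (verts F) \<and> (\<forall>e\<in>edges F. f ` e \<in> E) \<and>
     (\<forall>u\<in>verts F. \<forall>v\<in>verts F. u \<noteq> v \<longrightarrow> cov E (f u) (f v)))"

text \<open>The fibres of \<open>c\<close> are the clones of the vertices of \<open>E\<close>; empty
  fibres are allowed. With a map in place of a partition, moving one vertex to another fibre is a
  function update.\<close>

definition blowup :: "'w set \<Rightarrow> nat \<Rightarrow> ('w \<Rightarrow> 'v) \<Rightarrow> 'v set set \<Rightarrow> 'w set set" where
  "blowup V r c E = {e\<in>nsets V r. inj_on c e \<and> c ` e \<in> E}"

lemma cov_sym: "cov E u v \<longleftrightarrow> cov E v u"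
  unfolding cov_def by blast

text \<open>Covered vertices of a blow-up lie in different fibres, so the copy stays injective after
  composition with \<open>c\<close>. Freeness of a mere copy of \<open>F\<close> would in general
  not survive blowing up.\<close>

lemma core_copy_blowup:
  assumes "core_copy F (blowup V r c E)"
  shows "core_copy F E"
proof -
  from assms obtain f where f: "inj_on f (verts F)" "\<forall>e\<in>edges F. f ` e \<in> blowup V r c E"
    "\<forall>u\<in>verts F. \<forall>v\<in>verts F. u \<noteq> v \<longrightarrow> cov (blowup V r c E) (f u) (f v)"
    unfolding core_copy_def by (elim exE conjE)
  have cv: "c (f u) \<noteq> c (f v) \<and> cov E (c (f u)) (c (f v))"
    if uv: "u \<in> verts F" "v \<in> verts F" "u \<noteq> v" for u v
  proof -
    obtain e where e: "e \<in> blowup V r c E" "f u \<in> e" "f v \<in> e"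
      using f(3) uv unfolding cov_def by meson
    have "f u \<noteq> f v" using f(1) uv by (auto dest: inj_onD)
    moreover have "inj_on c e" "c ` e \<in> E" using e(1) by (auto simp: blowup_def)
    ultimately show ?thesis using e(2,3) by (auto simp: cov_def dest: inj_onD)
  qed
  show ?thesis unfolding core_copy_def
  proof (intro exI[of _ "c \<circ> f"] conjI ballI impI)
    show "inj_on (c \<circ> f) (verts F)" using cv by (intro inj_onI) (metis comp_apply)
    show "(c \<circ> f) ` e \<in> E" if "e \<in> edges F" for e
      using bspec[OF f(2) that] by (simp add: blowup_def image_comp)
    show "cov E ((c \<circ> f) u) ((c \<circ> f) v)" if "u \<in> verts F" "v \<in> verts F" "u \<noteq> v" for u v
      using cv[OF that] by simp
  qed
qed

text \<open>The end of a longest path has at most one neighbour.\<close>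

lemma acyclic_graph_leaf:
  assumes "r_graph 2 T" "\<nexists>p. is_cycle T p" "card (verts T) \<ge> 2"
  obtains l w where "l \<in> verts T" "w \<in> verts T" "l \<noteq> w" "\<And>e. e \<in> edges T \<Longrightarrow> l \<in> e \<Longrightarrow> e = {l, w}"
proof -
  define V where "V = verts T"
  have fV: "finite V" using assms(1) by (simp add: r_graph_def V_def)
  define path where "path = (\<lambda>p. p \<noteq> [] \<and> distinct p \<and> set p \<subseteq> V \<and>
    (\<forall>i. Suc i < length p \<longrightarrow> {p ! i, p ! Suc i} \<in> edges T))"
  have "V \<noteq> {}" using assms(3) by (auto simp: V_def)
  then obtain v0 where v0: "v0 \<in> V" by blast
  have "path [v0]" using v0 by (simp add: path_def)
  moreover have "\<forall>p. path p \<longrightarrow> length p < Suc (card V)"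
    using fV by (auto simp: path_def less_Suc_eq_le) (metis card_mono distinct_card)
  ultimately obtain p where p: "path p" "\<And>q. path q \<Longrightarrow> length q \<le> length p"
    using ex_has_greatest_nat[of path "[v0]" length "Suc (card V)"] by blast
  define l where "l = hd p"
  have pne: "p \<noteq> []" "distinct p" "set p \<subseteq> V" using p(1) by (auto simp: path_def)
  have l: "l \<in> V" "l = p ! 0" using pne by (auto simp: l_def hd_conv_nth)
  have nbr: "Suc 0 < length p \<and> z = p ! Suc 0" if "{l, z} \<in> edges T" "z \<noteq> l" for z
  proof -
    have zV: "z \<in> V" using that(1) assms(1) by (auto simp: r_graph_def V_def)
    have "z \<in> set p"
    proof (rule ccontr)
      assume "z \<notin> set p"
      have "{(z # p) ! i, (z # p) ! Suc i} \<in> edges T" if "Suc i < length (z # p)" for i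
        using that p(1) \<open>{l, z} \<in> edges T\<close> l(2) by (cases i) (auto simp: path_def insert_commute)
      then have "path (z # p)" using \<open>z \<notin> set p\<close> pne zV by (auto simp: path_def)
      from p(2)[OF this] show False by simp
    qed
    then obtain i where i: "i < length p" "p ! i = z" by (auto simp: in_set_conv_nth)
    have "i \<noteq> 0" using i that(2) l(2) by metis
    moreover have "\<not> i \<ge> 2"
    proof
      assume i2: "i \<ge> 2"
      have "is_cycle T (take (Suc i) p)"
        unfolding is_cycle_def
      proof (intro conjI allI impI)
        show "{last (take (Suc i) p), hd (take (Suc i) p)} \<in> edges T"
          using i i2 pne(1) that(1) by (simp add: take_Suc_conv_app_nth l_def insert_commute hd_append hd_take)
      qed (use i i2 pne p(1) in \<open>auto simp: path_def\<close>)
      then show False using assms(2) by blast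
    qed
    ultimately have "i = Suc 0" by linarith
    then show ?thesis using i by auto
  qed
  \<comment> \<open>If the longest path is a single vertex, \<open>l\<close> has no neighbour and
    any other vertex may play the role of \<open>w\<close>.\<close>
  obtain w where w: "w \<in> V" "w \<noteq> l" "Suc 0 < length p \<Longrightarrow> w = p ! Suc 0"
  proof (cases "Suc 0 < length p")
    case True
    then have "p ! Suc 0 \<in> V" "p ! Suc 0 \<noteq> l"
      using pne l(2) nth_eq_iff_index_eq[OF pne(2), of "Suc 0" 0] by auto
    then show thesis using that[of "p ! Suc 0"] by blast
  next
    case False
    have "\<not> V \<subseteq> {l}" using assms(3) card_mono[of "{l}" V] by (auto simp: V_def)
    then show thesis using that False by blast
  qed
  have "e = {l, w}" if e: "e \<in> edges T" "l \<in> e" for e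
  proof -
    have "card e = 2" using e(1) assms(1) by (auto simp: r_graph_def)
    then obtain a b where "e = {a, b}" "a \<noteq> b" by (auto simp: card_2_iff)
    then obtain z where z: "e = {l, z}" "z \<noteq> l" using e(2) by auto
    then show ?thesis using nbr[of z] e(1) w(3) by auto
  qed
  then show thesis using that[of l w] l(1) w by (auto simp: V_def)
qed

lemma subset_with_pair:
  assumes "finite X" "a \<in> X" "b \<in> X" "2 \<le> r" "r \<le> card X"
  obtains f where "f \<subseteq> X" "card f = r" "a \<in> f" "b \<in> f"
proof -
  have "card {a, b} \<le> r" using assms(4) by (simp add: card_insert_if)
  then obtain f where "{a,b} \<subseteq> f" "f \<subseteq> X" "card f = r"
    using exists_subset_between[of "{a,b}" r X] assms by auto
  then show thesis using that by auto
qed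

locale enlarged_tree =
  fixes k r :: nat and T :: "'a hypergraph" and D :: "'a set"
  assumes k3: "k \<ge> 3" and r2: "r \<ge> 2" and kM: "real k \<ge> M_last r"
    and tree: "is_tree T" and kT: "card (verts T) = k" and es: "satisfies_erdos_sos T"
    and fD: "finite D" and cD: "card D = r - 2" and disj: "D \<inter> verts T = {}"
begin

abbreviation "F \<equiv> enlargement T D"
abbreviation "m \<equiv> k + r - 3"

lemma T2: "r_graph 2 T" and acyc: "\<nexists>p. is_cycle T p"
  using tree by (auto simp: is_tree_def)

lemma fV: "finite (verts T)"
  using T2 by (simp add: r_graph_def)

lemma edgeT: "e \<in> edges T \<Longrightarrow> e \<subseteq> verts T \<and> card e = 2"
  using T2 by (simp add: r_graph_def)

lemma vertsF: "verts F = verts T \<union> D" and edgesF: "edges F = {e \<union> D |e. e \<in> edges T}"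
  by (auto simp: enlargement_def)

lemma finF: "finite (verts F)" and cardF: "card (verts F) = k + r - 2"
proof -
  show "finite (verts F)" using fV fD by (simp add: vertsF)
  show "card (verts F) = k + r - 2"
    unfolding vertsF using card_Un_disjoint[OF fV fD] disj kT cD r2 by (auto simp: Int_commute)
qed

lemma card_edgeF: "e \<in> edges T \<Longrightarrow> card (e \<union> D) = r"
proof -
  assume e: "e \<in> edges T"
  then have "finite e" "e \<inter> D = {}" using edgeT fV disj finite_subset by blast+
  then show ?thesis using card_Un_disjoint[of e D] fD cD edgeT[OF e] r2 by simp
qed

lemma condkr: "log_deriv_cond (real k) r"
  using log_deriv_cond_M_last[OF r2 kM] .

lemma m_ge_r: "m \<ge> r" and m_ge_2: "m \<ge> 2"
  using k3 r2 by auto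

lemma leaf: obtains l w where "l \<in> verts T" "w \<in> verts T" "l \<noteq> w"
    "\<And>e. e \<in> edges T \<Longrightarrow> l \<in> e \<Longrightarrow> e = {l, w}"
  using acyclic_graph_leaf[OF T2 acyc] kT k3 by auto

text \<open>Two nonadjacent vertices of the tree are sent to \<open>u\<close> and \<open>u'\<close>.\<close>

lemma core_copy_twins:
  assumes "u \<noteq> u'" "finite Y" "card Y = m - 1" "u \<notin> Y" "u' \<notin> Y" "cov E u u'"
    and "\<And>f. f \<subseteq> insert u Y \<Longrightarrow> card f = r \<Longrightarrow> f \<in> E"
    and "\<And>f. f \<subseteq> insert u' Y \<Longrightarrow> card f = r \<Longrightarrow> f \<in> E"
  shows "core_copy F E"
proof -
  obtain l w where l: "l \<in> verts T" "w \<in> verts T" "l \<noteq> w"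
    "\<And>e. e \<in> edges T \<Longrightarrow> l \<in> e \<Longrightarrow> e = {l, w}" by (rule leaf) blast
  \<comment> \<open>Since \<open>k \<ge> 3\<close> there is a third vertex \<open>z\<close>, not
    adjacent to the leaf \<open>l\<close>. Every edge of \<open>F\<close> misses \<open>l\<close> or
    \<open>z\<close>, so the images \<open>u\<close> and \<open>u'\<close> need to be covered but
    need no prescribed common edge.\<close>
  have "\<not> verts T \<subseteq> {l, w}"
    using card_mono[of "{l,w}" "verts T"] kT k3 l(3) by auto
  then obtain z where z: "z \<in> verts T" "z \<noteq> l" "z \<noteq> w" by auto
  define X where "X = verts F - {l, z}"
  have lzF: "l \<in> verts F" "z \<in> verts F" using l z by (auto simp: vertsF)
  have "card X = card Y"
    unfolding X_def using lzF z(2) finF cardF assms(3) k3 by (simp add: card_Diff_subset)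
  then obtain g where g: "bij_betw g X Y"
    using finite_same_card_bij[of X Y] finF assms(2) by (auto simp: X_def)
  define f where "f = (\<lambda>x. if x = l then u else if x = z then u' else g x)"
  have fX: "f x = g x \<and> g x \<in> Y" if "x \<in> X" for x
    using that g by (auto simp: f_def X_def bij_betw_def)
  have fl: "f l = u" "f z = u'" using z by (auto simp: f_def)
  have vF: "verts F = insert l (insert z X)" using lzF by (auto simp: X_def)
  have "inj_on f X" using g fX by (intro inj_onI) (metis bij_betw_inv_into_left)
  moreover have "f z \<notin> f ` X" "f l \<notin> f ` insert z X" using fX fl assms(1,4,5) by auto
  ultimately have inj: "inj_on f (verts F)" unfolding vF by (simp add: inj_on_insert) (auto simp: X_def)
  have noboth: "\<not> (l \<in> e \<and> z \<in> e)" if "e \<in> edges T" for e using l(4)[OF that] z by auto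
  have img1: "f ` S \<subseteq> insert u Y" if "S \<subseteq> verts F" "z \<notin> S" for S
    using that fX fl unfolding vF by fastforce
  have img2: "f ` S \<subseteq> insert u' Y" if "S \<subseteq> verts F" "l \<notin> S" for S
    using that fX fl unfolding vF by fastforce
  have sizes: "card (insert u Y) \<ge> r" "card (insert u' Y) \<ge> r"
    using assms(2-5) m_ge_r m_ge_2 by auto
  show ?thesis unfolding core_copy_def
  proof (intro exI[of _ f] conjI ballI impI)
    show "inj_on f (verts F)" by (rule inj)
    fix e' assume "e' \<in> edges F"
    then obtain e where e: "e \<in> edges T" "e' = e \<union> D" by (auto simp: edgesF)
    have sub: "e' \<subseteq> verts F" using e edgeT by (auto simp: vertsF)
    have card: "card (f ` e') = r"
      using card_image[OF inj_on_subset[OF inj sub]] card_edgeF[OF e(1)] e(2) by simp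
    show "f ` e' \<in> E"
    proof (cases "z \<in> e'")
      case False
      then show ?thesis using assms(7)[OF img1[OF sub]] card by blast
    next
      case True
      then have "l \<notin> e'" using noboth[OF e(1)] z(1) l(1) disj e(2) by auto
      then show ?thesis using assms(8)[OF img2[OF sub]] card by blast
    qed
  next
    fix a b assume ab: "a \<in> verts F" "b \<in> verts F" "a \<noteq> b"
    have c1: "cov E (f a) (f b)" if "f a \<in> insert u Y" "f b \<in> insert u Y"
      using subset_with_pair[OF _ that r2 sizes(1)] assms(2,7) unfolding cov_def
      by (metis finite_insert)
    have c2: "cov E (f a) (f b)" if "f a \<in> insert u' Y" "f b \<in> insert u' Y"
      using subset_with_pair[OF _ that r2 sizes(2)] assms(2,8) unfolding cov_def
      by (metis finite_insert)
    show "cov E (f a) (f b)"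
    proof (cases "z \<in> {a, b}")
      case False
      then show ?thesis using img1[of "{a,b}"] ab c1 by auto
    next
      case z: True
      show ?thesis
      proof (cases "l \<in> {a, b}")
        case False
        then show ?thesis using img2[of "{a,b}"] ab c2 by auto
      next
        case True
        then have "(a = l \<and> b = z) \<or> (a = z \<and> b = l)" using z ab \<open>z \<noteq> l\<close> by auto
        then show ?thesis using fl assms(6) cov_sym[of E u u'] by auto
      qed
    qed
  qed
qed

text \<open>A leaf of the tree is sent to \<open>v\<close>, so that a single edge at \<open>v\<close> suffices.\<close>

lemma core_copy_pendant:
  assumes "finite Y" "card Y = m" "v \<notin> Y" "f0 \<subseteq> Y" "card f0 = r - 1" "insert v f0 \<in> E"
    and "\<And>f. f \<subseteq> Y \<Longrightarrow> card f = r \<Longrightarrow> f \<in> E" "\<And>y. y \<in> Y \<Longrightarrow> cov E v y"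
  shows "core_copy F E"
proof -
  obtain l w where l: "l \<in> verts T" "w \<in> verts T" "l \<noteq> w"
    "\<And>e. e \<in> edges T \<Longrightarrow> l \<in> e \<Longrightarrow> e = {l, w}" by (rule leaf) blast
  have wD: "w \<notin> D" "l \<notin> D" using l disj by auto
  define X where "X = verts T - {l, w}"
  \<comment> \<open>The only possible edge of \<open>F\<close> at \<open>l\<close> is
    \<open>{l, w} \<union> D\<close>. Its other \<open>r - 1\<close> vertices are mapped onto
    \<open>f0\<close>, the remaining \<open>k - 2\<close> onto the rest of \<open>Y\<close>.\<close>
  have "card (insert w D) = card f0" using wD fD cD assms(5) r2 by simp
  then obtain g1 where g1: "bij_betw g1 (insert w D) f0"
    using finite_same_card_bij[of "insert w D" f0] fD finite_subset[OF assms(4,1)] by auto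
  have "card X = card (Y - f0)"
    unfolding X_def using l fV kT assms(1,2,4,5) k3 r2 finite_subset[OF assms(4,1)]
    by (simp add: card_Diff_subset)
  then obtain g2 where g2: "bij_betw g2 X (Y - f0)"
    using finite_same_card_bij[of X "Y - f0"] fV assms(1) by (auto simp: X_def)
  define f where "f = (\<lambda>x. if x = l then v else if x \<in> insert w D then g1 x else g2 x)"
  have b1: "bij_betw f (insert w D) f0"
    using g1 by (rule bij_betw_cong[THEN iffD1, rotated]) (use wD l in \<open>auto simp: f_def\<close>)
  have b2: "bij_betw f X (Y - f0)"
    using g2 by (rule bij_betw_cong[THEN iffD1, rotated]) (use disj in \<open>auto simp: f_def X_def\<close>)
  have b12: "bij_betw f (insert w D \<union> X) Y"
    using bij_betw_combine[OF b1 b2] assms(4) by (simp add: Un_absorb1)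
  have vF: "verts F = insert l (insert w D \<union> X)" using l by (auto simp: X_def vertsF)
  have fl: "f l = v" by (simp add: f_def)
  have "l \<notin> insert w D \<union> X" using wD l by (auto simp: X_def)
  then have inj: "inj_on f (verts F)"
    unfolding vF using b12 fl assms(3) by (auto simp: bij_betw_def inj_on_insert)
  have fY: "f x \<in> Y" if "x \<in> verts F" "x \<noteq> l" for x
    using that b12 unfolding vF bij_betw_def by blast
  show ?thesis unfolding core_copy_def
  proof (intro exI[of _ f] conjI ballI impI)
    show "inj_on f (verts F)" by (rule inj)
    fix e' assume "e' \<in> edges F"
    then obtain e where e: "e \<in> edges T" "e' = e \<union> D" by (auto simp: edgesF)
    have sub: "e' \<subseteq> verts F" using e edgeT by (auto simp: vertsF)
    show "f ` e' \<in> E"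
    proof (cases "l \<in> e")
      case True
      then have "f ` e' = insert v (f ` insert w D)" using l(4)[OF e(1)] e(2) fl by auto
      also have "f ` insert w D = f0" using b1 by (simp add: bij_betw_def)
      finally show ?thesis using assms(6) by simp
    next
      case False
      then have "f ` e' \<subseteq> Y" using fY sub wD e(2) by blast
      moreover have "card (f ` e') = r"
        using card_image[OF inj_on_subset[OF inj sub]] card_edgeF[OF e(1)] e(2) by simp
      ultimately show ?thesis by (rule assms(7))
    qed
  next
    fix a b assume ab: "a \<in> verts F" "b \<in> verts F" "a \<noteq> b"
    show "cov E (f a) (f b)"
    proof (cases "a = l \<or> b = l")
      case True
      then show ?thesis using ab fl fY assms(8) cov_sym[of E] by metis
    next
      case False
      then have "f a \<in> Y" "f b \<in> Y" using ab fY by auto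
      then obtain g where "g \<subseteq> Y" "card g = r" "f a \<in> g" "f b \<in> g"
        using subset_with_pair[OF assms(1) _ _ r2, of "f a" "f b"] assms(2) m_ge_r by metis
      then show ?thesis using assms(7) unfolding cov_def by blast
    qed
  qed
qed

text \<open>A copy of \<open>T\<close> in the link graph of \<open>A\<close>, with \<open>D\<close>
  sent to \<open>A\<close>, would be a copy of \<open>F\<close> inside \<open>W\<close>, where all
  pairs are covered. So these link graphs are free of \<open>T\<close> and the Erdos-Sos bound
  applies on every \<open>U\<close>.\<close>

lemma sparse_of_covered:
  assumes "\<not> core_copy F E" "finite W" "\<And>u v. u \<in> W \<Longrightarrow> v \<in> W \<Longrightarrow> u \<noteq> v \<Longrightarrow> cov E u v"
  shows "sparse k r W {e\<in>E. e \<subseteq> W}"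
  unfolding sparse_def
proof (intro allI impI)
  fix A U assume A: "A \<subseteq> W" "card A = r - 2" and U: "U \<subseteq> W - A"
  define L where "L = {g\<in>nsets U 2. A \<union> g \<in> {e\<in>E. e \<subseteq> W}}"
  have fU: "finite U" "finite A" using U A(1) assms(2) finite_subset by blast+
  define n where "n = card U"
  \<comment> \<open>\<open>turan_number\<close> speaks of graphs on \<open>{..<n}\<close>, hence the
    relabelling.\<close>
  obtain h where h: "bij_betw h U {..<n}"
    using ex_bij_betw_finite_nat[OF fU(1)] by (auto simp: n_def atLeast0LessThan)
  define E' where "E' = image h ` L"
  have Lsub: "L \<subseteq> Pow U" by (auto simp: L_def nsets_def)
  have injL: "inj_on (image h) L"
    by (rule inj_on_subset[OF inj_on_image_Pow[OF bij_betw_imp_inj_on[OF h]] Lsub])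
  then have cE': "card E' = card L" by (simp add: E'_def card_image)
  have rg: "r_graph 2 (Hypergraph {..<n} E')"
    unfolding r_graph_def
  proof (intro conjI ballI)
    fix e assume "e \<in> edges (Hypergraph {..<n} E')"
    then obtain g where g: "g \<in> nsets U 2" "e = h ` g" by (auto simp: E'_def L_def)
    then have "card (h ` g) = card g"
      using h by (intro card_image) (auto simp: bij_betw_def nsets_def intro: inj_on_subset)
    then show "card e = 2" using g by (simp add: nsets_def)
    show "e \<subseteq> verts (Hypergraph {..<n} E')" using g h by (auto simp: bij_betw_def nsets_def)
  qed simp
  have "\<not> has_copy T (Hypergraph {..<n} E')"
  proof
    assume "has_copy T (Hypergraph {..<n} E')"
    then obtain \<phi> where \<phi>: "inj_on \<phi> (verts T)" "\<phi> ` verts T \<subseteq> {..<n}" "\<And>e. e \<in> edges T \<Longrightarrow> \<phi> ` e \<in> E'"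
      by (auto simp: has_copy_def)
    have "card D = card A" using cD A by simp
    then obtain \<beta> where \<beta>: "bij_betw \<beta> D A"
      using finite_same_card_bij[OF fD fU(2)] by blast
    define hi where "hi = inv_into U h"
    have hi: "bij_betw hi {..<n} U" unfolding hi_def using h by (rule bij_betw_inv_into)
    define f where "f = (\<lambda>x. if x \<in> D then \<beta> x else hi (\<phi> x))"
    have fT: "f x = hi (\<phi> x)" if "x \<in> verts T" for x using that disj by (auto simp: f_def)
    have fU': "f x \<in> U" if "x \<in> verts T" for x
      using fT[OF that] hi \<phi>(2) that unfolding bij_betw_def by blast
    have injT: "inj_on f (verts T)"
    proof (rule inj_onI)
      fix x y assume xy: "x \<in> verts T" "y \<in> verts T" "f x = f y"
      then have "hi (\<phi> x) = hi (\<phi> y)" by (simp add: fT)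
      then have "\<phi> x = \<phi> y" using hi \<phi>(2) xy unfolding bij_betw_def by (meson image_subset_iff inj_onD)
      then show "x = y" using \<phi>(1) xy by (auto dest: inj_onD)
    qed
    have fDb: "bij_betw f D A"
      using \<beta> by (rule bij_betw_cong[THEN iffD1, rotated]) (simp add: f_def)
    have inj: "inj_on f (verts F)"
      unfolding vertsF
    proof (rule inj_on_Un[THEN iffD2], intro conjI)
      show "f ` (verts T - D) \<inter> f ` (D - verts T) = {}"
        using fU' fDb U by (auto simp: bij_betw_def)
    qed (use injT fDb in \<open>auto simp: bij_betw_def\<close>)
    have fW: "f x \<in> W" if "x \<in> verts F" for x
      using that fU' U A(1) fDb unfolding vertsF bij_betw_def by blast
    have "core_copy F E" unfolding core_copy_def
    proof (intro exI[of _ f] conjI ballI impI)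
      fix e' assume "e' \<in> edges F"
      then obtain e where e: "e \<in> edges T" "e' = e \<union> D" by (auto simp: edgesF)
      obtain g where g: "g \<in> L" "\<phi> ` e = h ` g" using \<phi>(3)[OF e(1)] by (auto simp: E'_def)
      have gU: "g \<subseteq> U" using g(1) Lsub by auto
      have "f ` e = hi ` (\<phi> ` e)"
        using fT edgeT[OF e(1)] unfolding image_image by (intro image_cong) auto
      also have "\<dots> = g" unfolding g(2) hi_def using gU h
        by (simp add: bij_betw_def inv_into_image_cancel)
      finally have "f ` e' = A \<union> g" using e(2) fDb by (auto simp: bij_betw_def)
      then show "f ` e' \<in> E" using g(1) by (simp add: L_def)
    next
      fix u v assume uv: "u \<in> verts F" "v \<in> verts F" "u \<noteq> v"
      then have "f u \<noteq> f v" using inj by (auto dest: inj_onD)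
      then show "cov E (f u) (f v)" using assms(3) fW uv by blast
    qed (rule inj)
    with assms(1) show False by simp
  qed
  with rg have "card E' \<in> {card E |E. r_graph 2 (Hypergraph {..<n} E) \<and> \<not> has_copy T (Hypergraph {..<n} E)}"
    by blast
  moreover have "finite {card E |E. r_graph 2 (Hypergraph {..<n} E) \<and> \<not> has_copy T (Hypergraph {..<n} E)}"
  proof (rule finite_subset)
    show "{card E |E. r_graph 2 (Hypergraph {..<n} E) \<and> \<not> has_copy T (Hypergraph {..<n} E)}
      \<subseteq> card ` Pow (Pow {..<n})" by (auto simp: r_graph_def)
  qed simp
  ultimately have "card E' \<le> turan_number 2 n T" unfolding turan_number_def by (rule Max_ge[rotated])
  then have "real (card E') \<le> real n * (real k - 2) / 2"
    using es kT unfolding satisfies_erdos_sos_def by (meson of_nat_le_iff order_trans)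
  then show "2 * real (card {g\<in>nsets U 2. A \<union> g \<in> {e\<in>E. e \<subseteq> W}}) \<le> (real k - 2) * real (card U)"
    unfolding L_def[symmetric] cE' n_def by (simp add: algebra_simps)
qed

end

subsection \<open>Weights and degrees in core-free hypergraphs\<close>

lemma wsum_const: "E \<subseteq> nsets V r \<Longrightarrow> wsum E (\<lambda>_. c) = real (card E) * c ^ r"
proof -
  assume E: "E \<subseteq> nsets V r"
  have "wsum E (\<lambda>_. c) = (\<Sum>e\<in>E. c ^ r)"
    unfolding wsum_def by (rule sum.cong) (use E in \<open>auto simp: nsets_def\<close>)
  then show ?thesis by simp
qed

context enlarged_tree
begin

text \<open>\<open>lam k r / fact r * n ^ r\<close> edges on \<open>n\<close> vertices mean average
  degree \<open>L * n ^ (r - 1)\<close>.\<close>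

abbreviation "L \<equiv> lam k r / fact (r - 1)"

lemma fact_r: "(fact r :: real) = real r * fact (r - 1)"
  using r2 by (simp add: fact_reduce)

lemma L_alt: "real r * (lam k r / fact r) = L"
  unfolding fact_r using r2 by simp

text \<open>Moving all the weight of a vertex to a vertex it is not covered with changes the weight
  linearly, so the support can be shrunk until its pairs are covered.\<close>

lemma wsum_le_lam:
  fixes V :: "'v set"
  assumes "\<not> core_copy F E" "finite V" "E \<subseteq> nsets V r" "\<And>i. i \<in> V \<Longrightarrow> 0 \<le> x i"
  shows "fact r * wsum E x \<le> lam k r * (sum x V) ^ r"
  using assms(4)
proof (induction "card {i\<in>V. x i > 0}" arbitrary: x rule: less_induct)
  case less
  define W where "W = {i\<in>V. x i > 0}"
  have W: "W \<subseteq> V" "finite W" using assms(2) by (auto simp: W_def)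
  have x0: "x i = 0" if "i \<in> V" "i \<notin> W" for i
    using less.prems[OF that(1)] that by (auto simp: W_def)
  show ?case
  proof (cases "\<forall>u\<in>W. \<forall>v\<in>W. u \<noteq> v \<longrightarrow> cov E u v")
    case True
    have fE: "finite E" using finite_nsets_sub[OF assms(2,3)] .
    have "fact r * wsum {e\<in>E. e \<subseteq> W} x \<le> lam k r * (sum x W) ^ r"
    proof (rule lagrangian_bound[OF k3 _ condkr W(2)])
      show "sparse k r W {e\<in>E. e \<subseteq> W}"
        using sparse_of_covered[OF assms(1) W(2)] True by blast
    qed (use r2 assms(3) in \<open>auto simp: nsets_def W_def\<close>)
    moreover have "wsum E x = wsum {e\<in>E. e \<subseteq> W} x" unfolding wsum_def
    proof (rule sum.mono_neutral_right[OF fE])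
      show "\<forall>e\<in>E - {e\<in>E. e \<subseteq> W}. prod x e = 0"
      proof
        fix e assume e: "e \<in> E - {e\<in>E. e \<subseteq> W}"
        then have "finite e" "e \<subseteq> V" using assms(3) by (auto simp: nsets_def)
        moreover obtain i where "i \<in> e" "i \<notin> W" using e by auto
        ultimately show "prod x e = 0" using x0 by (intro prod_zero) auto
      qed
    qed auto
    moreover have "sum x V = sum x W"
      using W assms(2) x0 by (intro sum.mono_neutral_right) auto
    ultimately show ?thesis by simp
  next
    case False
    then obtain a b where ab: "a \<in> W" "b \<in> W" "a \<noteq> b" "\<not> cov E a b" by blast
    define u where "u = (if wsum (link E a) x \<le> wsum (link E b) x then b else a)"
    define v where "v = (if wsum (link E a) x \<le> wsum (link E b) x then a else b)"
    have uv: "u \<in> W" "v \<in> W" "u \<noteq> v" "\<not> cov E u v"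
      "wsum (link E v) x \<le> wsum (link E u) x"
      using ab cov_sym[of E a b] by (auto simp: u_def v_def)
    define q where "q = r - 2"
    have q: "r = Suc (Suc q)" using r2 by (simp add: q_def)
    have "f \<notin> link (link E v) u" for f
    proof
      assume "f \<in> link (link E v) u"
      then have "insert v (insert u f) \<in> E" by (simp add: link_def)
      then have "cov E u v" unfolding cov_def by (rule bexI[rotated]) simp
      with uv(4) show False by simp
    qed
    then have "link (link E v) u = {}" by blast
    then have l0: "wsum (link (link E v) u) x = 0" by (simp add: wsum_def)
    define x' where "x' = x(v := x v - x v, u := x u + x v)"
    have uV: "u \<in> V" "v \<in> V" using uv W by auto
    have x'0: "0 \<le> x' i" if "i \<in> V" for i
      using less.prems[OF that] less.prems[OF uV(2)] less.prems[OF uV(1)] by (auto simp: x'_def)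
    have "wsum E x' = wsum E x + x v * (wsum (link E u) x - wsum (link E v) x)"
      unfolding x'_def using wsum_shift[OF assms(2) assms(3)[unfolded q], of v u x "x v"] uv(3) l0 by auto
    moreover have "x v * (wsum (link E u) x - wsum (link E v) x) \<ge> 0"
      using uv(5) less.prems[OF uV(2)] by simp
    ultimately have 1: "wsum E x \<le> wsum E x'" by linarith
    have "{i\<in>V. x' i > 0} \<subset> W"
      using uv uV by (auto simp: x'_def W_def)
    then have "card {i\<in>V. x' i > 0} < card {i\<in>V. x i > 0}"
      using W(2) psubset_card_mono unfolding W_def by blast
    from less.hyps[OF this x'0] have "fact r * wsum E x' \<le> lam k r * (sum x' V) ^ r" .
    also have "sum x' V = sum x V"
      unfolding x'_def using sum_shift[OF assms(2) uV(2,1), of x "x v"] uv(3) by auto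
    finally have 2: "fact r * wsum E x' \<le> lam k r * (sum x V) ^ r" .
    have "fact r * wsum E x \<le> fact r * wsum E x'" using 1 by (intro mult_left_mono) auto
    with 2 show ?thesis by linarith
  qed
qed

text \<open>Edges are measured against a power instead of a binomial coefficient, because
  \<open>card E / n ^ r\<close> is the value of \<open>wsum E\<close> at the uniform weights
  \<open>1 / n\<close>.\<close>

definition dense_core_free :: "real \<Rightarrow> 'v set \<Rightarrow> 'v set set \<Rightarrow> bool" where
  "dense_core_free \<delta> V E \<longleftrightarrow> finite V \<and> V \<noteq> {} \<and> E \<subseteq> nsets V r \<and> \<not> core_copy F E \<and>
     (lam k r / fact r - \<delta>) * real (card V) ^ r \<le> real (card E)"

lemma dense_core_free_mono:
  assumes "dense_core_free \<delta> V E" "\<delta> \<le> \<delta>'"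
  shows "dense_core_free \<delta>' V E"
proof -
  have "(lam k r / fact r - \<delta>') * real (card V) ^ r \<le> (lam k r / fact r - \<delta>) * real (card V) ^ r"
    using assms(2) by (intro mult_right_mono) auto
  then show ?thesis using assms(1) unfolding dense_core_free_def by (meson order_trans)
qed

text \<open>Scale the uniform weights by \<open>1 - t\<close> and give the freed weight
  \<open>t\<close> to \<open>u\<close>. The Lagrangian bound limits the gain, which is linear in
  \<open>t\<close> times the degree of \<open>u\<close>; with the deficit \<open>t * t\<close> the
  error is of second order.\<close>

lemma max_degree:
  assumes "\<tau> > 0"
  shows "\<exists>\<delta>>0. \<forall>(V :: 'v set) E u. dense_core_free \<delta> V E \<longrightarrow> u \<in> V \<longrightarrow>
    real (card (link E u)) \<le> (L + \<tau>) * real (card V) ^ (r - 1)"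
proof -
  have "((\<lambda>t::real. (L + t) / (1 - t) ^ (r - 1)) \<longlongrightarrow> (L + 0) / (1 - 0) ^ (r - 1)) (at_right 0)"
    by (intro tendsto_intros) auto
  then have "eventually (\<lambda>t::real. (L + t) / (1 - t) ^ (r - 1) < L + \<tau>) (at_right 0)"
    by (rule order_tendstoD(2)) (use assms in simp)
  moreover have "eventually (\<lambda>t::real. t < 1) (at_right 0)"
    by (intro order_tendstoD(2)[OF tendsto_ident_at]) auto
  moreover have "eventually (\<lambda>t::real. t > 0) (at_right 0)" by (rule eventually_at_right_less)
  ultimately have "eventually (\<lambda>t::real. (L + t) / (1 - t) ^ (r - 1) < L + \<tau> \<and> t < 1 \<and> t > 0) (at_right 0)"
    by eventually_elim auto
  then obtain t :: real where t: "(L + t) / (1 - t) ^ (r - 1) < L + \<tau>" "t < 1" "t > 0"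
    using eventually_happens'[OF trivial_limit_at_right_real] by blast
  show ?thesis
  proof (intro exI[of _ "t * t"] conjI allI impI)
    show "t * t > 0" using t by simp
    fix V :: "'v set" and E u
    assume "dense_core_free (t * t) V E" and u: "u \<in> V"
    then have V: "finite V" and E: "E \<subseteq> nsets V r" and nc: "\<not> core_copy F E"
      and big: "(lam k r / fact r - t * t) * real (card V) ^ r \<le> real (card E)"
      by (simp_all add: dense_core_free_def)
    define n where "n = real (card V)"
    have n: "n > 0" using V u by (auto simp: n_def card_gt_0_iff)
    define x where "x = (\<lambda>_::'v. 1 / n)"
    define y where "y = (\<lambda>i. (1 - t) * x i)"
    obtain q where q: "r = Suc q" using r2 by (cases r) auto
    have lk: "link E u \<subseteq> nsets (V - {u}) (r - 1)" using link_nsets[of E V q u] E q by simp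
    have wE: "wsum E x = real (card E) / n ^ r" unfolding x_def wsum_const[OF E] by (simp add: power_one_over)
    have wD: "wsum (link E u) x = real (card (link E u)) / n ^ (r - 1)"
      unfolding x_def wsum_const[OF lk] by (simp add: power_one_over)
    define A where "A = lam k r / fact r"
    define D where "D = wsum (link E u) x"
    have "sum (y(u := y u + t)) V = sum y V + t"
      using sum.remove[OF V u, of y] sum.remove[OF V u, of "y(u := y u + t)"] by simp
    also have "sum y V = 1 - t" using n by (simp add: y_def x_def n_def)
    finally have s1: "sum (y(u := y u + t)) V = 1" by simp
    have "fact r * wsum E (y(u := y u + t)) \<le> lam k r * (sum (y(u := y u + t)) V) ^ r"
      by (rule wsum_le_lam[OF nc V E]) (use t n in \<open>auto simp: y_def x_def\<close>)
    then have "wsum E (y(u := y u + t)) \<le> A" unfolding s1 A_def by (simp add: field_simps)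
    moreover have "wsum E (y(u := y u + t)) = (1 - t) ^ r * wsum E x + t * ((1 - t) ^ (r - 1) * D)"
      by (subst wsum_upd[OF V E]) (simp add: y_def wsum_scale[OF E] wsum_scale[OF lk] D_def)
    moreover have "A - t * t \<le> wsum E x"
      unfolding wE A_def using big n by (simp add: n_def pos_le_divide_eq)
    then have "(1 - t) ^ r * (A - t * t) \<le> (1 - t) ^ r * wsum E x" using t by (intro mult_left_mono) auto
    ultimately have 1: "t * ((1 - t) ^ (r - 1) * D) \<le> A - (1 - t) ^ r * (A - t * t)" by linarith
    have A0: "A > 0" unfolding A_def using lam_pos[OF k3, of r] r2 by simp
    have bern: "1 - real r * t \<le> (1 - t) ^ r"
      using Bernoulli_inequality[of "- t" r] t by simp
    then have "A * (1 - real r * t) \<le> A * (1 - t) ^ r" using A0 by (intro mult_left_mono) auto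
    moreover have "(1 - t) ^ r * (t * t) \<le> 1 * (t * t)"
      using t by (intro mult_right_mono power_le_one) auto
    ultimately have "t * ((1 - t) ^ (r - 1) * D) \<le> A * (real r * t) + t * t"
      using 1 by (simp add: algebra_simps)
    also have "A * (real r * t) = t * (real r * (lam k r / fact r))" by (simp add: A_def)
    also have "\<dots> = t * L" unfolding L_alt ..
    finally have "t * ((1 - t) ^ (r - 1) * D) \<le> t * (L + t)" by (simp add: algebra_simps)
    then have "(1 - t) ^ (r - 1) * D \<le> L + t" using t(3) by simp
    then have "D \<le> (L + t) / (1 - t) ^ (r - 1)" using t(2) by (simp add: pos_le_divide_eq mult.commute)
    then have "D \<le> L + \<tau>" using t(1) by linarith
    then show "real (card (link E u)) \<le> (L + \<tau>) * real (card V) ^ (r - 1)"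
      unfolding D_def wD using n by (simp add: n_def[symmetric] pos_divide_le_eq)
  qed
qed

text \<open>The average degree is nearly \<open>L\<close> and no degree is much larger, so few
  degrees can fall short by \<gamma>. The errors \<tau> and \<open>r * \<delta>\<close> are each at
  most half of \<open>\<epsilon> * \<gamma>\<close>.\<close>

lemma few_low_degrees:
  assumes "\<epsilon> > 0" "\<gamma> > 0"
  shows "\<exists>\<delta>>0. \<forall>(V :: 'v set) E. dense_core_free \<delta> V E \<longrightarrow>
    real (card {u\<in>V. real (card (link E u)) < (L - \<gamma>) * real (card V) ^ (r - 1)}) \<le> \<epsilon> * real (card V)"
proof -
  define \<tau> where "\<tau> = \<epsilon> * \<gamma> / 2"
  have tau: "\<tau> > 0" using assms by (simp add: \<tau>_def)
  obtain \<delta>' where d': "\<delta>' > 0" and dg: "\<forall>(V :: 'v set) E u. dense_core_free \<delta>' V E \<longrightarrow> u \<in> V \<longrightarrow>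
    real (card (link E u)) \<le> (L + \<tau>) * real (card V) ^ (r - 1)"
    using max_degree[OF tau, where 'v = 'v] by (elim exE conjE)
  define \<delta> where "\<delta> = min \<delta>' (\<epsilon> * \<gamma> / (2 * real r))"
  have d: "\<delta> > 0" "\<delta> \<le> \<delta>'" "\<delta> \<le> \<epsilon> * \<gamma> / (2 * real r)" using d' assms r2 by (auto simp: \<delta>_def)
  have rd: "real r * \<delta> \<le> \<epsilon> * \<gamma> / 2" using d(3) r2 by (simp add: field_simps)
  show ?thesis
  proof (intro exI[of _ \<delta>] conjI allI impI)
    fix V :: "'v set" and E
    assume dense: "dense_core_free \<delta> V E"
    then have V: "finite V" "V \<noteq> {}" and E: "E \<subseteq> nsets V r"
      and big: "(lam k r / fact r - \<delta>) * real (card V) ^ r \<le> real (card E)"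
      by (simp_all add: dense_core_free_def)
    define n where "n = real (card V)"
    have n: "n > 0" using V by (auto simp: n_def card_gt_0_iff)
    define N where "N = n ^ (r - 1)"
    have N: "N > 0" "n ^ r = n * N" using n r2 by (cases r; simp add: N_def)+
    define deg where "deg = (\<lambda>u. real (card (link E u)))"
    define Z where "Z = {u\<in>V. deg u < (L - \<gamma>) * N}"
    have Z: "Z \<subseteq> V" "finite Z" using V by (auto simp: Z_def)
    have degle: "deg u \<le> (L + \<tau>) * N" if "u \<in> V" for u
      using dg[rule_format, OF dense_core_free_mono[OF dense d(2)] that] unfolding deg_def N_def n_def .
    obtain q where q: "r = Suc q" using r2 by (cases r) auto
    have "(\<Sum>u\<in>V. 1 * wsum (link E u) (\<lambda>_. 1)) = real r * wsum E (\<lambda>_. 1)"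
      by (rule wsum_euler[OF V(1) E])
    moreover have "wsum (link E u) (\<lambda>_. 1) = deg u" for u
      unfolding deg_def using wsum_const[of "link E u" "V - {u}" q 1] link_nsets[of E V q u] E q by simp
    ultimately have sumdeg: "sum deg V = real r * real (card E)"
      using wsum_const[OF E, of 1] by simp
    have "real r * ((lam k r / fact r - \<delta>) * n ^ r) \<le> sum deg V"
      unfolding sumdeg using big by (intro mult_left_mono) (auto simp: n_def)
    then have 1: "(L - real r * \<delta>) * (n * N) \<le> sum deg V"
      unfolding N(2) L_alt[symmetric] by (simp add: algebra_simps)
    have "sum deg V = sum deg Z + sum deg (V - Z)"
      using sum.subset_diff[OF Z(1) V(1), of deg] by simp
    also have "\<dots> \<le> (\<Sum>u\<in>Z. (L - \<gamma>) * N) + (\<Sum>u\<in>V - Z. (L + \<tau>) * N)"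
      using degle by (intro add_mono sum_mono) (auto simp: Z_def)
    also have "\<dots> = real (card Z) * ((L - \<gamma>) * N) + (n - real (card Z)) * ((L + \<tau>) * N)"
      using Z V card_mono[OF V(1) Z(1)] by (simp add: card_Diff_subset of_nat_diff n_def)
    finally have "(L - real r * \<delta>) * (n * N) \<le>
       real (card Z) * ((L - \<gamma>) * N) + (n - real (card Z)) * ((L + \<tau>) * N)" using 1 by linarith
    moreover have "N * (z * (\<gamma> + \<tau>)) \<le> N * ((\<tau> + p) * n)"
      if "(l - p) * (n * N) \<le> z * ((l - \<gamma>) * N) + (n - z) * ((l + \<tau>) * N)" for l p z :: real
      using that by (simp add: algebra_simps)
    ultimately have "N * (real (card Z) * (\<gamma> + \<tau>)) \<le> N * ((\<tau> + real r * \<delta>) * n)"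
      by blast
    then have "real (card Z) * (\<gamma> + \<tau>) \<le> (\<tau> + real r * \<delta>) * n" using N(1) by simp
    also have "\<dots> \<le> (\<epsilon> * \<gamma>) * n" using rd n by (intro mult_right_mono) (auto simp: \<tau>_def)
    finally have "real (card Z) * \<gamma> + real (card Z) * \<tau> \<le> \<gamma> * (\<epsilon> * n)" by (simp add: algebra_simps)
    moreover have "real (card Z) * \<tau> \<ge> 0" using tau by simp
    ultimately have "\<gamma> * real (card Z) \<le> \<gamma> * (\<epsilon> * n)" by (simp add: mult.commute)
    then show "real (card {u\<in>V. real (card (link E u)) < (L - \<gamma>) * real (card V) ^ (r - 1)}) \<le> \<epsilon> * real (card V)"
      using assms(2) unfolding Z_def deg_def N_def n_def by simp
  qed (rule d)
qed

end

subsection \<open>Counting transversals\<close>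

lemma card_restrict_in_le:
  fixes P :: "'i \<Rightarrow> 'v set"
  assumes "finite J" "\<And>j. j \<in> J \<Longrightarrow> finite (P j)" "\<And>j. j \<in> J \<Longrightarrow> card (P j) \<le> n"
    and "I \<subseteq> J" "B \<subseteq> PiE I P"
  shows "card {g\<in>PiE J P. restrict g I \<in> B} \<le> card B * n ^ (card J - card I)"
proof -
  have fI: "finite I" using assms(1,4) finite_subset by blast
  have fB: "finite B" using assms(2,4,5) fI by (meson finite_PiE finite_subset subsetD)
  have fR: "finite (PiE (J - I) P)" using assms(1,2) by (intro finite_PiE) auto
  have "card {g\<in>PiE J P. restrict g I \<in> B} \<le> card (B \<times> PiE (J - I) P)"
  proof (rule card_inj_on_le)
    show "inj_on (\<lambda>g. (restrict g I, restrict g (J - I))) {g\<in>PiE J P. restrict g I \<in> B}"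
    proof (rule inj_onI)
      fix g h assume gh: "g \<in> {g\<in>PiE J P. restrict g I \<in> B}" "h \<in> {g\<in>PiE J P. restrict g I \<in> B}"
        and eq: "(restrict g I, restrict g (J - I)) = (restrict h I, restrict h (J - I))"
      have "g x = h x" for x
      proof -
        consider "x \<in> I" | "x \<in> J - I" | "x \<notin> J" by blast
        then show ?thesis
        proof cases
          case 1
          then show ?thesis using eq by (metis prod.inject restrict_apply')
        next
          case 2
          then show ?thesis using eq by (metis prod.inject restrict_apply')
        next
          case 3
          then show ?thesis using gh by (auto simp: PiE_def extensional_def)
        qed
      qed
      then show "g = h" by blast
    qed
    show "(\<lambda>g. (restrict g I, restrict g (J - I))) ` {g\<in>PiE J P. restrict g I \<in> B} \<subseteq> B \<times> PiE (J - I) P"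
      by auto
    show "finite (B \<times> PiE (J - I) P)" using fB fR by simp
  qed
  also have "\<dots> = card B * (\<Prod>j\<in>J - I. card (P j))"
    using assms(1) by (simp add: card_cartesian_product card_PiE)
  also have "\<dots> \<le> card B * n ^ card (J - I)"
    using prod_mono[of "J - I" "\<lambda>j. card (P j)" "\<lambda>_. n"] assms(3) by (intro mult_left_mono) auto
  also have "card (J - I) = card J - card I" using fI assms(4) by (rule card_Diff_subset)
  finally show ?thesis .
qed

text \<open>A union bound over the \<open>2 ^ card J\<close> index sets, each of which spoils at
  most \<open>\<xi> * n ^ card J\<close> transversals. It searches inside a given family
  \<open>T\<close>, so that the transversal can have further properties.\<close>

lemma avoiding_transversal:
  fixes P :: "'i \<Rightarrow> 'v set"
  assumes "finite J" "\<And>j. j \<in> J \<Longrightarrow> finite (P j)" "\<And>j. j \<in> J \<Longrightarrow> card (P j) \<le> n"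
    and "\<And>I. I \<subseteq> J \<Longrightarrow> B I \<subseteq> PiE I P"
    and "\<And>I. I \<subseteq> J \<Longrightarrow> real (card (B I)) \<le> \<xi> * real n ^ card I"
    and "T \<subseteq> PiE J P" "real (card T) > 2 ^ card J * \<xi> * real n ^ card J"
  shows "\<exists>g\<in>T. \<forall>I. I \<subseteq> J \<longrightarrow> restrict g I \<notin> B I"
proof (rule ccontr)
  assume "\<not> ?thesis"
  then have ex: "\<forall>g\<in>T. \<exists>I. I \<subseteq> J \<and> restrict g I \<in> B I" by simp
  have sub: "T \<subseteq> (\<Union>I\<in>Pow J. {g\<in>PiE J P. restrict g I \<in> B I})"
  proof
    fix g assume g: "g \<in> T"
    then obtain I where "I \<subseteq> J" "restrict g I \<in> B I" using ex by auto
    then show "g \<in> (\<Union>I\<in>Pow J. {g\<in>PiE J P. restrict g I \<in> B I})" using g assms(6) by auto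
  qed
  have fP: "finite (PiE J P)" using assms(1,2) by (intro finite_PiE) auto
  have "card T \<le> card (\<Union>I\<in>Pow J. {g\<in>PiE J P. restrict g I \<in> B I})"
    by (rule card_mono[OF _ sub]) (use fP assms(1) in auto)
  also have "\<dots> \<le> (\<Sum>I\<in>Pow J. card {g\<in>PiE J P. restrict g I \<in> B I})"
    by (rule card_UN_le) (use assms(1) in simp)
  finally have "real (card T) \<le> (\<Sum>I\<in>Pow J. real (card {g\<in>PiE J P. restrict g I \<in> B I}))"
    by (simp flip: of_nat_sum)
  also have "\<dots> \<le> (\<Sum>I\<in>Pow J. \<xi> * real n ^ card J)"
  proof (rule sum_mono)
    fix I assume "I \<in> Pow J"
    then have I: "I \<subseteq> J" by simp
    have "real (card {g\<in>PiE J P. restrict g I \<in> B I}) \<le> real (card (B I) * n ^ (card J - card I))"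
      using card_restrict_in_le[OF assms(1-3) I assms(4)[OF I]] by (rule of_nat_mono)
    also have "\<dots> = real (card (B I)) * real n ^ (card J - card I)" by simp
    also have "\<dots> \<le> \<xi> * real n ^ card I * real n ^ (card J - card I)"
      using assms(5)[OF I] by (intro mult_right_mono) auto
    also have "\<dots> = \<xi> * real n ^ card J"
      using card_mono[OF assms(1) I] by (simp flip: power_add)
    finally show "real (card {g\<in>PiE J P. restrict g I \<in> B I}) \<le> \<xi> * real n ^ card J" .
  qed
  also have "\<dots> = 2 ^ card J * \<xi> * real n ^ card J" using assms(1) by (simp add: card_Pow)
  finally show False using assms(7) by simp
qed

text \<open>Each member meets \<open>s\<close> different parts, and the set \<open>I\<close> of
  their indices together with the choice made in them recovers it.\<close>

lemma card_transversal_family_le: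
  fixes P :: "'i \<Rightarrow> 'v set"
  assumes "finite J" "\<And>j. j \<in> J \<Longrightarrow> finite (P j)" "disjoint_family_on P J"
    and F: "\<And>f. f \<in> \<F> \<Longrightarrow> f \<subseteq> (\<Union>j\<in>J. P j) \<and> card f = s \<and> finite f \<and> (\<forall>j\<in>J. card (f \<inter> P j) \<le> 1)"
  shows "card \<F> \<le> (\<Sum>I\<in>nsets J s. card {h\<in>PiE I P. h ` I \<in> \<F>})"
proof -
  have fN: "finite (nsets J s)" using assms(1) by (rule finite_imp_finite_nsets)
  have fP: "finite (PiE I P)" if "I \<in> nsets J s" for I
    using that assms(2) by (intro finite_PiE) (auto simp: nsets_def)
  have "\<F> \<subseteq> (\<Union>I\<in>nsets J s. (\<lambda>h. h ` I) ` {h\<in>PiE I P. h ` I \<in> \<F>})"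
  proof
    fix f assume f: "f \<in> \<F>"
    note Ff = F[OF f]
    have "\<forall>x\<in>f. \<exists>j. j \<in> J \<and> x \<in> P j" using Ff by blast
    then obtain c where c: "\<And>x. x \<in> f \<Longrightarrow> c x \<in> J \<and> x \<in> P (c x)" by metis
    have inj: "inj_on c f"
    proof (rule inj_onI)
      fix x y assume xy: "x \<in> f" "y \<in> f" "c x = c y"
      then have "{x, y} \<subseteq> f \<inter> P (c x)" using c[of x] c[of y] by auto
      then have "card {x, y} \<le> card (f \<inter> P (c x))" using Ff by (intro card_mono) auto
      also have "\<dots> \<le> 1" using Ff c[OF xy(1)] by blast
      finally show "x = y" by (cases "x = y") auto
    qed
    define I where "I = c ` f"
    define h where "h = restrict (inv_into f c) I"
    have I: "I \<in> nsets J s" using c Ff card_image[OF inj] by (auto simp: I_def nsets_def)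
    have hc: "h (c x) = x" if "x \<in> f" for x using that inj by (simp add: h_def I_def)
    have "h ` I = f" unfolding I_def using hc by (force simp: image_image)
    moreover have "h \<in> PiE I P"
    proof (rule PiE_I)
      show "h i \<in> P i" if "i \<in> I" for i using that hc c by (auto simp: I_def)
    qed (simp add: h_def)
    ultimately show "f \<in> (\<Union>I\<in>nsets J s. (\<lambda>h. h ` I) ` {h\<in>PiE I P. h ` I \<in> \<F>})"
      using I f by blast
  qed
  then have "card \<F> \<le> card (\<Union>I\<in>nsets J s. (\<lambda>h. h ` I) ` {h\<in>PiE I P. h ` I \<in> \<F>})"
    using fN fP by (intro card_mono) auto
  also have "\<dots> \<le> (\<Sum>I\<in>nsets J s. card ((\<lambda>h. h ` I) ` {h\<in>PiE I P. h ` I \<in> \<F>}))"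
    by (rule card_UN_le[OF fN])
  also have "\<dots> \<le> (\<Sum>I\<in>nsets J s. card {h\<in>PiE I P. h ` I \<in> \<F>})"
    using fP by (intro sum_mono card_image_le) auto
  finally show ?thesis .
qed

section \<open>Nearly complete partite structure and the two excluded configurations\<close>

definition missing :: "('i \<Rightarrow> 'v set) \<Rightarrow> 'v set set \<Rightarrow> 'v \<Rightarrow> 'i set \<Rightarrow> ('i \<Rightarrow> 'v) set" where
  "missing P E u I = {h\<in>PiE I P. insert u (h ` I) \<notin> E}"

text \<open>Every index set other than \<open>I0\<close> is credited with the full
  \<open>b ^ s\<close> choices, so all gaps at \<open>I0\<close> show up in the total shortfall.
  This is effective when the parts are nearly balanced, since then the degree almost equals the full
  count.\<close>

lemma missing_le:
  fixes P :: "'i \<Rightarrow> 'v set"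
  assumes "finite J" "\<And>j. j \<in> J \<Longrightarrow> finite (P j)" "disjoint_family_on P J"
    and F: "\<And>f. f \<in> \<F> \<Longrightarrow> f \<subseteq> (\<Union>j\<in>J. P j) \<and> card f = s \<and> finite f \<and> (\<forall>j\<in>J. card (f \<inter> P j) \<le> 1)"
    and "\<F> \<subseteq> link E w" "\<And>j. j \<in> J \<Longrightarrow> real (card (P j)) \<le> b" "c \<le> real (card \<F>)" "I0 \<in> nsets J s"
  shows "real (card (missing P E w I0)) \<le> real (card J choose s) * b ^ s - c"
proof -
  have fN: "finite (nsets J s)" using assms(1) by (rule finite_imp_finite_nsets)
  have fP: "finite (PiE I P)" if "I \<in> nsets J s" for I
    using that assms(2) by (intro finite_PiE) (auto simp: nsets_def)
  have cP: "real (card (PiE I P)) \<le> b ^ s" if I: "I \<in> nsets J s" for I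
  proof -
    have "real (card (PiE I P)) = (\<Prod>j\<in>I. real (card (P j)))"
      using I by (simp add: card_PiE nsets_def)
    also have "\<dots> \<le> (\<Prod>j\<in>I. b)" using I assms(6) by (intro prod_mono) (auto simp: nsets_def)
    also have "\<dots> = b ^ s" using I by (simp add: nsets_def)
    finally show ?thesis .
  qed
  have sub: "{h\<in>PiE I P. h ` I \<in> \<F>} \<subseteq> PiE I P - missing P E w I" for I
    using assms(5) by (auto simp: missing_def link_def)
  have le: "real (card {h\<in>PiE I P. h ` I \<in> \<F>}) \<le> b ^ s - real (card (missing P E w I))"
    if I: "I \<in> nsets J s" for I
  proof -
    have m: "missing P E w I \<subseteq> PiE I P" by (auto simp: missing_def)
    have "card {h\<in>PiE I P. h ` I \<in> \<F>} \<le> card (PiE I P - missing P E w I)"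
      using fP[OF I] by (intro card_mono sub) auto
    also have "\<dots> = card (PiE I P) - card (missing P E w I)"
      using m fP[OF I] by (intro card_Diff_subset finite_subset[OF m]) auto
    finally show ?thesis using cP[OF I] card_mono[OF fP[OF I] m] by linarith
  qed
  have "card \<F> \<le> (\<Sum>I\<in>nsets J s. card {h\<in>PiE I P. h ` I \<in> \<F>})"
    by (rule card_transversal_family_le[OF assms(1-3) F])
  then have "real (card \<F>) \<le> real (\<Sum>I\<in>nsets J s. card {h\<in>PiE I P. h ` I \<in> \<F>})"
    by (rule of_nat_mono)
  then have "c \<le> (\<Sum>I\<in>nsets J s. real (card {h\<in>PiE I P. h ` I \<in> \<F>}))"
    using assms(7) unfolding of_nat_sum by linarith
  also have "\<dots> = real (card {h\<in>PiE I0 P. h ` I0 \<in> \<F>}) + (\<Sum>I\<in>nsets J s - {I0}. real (card {h\<in>PiE I P. h ` I \<in> \<F>}))"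
    by (rule sum.remove[OF fN assms(8)])
  also have "\<dots> \<le> (b ^ s - real (card (missing P E w I0))) + (\<Sum>I\<in>nsets J s - {I0}. b ^ s)"
  proof (intro add_mono sum_mono)
    show "real (card {h\<in>PiE I P. h ` I \<in> \<F>}) \<le> b ^ s" if "I \<in> nsets J s - {I0}" for I
    proof -
      have "I \<in> nsets J s" using that by simp
      from le[OF this] show ?thesis by linarith
    qed
  qed (rule le[OF assms(8)])
  also have "(\<Sum>I\<in>nsets J s - {I0}. b ^ s) = (\<Sum>I\<in>nsets J s. b ^ s) - b ^ s"
    using sum.remove[OF fN assms(8), of "\<lambda>_. b ^ s"] by simp
  also have "(\<Sum>I\<in>nsets J s. b ^ s) = real (card J choose s) * b ^ s"
    using assms(1) by (simp add: card_nsets)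
  finally show ?thesis by linarith
qed

context enlarged_tree
begin

text \<open>\<open>u\<close> behaves like a vertex of part \<open>i\<close>, whether or not it lies
  there: almost every choice from \<open>r - 1\<close> of the other parts completes it to an
  edge.\<close>

definition good :: "nat \<Rightarrow> (nat \<Rightarrow> 'v set) \<Rightarrow> 'v set set \<Rightarrow> real \<Rightarrow> nat \<Rightarrow> 'v \<Rightarrow> bool" where
  "good n P E \<xi> i u \<longleftrightarrow> (\<forall>I\<in>nsets ({..<m} - {i}) (r - 1). real (card (missing P E u I)) \<le> \<xi> * real n ^ (r - 1))"

text \<open>Gaps are counted at a single index \<open>j\<close> of \<open>R\<close>, vertex by
  vertex in \<open>P j\<close>.\<close>

lemma missing_edges_le:
  fixes P :: "nat \<Rightarrow> 'v set"
  assumes "\<And>j. j < m \<Longrightarrow> finite (P j)" "\<And>j. j < m \<Longrightarrow> card (P j) \<le> n"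
    and "\<And>j w. j < m \<Longrightarrow> w \<in> P j \<Longrightarrow> good n P E \<xi> j w" "R \<in> nsets {..<m} r" "\<xi> \<ge> 0"
  shows "real (card {h\<in>PiE R P. h ` R \<notin> E}) \<le> \<xi> * real n ^ r"
proof -
  have R: "R \<subseteq> {..<m}" "finite R" "card R = r" using assms(4) by (auto simp: nsets_def)
  then obtain j where j: "j \<in> R" using r2 by fastforce
  then have jm: "j < m" using R by auto
  have "finite (PiE (R - {j}) P)" using R(1,2) assms(1) by (intro finite_PiE) auto
  then have fM: "finite (missing P E y (R - {j}))" for y
    unfolding missing_def by (rule finite_subset[rotated]) auto
  have Rj: "R - {j} \<in> nsets ({..<m} - {j}) (r - 1)" using R j by (auto simp: nsets_def)
  have "card {h\<in>PiE R P. h ` R \<notin> E} \<le> card (SIGMA y:P j. missing P E y (R - {j}))"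
  proof (rule card_inj_on_le)
    show "inj_on (\<lambda>h. (h j, restrict h (R - {j}))) {h\<in>PiE R P. h ` R \<notin> E}"
    proof (rule inj_onI)
      fix g h assume gh: "g \<in> {h\<in>PiE R P. h ` R \<notin> E}" "h \<in> {h\<in>PiE R P. h ` R \<notin> E}"
        and eq: "(g j, restrict g (R - {j})) = (h j, restrict h (R - {j}))"
      have "g x = h x" for x
      proof -
        consider "x = j" | "x \<in> R - {j}" | "x \<notin> R" by blast
        then show ?thesis
        proof cases
          case 2
          then show ?thesis using eq by (metis prod.inject restrict_apply')
        next
          case 3
          then show ?thesis using gh by (auto simp: PiE_def extensional_def)
        qed (use eq in simp)
      qed
      then show "g = h" by blast
    qed
    show "(\<lambda>h. (h j, restrict h (R - {j}))) ` {h\<in>PiE R P. h ` R \<notin> E} \<subseteq> (SIGMA y:P j. missing P E y (R - {j}))"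
    proof clarsimp
      fix h assume h: "h \<in> PiE R P" "h ` R \<notin> E"
      have "h ` R = insert (h j) (restrict h (R - {j}) ` (R - {j}))" using j by (auto simp: image_iff)
      then show "h j \<in> P j \<and> restrict h (R - {j}) \<in> missing P E (h j) (R - {j})"
        using h j by (auto simp: missing_def PiE_mem simp del: image_restrict_eq)
    qed
    show "finite (SIGMA y:P j. missing P E y (R - {j}))" using assms(1)[OF jm] fM by auto
  qed
  also have "\<dots> = (\<Sum>y\<in>P j. card (missing P E y (R - {j})))"
    using assms(1)[OF jm] fM by (intro card_SigmaI) auto
  finally have "real (card {h\<in>PiE R P. h ` R \<notin> E}) \<le> (\<Sum>y\<in>P j. real (card (missing P E y (R - {j}))))"
    by (simp flip: of_nat_sum)
  also have "\<dots> \<le> (\<Sum>y\<in>P j. \<xi> * real n ^ (r - 1))"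
    using assms(3)[OF jm] Rj by (intro sum_mono) (auto simp: good_def)
  also have "\<dots> = real (card (P j)) * (\<xi> * real n ^ (r - 1))" by simp
  also have "real (card (P j)) * (\<xi> * real n ^ (r - 1)) \<le> real n * (\<xi> * real n ^ (r - 1))"
    using assms(2)[OF jm] assms(5) by (intro mult_right_mono) auto
  also have "\<dots> = \<xi> * real n ^ r" using r2 by (cases r) auto
  finally show ?thesis .
qed

end

lemma inj_on_transversal:
  assumes "disjoint_family_on P J" "g \<in> PiE J P"
  shows "inj_on g J"
proof (rule inj_onI)
  fix i j assume ij: "i \<in> J" "j \<in> J" "g i = g j"
  then have "g i \<in> P i \<inter> P j" using assms(2) by (metis IntI PiE_mem)
  then show "i = j" using assms(1) ij unfolding disjoint_family_on_def by blast
qed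

lemma subset_image_card:
  assumes "f \<subseteq> g ` J" "inj_on g J"
  obtains I where "I \<subseteq> J" "g ` I = f" "card I = card f" "restrict g I ` I = f"
proof -
  obtain I where I: "I \<subseteq> J" "f = g ` I" using assms(1) by (auto simp: subset_image_iff)
  then have "card f = card I" using assms(2) by (auto intro: card_image inj_on_subset)
  then show thesis using that[of I] I by simp
qed

context enlarged_tree
begin

text \<open>Nearly all transversals of the other \<open>m - 1\<close> parts are complete and are
  completed by both \<open>u\<close> and \<open>u'\<close>. One such transversal, with
  \<open>u\<close> and \<open>u'\<close> covered, supports the embedding of
  \<open>core_copy_twins\<close>.\<close>

lemma twins_uncovered:
  fixes P :: "nat \<Rightarrow> 'v set"
  assumes nc: "\<not> core_copy F E" and n: "n > 0"
    and P: "\<And>j. j < m \<Longrightarrow> finite (P j)" "\<And>j. j < m \<Longrightarrow> card (P j) \<le> n" "disjoint_family_on P {..<m}"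
    and gd: "\<And>j w. j < m \<Longrightarrow> w \<in> P j \<Longrightarrow> good n P E \<xi> j w" and xi: "\<xi> \<ge> 0"
    and low: "\<And>j. j < m \<Longrightarrow> \<beta> * real n \<le> real (card (P j))" "\<beta> > 0" "\<beta> ^ (m - 1) > 2 ^ m * \<xi>"
    and i: "i < m" and u: "u \<noteq> u'" "good n P E \<xi> i u" "good n P E \<xi> i u'"
    "\<And>j. j < m \<Longrightarrow> j \<noteq> i \<Longrightarrow> u \<notin> P j \<and> u' \<notin> P j"
  shows "\<not> cov E u u'"
proof
  assume cv: "cov E u u'"
  define J where "J = {..<m} - {i}"
  have J: "finite J" "card J = m - 1" using i by (auto simp: J_def)
  have PJ: "\<And>j. j \<in> J \<Longrightarrow> finite (P j)" "\<And>j. j \<in> J \<Longrightarrow> card (P j) \<le> n"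
    using P by (auto simp: J_def)
  have dJ: "disjoint_family_on P J" using P(3) by (rule disjoint_family_on_mono[rotated]) (simp add: J_def)
  \<comment> \<open>Bad choices are non-edges inside the transversal and \<open>(r - 1)\<close>-sets
    that \<open>u\<close> or \<open>u'\<close> fails to complete. The two vertices account for the
    tolerance \<open>2 * \<xi>\<close>; with \<open>2 ^ (m - 1)\<close> index sets this gives the
    \<open>2 ^ m\<close> of the hypothesis.\<close>
  define B where "B = (\<lambda>I. {h\<in>PiE I P. (card I = r \<and> h ` I \<notin> E) \<or>
    (card I = r - 1 \<and> (insert u (h ` I) \<notin> E \<or> insert u' (h ` I) \<notin> E))})"
  have "\<exists>g\<in>PiE J P. \<forall>I. I \<subseteq> J \<longrightarrow> restrict g I \<notin> B I"
  proof (rule avoiding_transversal[where \<xi> = "2 * \<xi>", OF J(1) PJ])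
    show "B I \<subseteq> PiE I P" if "I \<subseteq> J" for I by (auto simp: B_def)
    show "real (card (B I)) \<le> 2 * \<xi> * real n ^ card I" if I: "I \<subseteq> J" for I
    proof -
      have fI: "finite I" using I J(1) finite_subset by blast
      have fP: "finite (PiE I P)" using I PJ fI by (intro finite_PiE) auto
      consider "card I = r" | "card I = r - 1" | "card I \<noteq> r" "card I \<noteq> r - 1" by blast
      then show ?thesis
      proof cases
        case 1
        then have "B I = {h\<in>PiE I P. h ` I \<notin> E}" using r2 by (auto simp: B_def)
        moreover have "I \<in> nsets {..<m} r" using I fI 1 by (auto simp: nsets_def J_def)
        ultimately have "real (card (B I)) \<le> \<xi> * real n ^ r"
          using missing_edges_le[OF P(1,2) gd _ xi] by simp
        moreover have "0 \<le> \<xi> * real n ^ r" using xi by simp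
        ultimately show ?thesis using 1 by simp
      next
        case 2
        then have "B I \<subseteq> missing P E u I \<union> missing P E u' I" using r2 by (auto simp: B_def missing_def)
        moreover have "finite (missing P E u I \<union> missing P E u' I)"
          using fP by (auto simp: missing_def)
        ultimately have "card (B I) \<le> card (missing P E u I \<union> missing P E u' I)" by (rule card_mono[rotated])
        also have "\<dots> \<le> card (missing P E u I) + card (missing P E u' I)" by (rule card_Un_le)
        finally have "real (card (B I)) \<le> real (card (missing P E u I)) + real (card (missing P E u' I))"
          by linarith
        moreover have "I \<in> nsets ({..<m} - {i}) (r - 1)" using I fI 2 by (auto simp: nsets_def J_def)
        ultimately show ?thesis using u(2,3) 2 unfolding good_def by fastforce
      next
        case 3
        then have "B I = {}" by (auto simp: B_def)
        then show ?thesis using xi by simp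
      qed
    qed
    have "(\<beta> * real n) ^ (m - 1) = (\<Prod>j\<in>J. \<beta> * real n)" using J by simp
    also have "\<dots> \<le> (\<Prod>j\<in>J. real (card (P j)))"
      using low by (intro prod_mono) (auto simp: J_def)
    also have "\<dots> = real (card (PiE J P))" using J(1) by (simp add: card_PiE)
    finally have 1: "(\<beta> * real n) ^ (m - 1) \<le> real (card (PiE J P))" .
    have "m = Suc (m - 1)" using m_ge_2 by simp
    then have "(2::real) ^ m = 2 * 2 ^ (m - 1)" by (metis power_Suc)
    then have "2 ^ card J * (2 * \<xi>) * real n ^ card J = (2 ^ m * \<xi>) * real n ^ (m - 1)"
      using J(2) by simp
    also have "\<dots> < \<beta> ^ (m - 1) * real n ^ (m - 1)" using low(3) n by (intro mult_strict_right_mono) auto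
    also have "\<dots> = (\<beta> * real n) ^ (m - 1)" by (simp add: power_mult_distrib)
    finally show "2 ^ card J * (2 * \<xi>) * real n ^ card J < real (card (PiE J P))" using 1 by linarith
  qed auto
  then obtain g where g: "g \<in> PiE J P" "\<And>I. I \<subseteq> J \<Longrightarrow> restrict g I \<notin> B I" by auto
  have injg: "inj_on g J" using inj_on_transversal[OF dJ g(1)] .
  define Y where "Y = g ` J"
  have Y: "finite Y" "card Y = m - 1" using J card_image[OF injg] by (auto simp: Y_def)
  have gP: "g j \<in> P j" "j < m" "j \<noteq> i" if "j \<in> J" for j using g(1) that by (auto simp: J_def PiE_mem)
  have uY: "u \<notin> Y" "u' \<notin> Y" using u(4) gP by (force simp: Y_def)+
  have gI: "restrict g I \<in> PiE I P" if "I \<subseteq> J" for I using that gP by auto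
  have rY: "f \<in> E" if f: "f \<subseteq> Y" "card f = r" for f
  proof -
    obtain I where I: "I \<subseteq> J" "g ` I = f" "card I = card f" "restrict g I ` I = f"
      by (rule subset_image_card[OF f(1)[unfolded Y_def] injg]) blast
    then show ?thesis using g(2)[OF I(1)] gI[OF I(1)] f(2) unfolding B_def by auto
  qed
  have r1Y: "insert u f \<in> E \<and> insert u' f \<in> E" if f: "f \<subseteq> Y" "card f = r - 1" for f
  proof -
    obtain I where I: "I \<subseteq> J" "g ` I = f" "card I = card f" "restrict g I ` I = f"
      by (rule subset_image_card[OF f(1)[unfolded Y_def] injg]) blast
    then show ?thesis using g(2)[OF I(1)] gI[OF I(1)] f(2) unfolding B_def by auto
  qed
  have ins: "f \<in> E" if f: "f \<subseteq> insert z Y" "card f = r" and z: "z = u \<or> z = u'" for f z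
  proof (cases "z \<in> f")
    case True
    have "finite f" using f(1) Y(1) finite_subset by blast
    then have "card (f - {z}) = r - 1" using True f(2) by simp
    moreover have "f - {z} \<subseteq> Y" using f(1) by auto
    ultimately have "insert z (f - {z}) \<in> E" using r1Y[of "f - {z}"] z by auto
    then show ?thesis using True by (simp add: insert_absorb)
  next
    case False
    then show ?thesis using rY f by blast
  qed
  have "core_copy F E"
    by (rule core_copy_twins[OF u(1) Y uY cv]) (use ins in blast)+
  with nc show False by simp
qed

text \<open>A vertex outside the parts that lies in many edges over \<open>I0\<close> and is covered
  with many vertices of every part would sit on a complete transversal as in
  \<open>core_copy_pendant\<close>.\<close>

lemma pendant_absent:
  fixes P :: "nat \<Rightarrow> 'v set"
  assumes nc: "\<not> core_copy F E" and n: "n > 0"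
    and P: "\<And>j. j < m \<Longrightarrow> finite (P j)" "\<And>j. j < m \<Longrightarrow> card (P j) \<le> n" "disjoint_family_on P {..<m}"
    and gd: "\<And>j w. j < m \<Longrightarrow> w \<in> P j \<Longrightarrow> good n P E \<xi> j w" and xi: "\<xi> \<ge> 0"
    and v: "\<And>j. j < m \<Longrightarrow> v \<notin> P j" and I0: "I0 \<in> nsets {..<m} (r - 1)"
    and d: "d * real n ^ (r - 1) \<le> real (card {h\<in>PiE I0 P. insert v (h ` I0) \<in> E})" "d > 0"
    and eta: "\<And>j. j < m \<Longrightarrow> \<eta> * real n \<le> real (card {y\<in>P j. cov E v y})" "\<eta> > 0"
    and big: "d * \<eta> ^ (m - (r - 1)) > 2 ^ m * \<xi>"
  shows False
proof -
  define J where "J = {..<m}"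
  have J: "finite J" "card J = m" by (auto simp: J_def)
  have PJ: "\<And>j. j \<in> J \<Longrightarrow> finite (P j)" "\<And>j. j \<in> J \<Longrightarrow> card (P j) \<le> n"
    using P by (auto simp: J_def)
  have I0J: "I0 \<subseteq> J" "finite I0" "card I0 = r - 1" using I0 by (auto simp: nsets_def J_def)
  define B where "B = (\<lambda>I. {h\<in>PiE I P. card I = r \<and> h ` I \<notin> E})"
  define N where "N = (\<lambda>j. {y\<in>P j. cov E v y})"
  \<comment> \<open>These transversals already supply the edge at \<open>v\<close> and all pairs at
    \<open>v\<close>. There are enough of them that one also avoids every missing
    \<open>r\<close>-set inside.\<close>
  define S where "S = {g\<in>PiE J P. insert v (g ` I0) \<in> E \<and> (\<forall>j\<in>J - I0. cov E v (g j))}"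
  have fPJ: "finite (PiE J P)" using J PJ by (intro finite_PiE) auto
  have cS: "d * real n ^ (r - 1) * (\<eta> * real n) ^ (m - (r - 1)) \<le> real (card S)"
  proof -
    define H where "H = {h\<in>PiE I0 P. insert v (h ` I0) \<in> E}"
    define K where "K = PiE (J - I0) N"
    define mrg where "mrg = (\<lambda>(h :: nat \<Rightarrow> 'v, h' :: nat \<Rightarrow> 'v). \<lambda>x. if x \<in> I0 then h x else h' x)"
    have "card (H \<times> K) \<le> card S"
    proof (rule card_inj_on_le)
      show "inj_on mrg (H \<times> K)"
      proof (rule inj_onI, clarify)
        fix a b a' b' assume ab: "a \<in> H" "b \<in> K" "a' \<in> H" "b' \<in> K" and eq: "mrg (a, b) = mrg (a', b')"
        have pw: "(if x \<in> I0 then a x else b x) = (if x \<in> I0 then a' x else b' x)" for x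
          using fun_cong[OF eq, of x] by (simp add: mrg_def)
        have "a x = a' x" for x
        proof (cases "x \<in> I0")
          case True
          then show ?thesis using pw[of x] by simp
        next
          case False
          then show ?thesis using ab(1,3) by (auto simp: H_def PiE_def extensional_def)
        qed
        moreover have "b x = b' x" for x
        proof (cases "x \<in> J - I0")
          case True
          then show ?thesis using pw[of x] by simp
        next
          case False
          then show ?thesis using ab(2,4) by (auto simp: K_def PiE_def extensional_def)
        qed
        ultimately show "a = a' \<and> b = b'" by blast
      qed
      show "mrg ` (H \<times> K) \<subseteq> S"
      proof clarify
        fix h h' assume h: "h \<in> H" "h' \<in> K"
        have "mrg (h, h') ` I0 = h ` I0" by (auto simp: mrg_def)
        moreover have "mrg (h, h') \<in> PiE J P"
        proof (rule PiE_I)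
          show "mrg (h, h') x \<in> P x" if "x \<in> J" for x
            using that h by (auto simp: mrg_def H_def K_def N_def PiE_def Pi_def)
          show "mrg (h, h') x = undefined" if "x \<notin> J" for x
            using that h I0J(1) by (auto simp: mrg_def K_def PiE_def extensional_def)
        qed
        moreover have "cov E v (mrg (h, h') j)" if "j \<in> J - I0" for j
          using that h by (auto simp: mrg_def K_def N_def PiE_def Pi_def)
        ultimately show "mrg (h, h') \<in> S" using h by (auto simp: S_def H_def)
      qed
      show "finite S" using fPJ by (auto simp: S_def)
    qed
    then have "real (card H) * real (card K) \<le> real (card S)"
      by (simp add: card_cartesian_product flip: of_nat_mult)
    moreover have "(\<eta> * real n) ^ (m - (r - 1)) \<le> real (card K)"
    proof -
      have "card (J - I0) = m - (r - 1)" using I0J J card_Diff_subset[OF I0J(2,1)] by simp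
      then have "(\<eta> * real n) ^ (m - (r - 1)) = (\<Prod>j\<in>J - I0. \<eta> * real n)" by simp
      also have "\<dots> \<le> (\<Prod>j\<in>J - I0. real (card (N j)))"
        using eta n by (intro prod_mono) (auto simp: J_def N_def)
      also have "\<dots> = real (card K)" unfolding K_def using J(1) by (simp add: card_PiE)
      finally show ?thesis .
    qed
    moreover have "d * real n ^ (r - 1) \<le> real (card H)" using d(1) by (simp add: H_def)
    ultimately show ?thesis
      using mult_mono[of "d * real n ^ (r - 1)" "real (card H)" "(\<eta> * real n) ^ (m - (r - 1))" "real (card K)"]
        d(2) eta(2) by (auto intro: order_trans)
  qed
  have "\<exists>g\<in>S. \<forall>I. I \<subseteq> J \<longrightarrow> restrict g I \<notin> B I"
  proof (rule avoiding_transversal[where \<xi> = \<xi>, OF J(1) PJ])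
    show "B I \<subseteq> PiE I P" if "I \<subseteq> J" for I by (auto simp: B_def)
    show "real (card (B I)) \<le> \<xi> * real n ^ card I" if I: "I \<subseteq> J" for I
    proof (cases "card I = r")
      case True
      have fI: "finite I" using I J(1) finite_subset by blast
      have "B I = {h\<in>PiE I P. h ` I \<notin> E}" using True by (auto simp: B_def)
      moreover have "I \<in> nsets {..<m} r" using I fI True by (auto simp: nsets_def J_def)
      ultimately show ?thesis
        using missing_edges_le[OF P(1,2) gd _ xi] True by simp
    next
      case False
      then have "B I = {}" by (auto simp: B_def)
      then show ?thesis using xi by simp
    qed
    have "r - 1 + (m - (r - 1)) = m" using m_ge_r by simp
    then have "d * real n ^ (r - 1) * (\<eta> * real n) ^ (m - (r - 1)) = (d * \<eta> ^ (m - (r - 1))) * real n ^ m"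
      by (simp add: power_mult_distrib flip: power_add)
    moreover have "(2 ^ m * \<xi>) * real n ^ m < (d * \<eta> ^ (m - (r - 1))) * real n ^ m"
      using big n by (intro mult_strict_right_mono) auto
    ultimately show "2 ^ card J * \<xi> * real n ^ card J < real (card S)"
      using cS unfolding J(2) by linarith
  qed (auto simp: S_def)
  then obtain g where g: "g \<in> S" "\<And>I. I \<subseteq> J \<Longrightarrow> restrict g I \<notin> B I" by auto
  have gPi: "g \<in> PiE J P" using g(1) by (simp add: S_def)
  have injg: "inj_on g J" using inj_on_transversal[OF _ gPi] P(3) by (simp add: J_def)
  define Y where "Y = g ` J"
  have Y: "finite Y" "card Y = m" using J card_image[OF injg] by (auto simp: Y_def)
  have gP: "g j \<in> P j" "j < m" if "j \<in> J" for j using gPi that by (auto simp: J_def PiE_mem)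
  have rY: "f \<in> E" if f: "f \<subseteq> Y" "card f = r" for f
  proof -
    obtain I where I: "I \<subseteq> J" "g ` I = f" "card I = card f" "restrict g I ` I = f"
      by (rule subset_image_card[OF f(1)[unfolded Y_def] injg]) blast
    have "restrict g I \<in> PiE I P" using I(1) gP by auto
    then show ?thesis using g(2)[OF I(1)] I f(2) unfolding B_def by auto
  qed
  have "core_copy F E"
  proof (rule core_copy_pendant[OF Y])
    show "v \<notin> Y" using v gP by (auto simp: Y_def) 
    show "g ` I0 \<subseteq> Y" using I0J by (auto simp: Y_def)
    show "card (g ` I0) = r - 1" using I0J card_image[OF inj_on_subset[OF injg I0J(1)]] by simp
    show e0: "insert v (g ` I0) \<in> E" using g(1) by (simp add: S_def)
    show "cov E v y" if y: "y \<in> Y" for y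
    proof -
      obtain j where j: "j \<in> J" "y = g j" using y by (auto simp: Y_def)
      show ?thesis
      proof (cases "j \<in> I0")
        case True
        then show ?thesis using e0 j unfolding cov_def by (intro bexI[OF _ e0]) auto
      next
        case False
        then show ?thesis using g(1) j by (auto simp: S_def)
      qed
    qed
  qed (rule rY)
  with nc show False by simp
qed

text \<open>Maclaurin's inequality, as the Lagrangian bound for the complete hypergraph.\<close>

lemma complete_wsum_le:
  assumes "finite J" "card J = m - 1" "\<And>j. j \<in> J \<Longrightarrow> 0 \<le> x j"
  shows "fact (r - 1) * wsum (nsets J (r - 1)) x \<le> lam k (r - 1) * (sum x J) ^ (r - 1)"
proof (rule lagrangian_bound[OF k3 _ _ assms(1) subset_refl _ assms(3)])
  have "Suc (r - 1) = r" using r2 by simp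
  then show "log_deriv_cond (real k) (r - 1)" if "r - 1 \<ge> 2"
    using log_deriv_cond_Suc[of "real k" "r - 1"] condkr k3 that by simp
  show "sparse k (r - 1) J (nsets J (r - 1))" if r: "r - 1 \<ge> 2"
    unfolding sparse_def
  proof (intro allI impI)
    fix A U assume A: "A \<subseteq> J" "card A = r - 1 - 2" and U: "U \<subseteq> J - A"
    have fU: "finite U" "finite A" using A U assms(1) finite_subset by blast+
    \<comment> \<open>Of the \<open>m - 1\<close> vertices, \<open>r - 3\<close> are used by
      \<open>A\<close> and \<open>k - 1\<close> remain, so the complete graph on \<open>U\<close>
      has average degree at most \<open>k - 2\<close>.\<close>
    have "card U \<le> card (J - A)" using U assms(1) by (intro card_mono) auto
    also have "\<dots> = k - 1" using card_Diff_subset[OF fU(2) A(1)] A(2) assms(2) r k3 by simp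
    finally have cU: "card U \<le> k - 1" .
    have "card {g\<in>nsets U 2. A \<union> g \<in> nsets J (r - 1)} \<le> card (nsets U 2)"
      using fU by (intro card_mono finite_imp_finite_nsets) auto
    also have "\<dots> = card U choose 2" using fU by (simp add: card_nsets)
    finally have "2 * card {g\<in>nsets U 2. A \<union> g \<in> nsets J (r - 1)} \<le> card U * (card U - 1)"
      by (simp add: choose_two)
    also have "\<dots> \<le> card U * (k - 2)" using cU by (intro mult_left_mono) auto
    finally have "real (2 * card {g\<in>nsets U 2. A \<union> g \<in> nsets J (r - 1)}) \<le> real (card U * (k - 2))"
      by (rule of_nat_mono)
    then show "2 * real (card {g\<in>nsets U 2. A \<union> g \<in> nsets J (r - 1)}) \<le> (real k - 2) * real (card U)"
      using k3 by (simp add: of_nat_diff mult.commute)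
  qed
qed (use r2 in auto)

text \<open>\<open>L\<close> as the largest degree over \<open>m - 1\<close> parts that together
  have the share \<open>1 - 1/m\<close>. In this form it bounds the parts from above.\<close>

lemma L_lam_pred: "L = lam k (r - 1) / fact (r - 1) * (1 - 1 / real m) ^ (r - 1)"
proof -
  obtain q where q: "r = Suc q" using r2 by (cases r) auto
  have "real m = real k + real q - 2" using k3 q by (simp add: of_nat_diff)
  then show ?thesis using lam_Suc[OF k3, of q] q by simp
qed

text \<open>\<open>L\<close> as the degree in the balanced complete \<open>m\<close>-partite
  hypergraph: choose \<open>r - 1\<close> of the other parts, each with share \<open>1/m\<close>. In
  this form it bounds the gaps.\<close>

lemma L_choose: "L = real ((m - 1) choose (r - 1)) * (1 / real m) ^ (r - 1)"
proof -
  obtain q where q: "r = Suc q" using r2 by (cases r) auto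
  obtain p where p: "m = Suc p" using m_ge_2 by (cases m) auto
  have "real (p choose q) = (\<Prod>i<q. real p - real i) / fact q"
    by (simp add: binomial_gbinomial gbinomial_prod_rev atLeast0LessThan)
  moreover have "falling_factorial (Suc p) (Suc q) = real (Suc p) * (\<Prod>i<q. real p - real i)"
    unfolding falling_factorial_def by (simp add: prod.lessThan_Suc_shift del: prod.lessThan_Suc)
  ultimately show ?thesis
    unfolding lam_def p unfolding q by (simp add: power_one_over)
qed

end

subsection \<open>Extending a partite subgraph\<close>

lemma card_meeting_le:
  assumes "finite V" "N \<subseteq> V"
  shows "card {f\<in>nsets V (Suc s). f \<inter> N \<noteq> {}} \<le> card N * card V ^ s"
proof -
  have fN: "finite N" using assms finite_subset by blast
  have fs: "finite (nsets V s)" using assms(1) by (rule finite_imp_finite_nsets)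
  have "{f\<in>nsets V (Suc s). f \<inter> N \<noteq> {}} \<subseteq> (\<Union>z\<in>N. insert z ` nsets V s)"
  proof
    fix f assume f: "f \<in> {f\<in>nsets V (Suc s). f \<inter> N \<noteq> {}}"
    then obtain z where z: "z \<in> f" "z \<in> N" by auto
    then have "f - {z} \<in> nsets V s" using f by (auto simp: nsets_def)
    moreover have "f = insert z (f - {z})" using z by auto
    ultimately show "f \<in> (\<Union>z\<in>N. insert z ` nsets V s)" using z by blast
  qed
  then have "card {f\<in>nsets V (Suc s). f \<inter> N \<noteq> {}} \<le> card (\<Union>z\<in>N. insert z ` nsets V s)"
    using fN fs by (intro card_mono) auto
  also have "\<dots> \<le> (\<Sum>z\<in>N. card (insert z ` nsets V s))" by (rule card_UN_le[OF fN])
  also have "\<dots> \<le> (\<Sum>z\<in>N. card V ^ s)"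
  proof (rule sum_mono)
    fix z
    have "card (insert z ` nsets V s) \<le> card (nsets V s)" using fs by (rule card_image_le)
    also have "\<dots> \<le> card V ^ s" using assms(1) binomial_le_pow[of s "card V"]
      by (cases "s \<le> card V") (auto simp: card_nsets binomial_eq_0)
    finally show "card (insert z ` nsets V s) \<le> card V ^ s" .
  qed
  finally show ?thesis by simp
qed

context enlarged_tree
begin

text \<open>An oversized part leaves too little room for the degrees of its own vertices, so the
  parts are nearly balanced and their vertices \<open>good\<close>. Then pairs inside a part are
  uncovered and the link sets of \<open>v\<close> inside \<open>U\<close> are transversal. If
  \<open>v\<close> were covered with many vertices of every part, \<open>pendant_absent\<close>
  would apply; so \<open>v\<close> nearly avoids some part, is \<open>good\<close> for it, and by
  \<open>twins_uncovered\<close> avoids it altogether.\<close>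

lemma extension:
  "\<exists>\<gamma>>0. \<forall>(V :: 'v set) E P v U. finite V \<longrightarrow> E \<subseteq> nsets V r \<longrightarrow> \<not> core_copy F E \<longrightarrow>
    disjoint_family_on P {..<m} \<longrightarrow> U = (\<Union>j<m. P j) \<longrightarrow> U \<subseteq> V \<longrightarrow>
    (\<forall>e\<in>E. e \<subseteq> U \<longrightarrow> (\<forall>j<m. card (e \<inter> P j) \<le> 1)) \<longrightarrow> v \<in> V - U \<longrightarrow>
    (1 - \<gamma>) * real (card V) \<le> real (card U) \<longrightarrow>
    (\<forall>w\<in>insert v U. (L - \<gamma>) * real (card V) ^ (r - 1) \<le> real (card {f\<in>link E w. f \<subseteq> U})) \<longrightarrow>
    (\<exists>i<m. \<forall>e\<in>E. e \<subseteq> insert v U \<longrightarrow> (\<forall>j<m. card (e \<inter> (P(i := insert v (P i))) j) \<le> 1))"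
proof -
  define M where "M = real m"
  have M: "M \<ge> 2" using m_ge_2 unfolding M_def by linarith
  have L0: "L > 0" using lam_pos[OF k3, of r] r2 by simp
  define C where "C = real ((m - 1) choose (r - 1))"
  \<comment> \<open>The gap tolerance for \<open>twins_uncovered\<close> when each part has at least
    \<open>n / (2 * M)\<close> vertices; a spare factor 2 makes the inequality strict.\<close>
  define \<xi>1 where "\<xi>1 = (1 / (2 * M)) ^ (m - 1) / 2 ^ (m + 1)"
  have xi1: "\<xi>1 > 0" using M by (simp add: \<xi>1_def)
  have tw: "(1 / (2 * M)) ^ (m - 1) > 2 ^ m * \<xi>1"
  proof -
    have "(1 / (2 * M)) ^ (m - 1) > 0" using M by simp
    then show ?thesis by (simp add: \<xi>1_def)
  qed
  define \<eta> where "\<eta> = \<xi>1 / 4"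
  \<comment> \<open>The degree of \<open>v\<close> exceeds \<open>L / 2\<close>, and at most
    \<open>2 ^ m\<close> index sets share it, so one of them receives \<open>d\<close>.\<close>
  define d where "d = (L / 2) / 2 ^ m"
  define q where "q = d * \<eta> ^ (m - (r - 1))"
  have eta: "\<eta> > 0" using xi1 by (simp add: \<eta>_def)
  have d: "d > 0" using lam_pos[OF k3, of r] r2 by (simp add: d_def)
  have q: "q > 0" using eta d by (simp add: q_def)
  \<comment> \<open>Vertices of the parts get a smaller tolerance than \<open>v\<close>. The link of
    \<open>v\<close> may lose a share \<eta> and is therefore only controlled up to
    \<open>\<xi>1\<close>, whereas \<open>pendant_absent\<close> needs gaps small compared with a
    power of \<eta>.\<close>
  define \<xi> where "\<xi> = min \<xi>1 (q / 2 ^ (m + 1))"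
  have xi: "\<xi> > 0" "\<xi> \<le> \<xi>1" "\<xi> \<le> q / 2 ^ (m + 1)" using q xi1 by (auto simp: \<xi>_def)
  have pend: "q > 2 ^ m * \<xi>"
  proof -
    have "2 ^ m * \<xi> \<le> 2 ^ m * (q / 2 ^ (m + 1))" using xi(3) by (intro mult_left_mono) auto
    also have "\<dots> = q / 2" by simp
    finally show ?thesis using q by linarith
  qed
  define \<rho> where "\<rho> = min (\<xi>1 / 4) (\<xi> / 2)"
  have rho: "\<rho> > 0" "\<rho> \<le> \<xi>1 / 4" "\<rho> \<le> \<xi> / 2" using xi xi1 by (auto simp: \<rho>_def)
  have LC: "C * (1 / M + 0) ^ (r - 1) = L" unfolding C_def M_def using L_choose by simp
  have "((\<lambda>\<beta>. C * (1 / M + \<beta>) ^ (r - 1)) \<longlongrightarrow> C * (1 / M + 0) ^ (r - 1)) (at_right 0)"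
    by (intro tendsto_intros)
  then have "eventually (\<lambda>\<beta>. C * (1 / M + \<beta>) ^ (r - 1) < L + \<rho>) (at_right 0)"
    unfolding LC by (rule order_tendstoD(2)) (use rho in simp)
  moreover have "1 / (4 * M\<^sup>2) > 0" using M by simp
  then have "eventually (\<lambda>\<beta>. \<beta> < 1 / (4 * M\<^sup>2)) (at_right 0)"
    by (intro order_tendstoD(2)[OF tendsto_ident_at])
  moreover have "1 - 1 / M > 0" using M by simp
  then have "eventually (\<lambda>\<beta>. \<beta> < 1 - 1 / M) (at_right 0)"
    by (intro order_tendstoD(2)[OF tendsto_ident_at])
  moreover have "eventually (\<lambda>\<beta>. \<beta> > (0::real)) (at_right 0)" by (rule eventually_at_right_less)
  ultimately have "eventually (\<lambda>\<beta>. C * (1 / M + \<beta>) ^ (r - 1) < L + \<rho> \<and> \<beta> < 1 / (4 * M\<^sup>2) \<and>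
      \<beta> < 1 - 1 / M \<and> \<beta> > 0) (at_right 0)"
    by eventually_elim auto
  then obtain \<beta> where beta: "C * (1 / M + \<beta>) ^ (r - 1) < L + \<rho>" "\<beta> < 1 / (4 * M\<^sup>2)" "\<beta> < 1 - 1 / M" "\<beta> > 0"
    using eventually_happens'[OF trivial_limit_at_right_real] by blast
  have Mb: "M * \<beta> \<le> 1 / (4 * M)"
  proof -
    have "M * \<beta> \<le> M * (1 / (4 * M\<^sup>2))" using beta(2) M by (intro mult_left_mono) auto
    also have "\<dots> = 1 / (4 * M)" using M by (simp add: power2_eq_square)
    finally show ?thesis .
  qed
  define l' where "l' = lam k (r - 1) / fact (r - 1)"
  have l'0: "l' > 0" using lam_pos[OF k3, of "r - 1"] r2 by (simp add: l'_def)
  \<comment> \<open>The degree lost by the vertices of a part whose share exceeds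
    \<open>1 / M\<close> by \<beta>, according to Maclaurin's inequality on the other parts.\<close>
  define G where "G = L - l' * (1 - 1 / M - \<beta>) ^ (r - 1)"
  have G: "G > 0"
  proof -
    have "(1 - 1 / M - \<beta>) ^ (r - 1) < (1 - 1 / M) ^ (r - 1)"
      using beta(3,4) r2 by (intro power_strict_mono) auto
    then have "l' * (1 - 1 / M - \<beta>) ^ (r - 1) < l' * (1 - 1 / M) ^ (r - 1)" using l'0 by simp
    also have "\<dots> = L" using L_lam_pred by (simp add: l'_def M_def)
    finally show ?thesis by (simp add: G_def)
  qed
  \<comment> \<open>In turn: oversized parts are contradictory, gaps stay within the tolerances, the
    degree of \<open>v\<close> exceeds \<open>L / 2\<close>, and no part is too small.\<close>
  define \<gamma> where "\<gamma> = Min {G / 2, \<rho>, L / 4, 1 / (4 * M)}"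
  have gam: "\<gamma> > 0" "\<gamma> \<le> G / 2" "\<gamma> \<le> \<rho>" "\<gamma> \<le> L / 4" "\<gamma> \<le> 1 / (4 * M)"
    using G rho L0 M by (auto simp: \<gamma>_def)
  show ?thesis
  proof (intro exI[of _ \<gamma>] conjI allI impI)
    fix V :: "'v set" and E P v U
    assume V: "finite V" and E: "E \<subseteq> nsets V r" and nc: "\<not> core_copy F E"
      and dj: "disjoint_family_on P {..<m}" and U: "U = (\<Union>j<m. P j)" and UV: "U \<subseteq> V"
      and part: "\<forall>e\<in>E. e \<subseteq> U \<longrightarrow> (\<forall>j<m. card (e \<inter> P j) \<le> 1)" and v: "v \<in> V - U"
      and Ubig: "(1 - \<gamma>) * real (card V) \<le> real (card U)"
      and deg: "\<forall>w\<in>insert v U. (L - \<gamma>) * real (card V) ^ (r - 1) \<le> real (card {f\<in>link E w. f \<subseteq> U})"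
    define n where "n = card V"
    have n: "n > 0" using V v by (auto simp: n_def card_gt_0_iff)
    have PU: "P j \<subseteq> U" if "j < m" for j using that U by auto
    have fU: "finite U" using UV V finite_subset by blast
    have P: "finite (P j)" "card (P j) \<le> n" if "j < m" for j
      using PU[OF that] UV V fU by (auto simp: n_def intro: finite_subset card_mono)
    have lk: "link E w \<subseteq> nsets (V - {w}) (r - 1)" for w
      using link_nsets[of E V "r - 1" w] E r2 by simp
    define Fam where "Fam = (\<lambda>w. {f\<in>link E w. f \<subseteq> U})"
    have degw: "(L - \<gamma>) * real n ^ (r - 1) \<le> real (card (Fam w))" if "w \<in> insert v U" for w
      unfolding Fam_def n_def by (rule bspec[OF deg that])
    have FamS: "card f = r - 1 \<and> finite f \<and> f \<subseteq> U \<and> w \<notin> f \<and> insert w f \<in> E" if "f \<in> Fam w" for f w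
      using that lk[of w] by (auto simp: Fam_def nsets_def link_def)
    have UJ: "(\<Union>j\<in>{..<m} - {i}. P j) = U - P i" if "i < m" for i
      using dj that unfolding U disjoint_family_on_def by blast
    have djJ: "disjoint_family_on P ({..<m} - {i})" for i
      using dj by (rule disjoint_family_on_mono[rotated]) auto
    have famP: "f \<subseteq> (\<Union>j\<in>{..<m} - {i}. P j) \<and> card f = r - 1 \<and> finite f \<and>
        (\<forall>j\<in>{..<m} - {i}. card (f \<inter> P j) \<le> 1)" if i: "i < m" "w \<in> P i" "f \<in> Fam w" for i w f
    proof -
      note f = FamS[OF i(3)]
      have wU: "w \<in> U" using PU[OF i(1)] i(2) by blast
      have tr: "card (insert w f \<inter> P j) \<le> 1" if "j < m" for j using part f wU that by auto
      have "f \<inter> P i = {}"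
      proof (rule ccontr)
        assume "f \<inter> P i \<noteq> {}"
        then obtain z where z: "z \<in> f" "z \<in> P i" by auto
        then have "card {w, z} \<le> card (insert w f \<inter> P i)" using f i(2) by (intro card_mono) auto
        moreover have "w \<noteq> z" using f z by auto
        ultimately show False using tr[OF i(1)] by simp
      qed
      moreover have "card (f \<inter> P j) \<le> 1" if "j < m" for j
        using card_mono[of "insert w f \<inter> P j" "f \<inter> P j"] tr[OF that] f by fastforce
      ultimately show ?thesis unfolding UJ[OF i(1)] using f by auto
    qed
    have cardJ: "card ({..<m} - {i}) = m - 1" if "i < m" for i using that by simp
    have sumP: "(\<Sum>j\<in>{..<m} - {i}. real (card (P j))) = real (card U) - real (card (P i))" if i: "i < m" for i
    proof -
      have "card U = (\<Sum>j<m. card (P j))"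
        unfolding U using dj P by (intro card_UN_disjoint) (auto simp: disjoint_family_on_def)
      then have "real (card U) = (\<Sum>j<m. real (card (P j)))" by simp
      also have "\<dots> = real (card (P i)) + (\<Sum>j\<in>{..<m} - {i}. real (card (P j)))"
        using i by (intro sum.remove) auto
      finally show ?thesis by simp
    qed
    have Un: "real (card U) \<le> real n" using UV V by (simp add: n_def card_mono)
    have nr: "real n > 0" using n by simp
    have up: "real (card (P i)) \<le> (1 / M + \<beta>) * real n" if i: "i < m" for i
    proof (cases "P i = {}")
      case True
      then show ?thesis using M beta nr by simp
    next
      case False
      then obtain w where w: "w \<in> P i" by blast
      show ?thesis
      proof (rule ccontr)
        assume neg: "\<not> ?thesis"
        define J where "J = {..<m} - {i}"
        have J: "finite J" "card J = m - 1" using cardJ[OF i] by (auto simp: J_def)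
        have "card (Fam w) \<le> (\<Sum>I\<in>nsets J (r - 1). card {h\<in>PiE I P. h ` I \<in> Fam w})"
          unfolding J_def
          by (rule card_transversal_family_le[OF _ _ djJ famP[OF i w]]) (use P in auto)
        also have "\<dots> \<le> (\<Sum>I\<in>nsets J (r - 1). \<Prod>j\<in>I. card (P j))"
        proof (rule sum_mono)
          fix I assume I: "I \<in> nsets J (r - 1)"
          then have fI: "finite I" "\<And>j. j \<in> I \<Longrightarrow> finite (P j)" using P by (auto simp: nsets_def J_def)
          then have "card {h\<in>PiE I P. h ` I \<in> Fam w} \<le> card (PiE I P)"
            by (intro card_mono finite_PiE) auto
          then show "card {h\<in>PiE I P. h ` I \<in> Fam w} \<le> (\<Prod>j\<in>I. card (P j))"
            using fI(1) by (simp add: card_PiE)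
        qed
        finally have "real (card (Fam w)) \<le> real (\<Sum>I\<in>nsets J (r - 1). \<Prod>j\<in>I. card (P j))"
          by (rule of_nat_mono)
        also have "\<dots> = wsum (nsets J (r - 1)) (\<lambda>j. real (card (P j)))"
          by (simp add: wsum_def)
        also have "\<dots> \<le> l' * (\<Sum>j\<in>J. real (card (P j))) ^ (r - 1)"
          using complete_wsum_le[OF J, of "\<lambda>j. real (card (P j))"] by (simp add: l'_def field_simps)
        also have "\<dots> \<le> l' * ((1 - 1 / M - \<beta>) * real n) ^ (r - 1)"
        proof (intro mult_left_mono power_mono)
          show "(\<Sum>j\<in>J. real (card (P j))) \<le> (1 - 1 / M - \<beta>) * real n"
            using neg Un unfolding J_def sumP[OF i] by (simp add: algebra_simps)
        qed (use l'0 in \<open>auto intro: sum_nonneg\<close>)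
        also have "\<dots> = (L - G) * real n ^ (r - 1)" by (simp add: G_def power_mult_distrib)
        finally have "(L - \<gamma>) * real n ^ (r - 1) \<le> (L - G) * real n ^ (r - 1)"
          using degw[of w] PU[OF i] w by auto
        then have "L - \<gamma> \<le> L - G" using nr by simp
        then show False using gam(2) G by linarith
      qed
    qed
    have low: "1 / (2 * M) * real n \<le> real (card (P i))" if i: "i < m" for i
    proof -
      have "(\<Sum>j\<in>{..<m} - {i}. real (card (P j))) \<le> (\<Sum>j\<in>{..<m} - {i}. (1 / M + \<beta>) * real n)"
        using up by (intro sum_mono) auto
      also have "\<dots> = (M - 1) * ((1 / M + \<beta>) * real n)"
        using cardJ[OF i] m_ge_2 by (simp add: M_def of_nat_diff)
      also have "\<dots> = (1 - 1 / M + (M - 1) * \<beta>) * real n" using M by (simp add: field_simps)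
      also have "\<dots> \<le> (1 - 1 / M + 1 / (4 * M)) * real n"
      proof -
        have "(M - 1) * \<beta> \<le> 1 / (4 * M)" using Mb beta(4) by (simp add: algebra_simps)
        then show ?thesis by (intro mult_right_mono) auto
      qed
      finally have "real (card U) - real (card (P i)) \<le> (1 - 1 / M + 1 / (4 * M)) * real n"
        unfolding sumP[OF i] .
      moreover have "(1 - 1 / (4 * M)) * real n \<le> (1 - \<gamma>) * real n"
        using gam(5) by (intro mult_right_mono) auto
      ultimately have "(1 - 1 / (4 * M)) * real n - (1 - 1 / M + 1 / (4 * M)) * real n \<le> real (card (P i))"
        using Ubig unfolding n_def by linarith
      moreover have "(1 - 1 / (4 * M)) * real n - (1 - 1 / M + 1 / (4 * M)) * real n = 1 / (2 * M) * real n"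
        using M by (simp add: field_simps)
      ultimately show ?thesis by simp
    qed
    have miss: "real (card (missing P E w I)) \<le> (\<rho> + \<gamma> + t) * real n ^ (r - 1)"
      if i: "i < m" and I: "I \<in> nsets ({..<m} - {i}) (r - 1)" and FF: "\<F> \<subseteq> link E w"
        "\<And>f. f \<in> \<F> \<Longrightarrow> f \<subseteq> (\<Union>j\<in>{..<m} - {i}. P j) \<and> card f = r - 1 \<and> finite f \<and>
          (\<forall>j\<in>{..<m} - {i}. card (f \<inter> P j) \<le> 1)"
        "(L - \<gamma> - t) * real n ^ (r - 1) \<le> real (card \<F>)" for i w I \<F> t
    proof -
      have "real (card (missing P E w I)) \<le> real (card ({..<m} - {i}) choose (r - 1)) * ((1 / M + \<beta>) * real n) ^ (r - 1)
         - (L - \<gamma> - t) * real n ^ (r - 1)"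
        by (rule missing_le[OF _ _ djJ FF(2) FF(1) _ FF(3) I]) (use P up in auto)
      also have "\<dots> = (C * (1 / M + \<beta>) ^ (r - 1) - (L - \<gamma> - t)) * real n ^ (r - 1)"
        unfolding cardJ[OF i] C_def[symmetric] by (simp add: power_mult_distrib left_diff_distrib)
      also have "\<dots> \<le> (\<rho> + \<gamma> + t) * real n ^ (r - 1)"
        using beta(1) by (intro mult_right_mono) auto
      finally show ?thesis .
    qed
    have gd: "good n P E \<xi> j w" if j: "j < m" and w: "w \<in> P j" for j w
      unfolding good_def
    proof
      fix I assume I: "I \<in> nsets ({..<m} - {j}) (r - 1)"
      have "real (card (missing P E w I)) \<le> (\<rho> + \<gamma> + 0) * real n ^ (r - 1)"
      proof (rule miss[OF j I _ famP[OF j w]])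
        show "Fam w \<subseteq> link E w" by (auto simp: Fam_def)
        show "(L - \<gamma> - 0) * real n ^ (r - 1) \<le> real (card (Fam w))"
          using degw[of w] PU[OF j] w by auto
      qed
      also have "\<dots> \<le> \<xi> * real n ^ (r - 1)" using gam(3) rho(3) by (intro mult_right_mono) auto
      finally show "real (card (missing P E w I)) \<le> \<xi> * real n ^ (r - 1)" .
    qed
    have gd1: "good n P E \<xi>1 j w" if "j < m" "w \<in> P j" for j w
      using gd[OF that] mult_right_mono[OF xi(2), of "real n ^ (r - 1)"] unfolding good_def
      by (meson order_trans of_nat_0_le_iff zero_le_power)
    have twins: "\<not> cov E u u'"
      if "i < m" "u \<noteq> u'" "good n P E \<xi>1 i u" "good n P E \<xi>1 i u'"
        "\<And>j. j < m \<Longrightarrow> j \<noteq> i \<Longrightarrow> u \<notin> P j \<and> u' \<notin> P j" for i u u'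
      by (rule twins_uncovered[OF nc n P dj gd1 _ low _ tw that]) (use xi1 M in auto)
    have disjP: "x \<notin> P j" if "x \<in> P i" "i < m" "j < m" "j \<noteq> i" for x i j
      using dj that unfolding disjoint_family_on_def by blast
    have same: "\<not> cov E u u'" if i: "i < m" "u \<in> P i" "u' \<in> P i" "u \<noteq> u'" for i u u'
      by (rule twins[OF i(1,4) gd1[OF i(1,2)] gd1[OF i(1,3)]]) (use i disjP in blast)
    have vP: "v \<notin> P j" if "j < m" for j using PU[OF that] v by auto
    have vtr: "card (f \<inter> P j) \<le> 1" if f: "f \<in> Fam v" and j: "j < m" for f j
    proof (rule ccontr)
      assume "\<not> card (f \<inter> P j) \<le> 1"
      then obtain x y where xy: "x \<in> f \<inter> P j" "y \<in> f \<inter> P j" "x \<noteq> y"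
        using FamS[OF f] card_le_Suc0_iff_eq[of "f \<inter> P j"] by auto
      then have "cov E x y" using FamS[OF f] unfolding cov_def by (intro bexI[of _ "insert v f"]) auto
      then show False using same[OF j] xy by blast
    qed
    define N where "N = (\<lambda>j. {y\<in>P j. cov E v y})"
    have "\<exists>i<m. good n P E \<xi>1 i v"
    proof (cases "\<exists>i<m. real (card (N i)) < \<eta> * real n")
      case True
      then obtain i where i: "i < m" "real (card (N i)) < \<eta> * real n" by blast
      define F' where "F' = {f\<in>Fam v. f \<inter> P i = {}}"
      have NV: "N i \<subseteq> V" using PU[OF i(1)] UV by (auto simp: N_def)
      have fF: "finite (Fam v)"
        using finite_nsets_sub[OF _ lk, of v] V by (auto simp: Fam_def)
      \<comment> \<open>A link set of \<open>v\<close> that meets \<open>P i\<close> does so in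
        vertices covered with \<open>v\<close>, that is in \<open>N i\<close>. Discarding these sets
        costs at most \<open>\<eta> * n ^ (r - 1)\<close>.\<close>
      have "Fam v - F' \<subseteq> {f\<in>nsets V (Suc (r - 2)). f \<inter> N i \<noteq> {}}"
      proof
        fix f assume f: "f \<in> Fam v - F'"
        then obtain y where y: "y \<in> f" "y \<in> P i" by (auto simp: F'_def)
        have ff: "card f = r - 1 \<and> finite f \<and> f \<subseteq> U \<and> v \<notin> f \<and> insert v f \<in> E" using FamS f by blast
        then have "cov E v y" using y unfolding cov_def by (intro bexI[of _ "insert v f"]) auto
        then have "y \<in> N i" using y by (simp add: N_def)
        moreover have "f \<in> nsets V (Suc (r - 2))" using ff UV r2 by (auto simp: nsets_def)
        ultimately show "f \<in> {f\<in>nsets V (Suc (r - 2)). f \<inter> N i \<noteq> {}}" using y by blast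
      qed
      then have "card (Fam v - F') \<le> card {f\<in>nsets V (Suc (r - 2)). f \<inter> N i \<noteq> {}}"
        using finite_imp_finite_nsets[OF V, of "Suc (r - 2)"] by (intro card_mono) auto
      also have "\<dots> \<le> card (N i) * n ^ (r - 2)" unfolding n_def by (rule card_meeting_le[OF V NV])
      finally have "real (card (Fam v - F')) \<le> real (card (N i)) * real n ^ (r - 2)"
        by (simp flip: of_nat_mult of_nat_power)
      also have "\<dots> \<le> (\<eta> * real n) * real n ^ (r - 2)" using i(2) by (intro mult_right_mono) auto
      also have "\<dots> = \<eta> * real n ^ Suc (r - 2)" by simp
      also have "Suc (r - 2) = r - 1" using r2 by simp
      finally have 1: "real (card (Fam v - F')) \<le> \<eta> * real n ^ (r - 1)" .
      have "card (Fam v - F') = card (Fam v) - card F'" "card F' \<le> card (Fam v)"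
        using fF by (auto simp: F'_def card_Diff_subset card_mono)
      then have big: "(L - \<gamma> - \<eta>) * real n ^ (r - 1) \<le> real (card F')"
        using 1 degw[of v] by (simp add: algebra_simps of_nat_diff)
      have "good n P E \<xi>1 i v" unfolding good_def
      proof
        fix I assume I: "I \<in> nsets ({..<m} - {i}) (r - 1)"
        have "real (card (missing P E v I)) \<le> (\<rho> + \<gamma> + \<eta>) * real n ^ (r - 1)"
        proof (rule miss[OF i(1) I _ _ big])
          show "F' \<subseteq> link E v" by (auto simp: Fam_def F'_def)
          show "f \<subseteq> (\<Union>j\<in>{..<m} - {i}. P j) \<and> card f = r - 1 \<and> finite f \<and>
            (\<forall>j\<in>{..<m} - {i}. card (f \<inter> P j) \<le> 1)" if "f \<in> F'" for f
            unfolding UJ[OF i(1)] using that FamS[of f v] vtr[of f] by (auto simp: F'_def)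
        qed
        also have "\<dots> \<le> \<xi>1 * real n ^ (r - 1)"
          using gam(3) rho(2) xi1 by (intro mult_right_mono) (auto simp: \<eta>_def)
        finally show "real (card (missing P E v I)) \<le> \<xi>1 * real n ^ (r - 1)" .
      qed
      then show ?thesis using i(1) by blast
    next
      case False
      define H where "H = (\<lambda>I. {h\<in>PiE I P. insert v (h ` I) \<in> E})"
      have fN: "finite (nsets {..<m} (r - 1))" by (rule finite_imp_finite_nsets) simp
      have "card (Fam v) \<le> (\<Sum>I\<in>nsets {..<m} (r - 1). card {h\<in>PiE I P. h ` I \<in> Fam v})"
      proof (rule card_transversal_family_le[OF _ _ dj])
        show "f \<subseteq> (\<Union>j\<in>{..<m}. P j) \<and> card f = r - 1 \<and> finite f \<and> (\<forall>j\<in>{..<m}. card (f \<inter> P j) \<le> 1)"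
          if "f \<in> Fam v" for f using FamS[OF that] vtr[OF that] U by auto
      qed (use P in auto)
      also have "\<dots> \<le> (\<Sum>I\<in>nsets {..<m} (r - 1). card (H I))"
      proof (rule sum_mono)
        fix I assume I: "I \<in> nsets {..<m} (r - 1)"
        then have "finite (PiE I P)" using P by (intro finite_PiE) (auto simp: nsets_def)
        then show "card {h\<in>PiE I P. h ` I \<in> Fam v} \<le> card (H I)"
          using FamS by (intro card_mono) (auto simp: H_def)
      qed
      finally have c1: "real (card (Fam v)) \<le> (\<Sum>I\<in>nsets {..<m} (r - 1). real (card (H I)))"
        by (simp flip: of_nat_sum)
      have "\<exists>I0\<in>nsets {..<m} (r - 1). d * real n ^ (r - 1) \<le> real (card (H I0))"
      proof (rule ccontr)
        assume "\<not> ?thesis"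
        then have "\<And>I. I \<in> nsets {..<m} (r - 1) \<Longrightarrow> real (card (H I)) \<le> d * real n ^ (r - 1)" by force
        then have "(\<Sum>I\<in>nsets {..<m} (r - 1). real (card (H I))) \<le> (\<Sum>I\<in>nsets {..<m} (r - 1). d * real n ^ (r - 1))"
          by (rule sum_mono)
        also have "\<dots> = real (m choose (r - 1)) * (d * real n ^ (r - 1))" by (simp add: card_nsets)
        also have "\<dots> \<le> 2 ^ m * (d * real n ^ (r - 1))"
        proof (rule mult_right_mono)
          have "m choose (r - 1) \<le> 2 ^ m" by (rule binomial_le_pow2)
          then have "real (m choose (r - 1)) \<le> real (2 ^ m)" by (rule of_nat_mono)
          then show "real (m choose (r - 1)) \<le> 2 ^ m" by simp
        qed (use d in simp)
        also have "\<dots> = L / 2 * real n ^ (r - 1)" by (simp add: d_def)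
        finally have "(L - \<gamma>) * real n ^ (r - 1) \<le> L / 2 * real n ^ (r - 1)"
          using c1 degw[of v] by simp
        then have "L - \<gamma> \<le> L / 2" using nr by (simp only: mult_le_cancel_right_pos zero_less_power)
        then show False using gam(4) L0 by linarith
      qed
      then obtain I0 where I0: "I0 \<in> nsets {..<m} (r - 1)" "d * real n ^ (r - 1) \<le> real (card (H I0))"
        by blast
      have False
      proof (rule pendant_absent[OF nc n P dj gd _ vP I0(1) I0(2)[unfolded H_def] d _ eta])
        show "\<eta> * real n \<le> real (card {y\<in>P j. cov E v y})" if "j < m" for j
          using False that unfolding N_def by force
        show "2 ^ m * \<xi> < d * \<eta> ^ (m - (r - 1))" using pend by (simp add: q_def)
      qed (use xi in auto)
      then show ?thesis ..
    qed
    then obtain i where i: "i < m" "good n P E \<xi>1 i v" by blast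
    have vi: "\<not> cov E v y" if y: "y \<in> P i" for y
    proof (rule twins[OF i(1) _ i(2) gd1[OF i(1) y]])
      show "v \<noteq> y" using vP[OF i(1)] y by blast
      show "v \<notin> P j \<and> y \<notin> P j" if "j < m" "j \<noteq> i" for j
        using vP[OF that(1)] disjP[OF y i(1) that] by blast
    qed
    show "\<exists>i<m. \<forall>e\<in>E. e \<subseteq> insert v U \<longrightarrow> (\<forall>j<m. card (e \<inter> (P(i := insert v (P i))) j) \<le> 1)"
    proof (intro exI[of _ i] conjI ballI impI allI)
      fix e j assume e: "e \<in> E" "e \<subseteq> insert v U" and j: "j < m"
      show "card (e \<inter> (P(i := insert v (P i))) j) \<le> 1"
      proof (cases "v \<in> e")
        case False
        then have "e \<inter> (P(i := insert v (P i))) j = e \<inter> P j" by auto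
        moreover have "e \<subseteq> U" using e False by auto
        ultimately show ?thesis using part e(1) j by simp
      next
        case True
        define f where "f = e - {v}"
        have ef: "e = insert v f" using True by (auto simp: f_def)
        then have f: "f \<in> Fam v" using e by (auto simp: Fam_def link_def f_def insert_absorb)
        show ?thesis
        proof (cases "j = i")
          case True
          have "f \<inter> P i = {}"
          proof (rule ccontr)
            assume "f \<inter> P i \<noteq> {}"
            then obtain y where y: "y \<in> f" "y \<in> P i" by auto
            then have "cov E v y" using e(1) ef unfolding cov_def by (intro bexI[of _ e]) auto
            then show False using vi[OF y(2)] by simp
          qed
          then have "e \<inter> (P(i := insert v (P i))) j = {v}" using True ef by auto
          then show ?thesis by simp
        next
          case False
          then have "e \<inter> (P(i := insert v (P i))) j = f \<inter> P j" using ef vP[OF j] by auto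
          then show ?thesis using vtr[OF f j] by simp
        qed
      qed
    qed (rule i(1))
  qed (rule gam)
qed

end

subsection \<open>Stability\<close>

context enlarged_tree
begin

definition partite :: "'v set set \<Rightarrow> 'v set \<Rightarrow> bool" where
  "partite E U \<longleftrightarrow> (\<exists>P. disjoint_family_on P {..<m} \<and> U = (\<Union>j<m. P j) \<and>
     (\<forall>e\<in>E. e \<subseteq> U \<longrightarrow> (\<forall>j<m. card (e \<inter> P j) \<le> 1)))"

lemma partite_subset:
  assumes "partite E U" "U' \<subseteq> U" "\<And>e. e \<in> E' \<Longrightarrow> e \<subseteq> U' \<Longrightarrow> e \<in> E"
  shows "partite E' U'"
proof -
  obtain P where P: "disjoint_family_on P {..<m}" "U = (\<Union>j<m. P j)"
    "\<forall>e\<in>E. e \<subseteq> U \<longrightarrow> (\<forall>j<m. card (e \<inter> P j) \<le> 1)"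
    using assms(1) unfolding partite_def by (elim exE conjE)
  show ?thesis unfolding partite_def
  proof (intro exI[of _ "\<lambda>j. P j \<inter> U'"] conjI ballI impI allI)
    show "disjoint_family_on (\<lambda>j. P j \<inter> U') {..<m}"
      using P(1) by (auto simp: disjoint_family_on_def)
    show "U' = (\<Union>j<m. P j \<inter> U')" using P(2) assms(2) by auto
    fix e j assume e: "e \<in> E'" "e \<subseteq> U'" "j < m"
    then have "e \<inter> (P j \<inter> U') = e \<inter> P j" by auto
    moreover have "e \<in> E" "e \<subseteq> U" using assms e by auto
    ultimately show "card (e \<inter> (P j \<inter> U')) \<le> 1" using P(3) e(3) by simp
  qed
qed

text \<open>Discard the vertices of low degree, then put the remaining ones back one at a time.\<close>

lemma partite_improve:
  "\<exists>\<epsilon>0>0. \<forall>\<epsilon>. 0 < \<epsilon> \<longrightarrow> \<epsilon> \<le> \<epsilon>0 \<longrightarrow> (\<exists>\<delta>>0. \<forall>(V :: 'v set) E U0. dense_core_free \<delta> V E \<longrightarrow>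
    U0 \<subseteq> V \<longrightarrow> partite E U0 \<longrightarrow> (1 - 2 * \<epsilon>) * real (card V) \<le> real (card U0) \<longrightarrow>
    (\<exists>U\<subseteq>V. partite E U \<and> (1 - \<epsilon>) * real (card V) \<le> real (card U)))"
proof -
  obtain \<gamma> where g: "\<gamma> > 0" and ext: "\<forall>(V :: 'v set) E P v U. finite V \<longrightarrow> E \<subseteq> nsets V r \<longrightarrow> \<not> core_copy F E \<longrightarrow>
    disjoint_family_on P {..<m} \<longrightarrow> U = (\<Union>j<m. P j) \<longrightarrow> U \<subseteq> V \<longrightarrow>
    (\<forall>e\<in>E. e \<subseteq> U \<longrightarrow> (\<forall>j<m. card (e \<inter> P j) \<le> 1)) \<longrightarrow> v \<in> V - U \<longrightarrow>
    (1 - \<gamma>) * real (card V) \<le> real (card U) \<longrightarrow>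
    (\<forall>w\<in>insert v U. (L - \<gamma>) * real (card V) ^ (r - 1) \<le> real (card {f\<in>link E w. f \<subseteq> U})) \<longrightarrow>
    (\<exists>i<m. \<forall>e\<in>E. e \<subseteq> insert v U \<longrightarrow> (\<forall>j<m. card (e \<inter> (P(i := insert v (P i))) j) \<le> 1))"
    using extension[where 'v = 'v] by (elim exE conjE)
  show ?thesis
  \<comment> \<open>Half of \<gamma> goes into the threshold for low degrees, the other half pays
    for the link sets that leave \<open>U\<close>, of which a share up to
    \<open>3 * \<epsilon>\<close> is lost.\<close>
  proof (rule exI[of _ "\<gamma> / 6"], intro conjI allI impI)
    show "\<gamma> / 6 > 0" using g by simp
    fix \<epsilon> :: real assume eps: "0 < \<epsilon>" "\<epsilon> \<le> \<gamma> / 6"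
    have g2: "\<gamma> / 2 > 0" using g by simp
    obtain \<delta> where d: "\<delta> > 0" and low: "\<forall>(V :: 'v set) E. dense_core_free \<delta> V E \<longrightarrow>
      real (card {u\<in>V. real (card (link E u)) < (L - \<gamma> / 2) * real (card V) ^ (r - 1)}) \<le> \<epsilon> * real (card V)"
      using few_low_degrees[OF eps(1) g2, where 'v = 'v] by (elim exE conjE)
    show "\<exists>\<delta>>0. \<forall>(V :: 'v set) E U0. dense_core_free \<delta> V E \<longrightarrow>
      U0 \<subseteq> V \<longrightarrow> partite E U0 \<longrightarrow> (1 - 2 * \<epsilon>) * real (card V) \<le> real (card U0) \<longrightarrow>
      (\<exists>U\<subseteq>V. partite E U \<and> (1 - \<epsilon>) * real (card V) \<le> real (card U))"
    proof (intro exI[of _ \<delta>] conjI allI impI)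
      fix V :: "'v set" and E U0
      assume dense: "dense_core_free \<delta> V E"
        and U0: "U0 \<subseteq> V" "partite E U0" "(1 - 2 * \<epsilon>) * real (card V) \<le> real (card U0)"
      from dense have V: "finite V" and E: "E \<subseteq> nsets V r" and nc: "\<not> core_copy F E"
        by (simp_all add: dense_core_free_def)
      define n where "n = card V"
      define Z where "Z = {u\<in>V. real (card (link E u)) < (L - \<gamma> / 2) * real n ^ (r - 1)}"
      have Z: "Z \<subseteq> V" "finite Z" using V by (auto simp: Z_def)
      have cZ: "real (card Z) \<le> \<epsilon> * real n"
        using low[rule_format, OF dense] by (simp add: Z_def n_def)
      \<comment> \<open>A largest such set turns out to be all of \<open>V - Z\<close>. Its size
        depends on \<open>Z\<close> and no longer on \<open>U0\<close>, which is how
        \<open>2 * \<epsilon>\<close> improves to \<epsilon>.\<close>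
      define \<U> where "\<U> = {U. U0 - Z \<subseteq> U \<and> U \<subseteq> V - Z \<and> partite E U}"
      have "U0 - Z \<in> \<U>" using U0 partite_subset[OF U0(2), of "U0 - Z" E] by (auto simp: \<U>_def)
      moreover have "finite \<U>" using V by (rule finite_subset[rotated, OF finite_Pow_iff[THEN iffD2]]) (auto simp: \<U>_def)
      ultimately have "Max (card ` \<U>) \<in> card ` \<U>" by (intro Max_in) auto
      then obtain U where U: "U \<in> \<U>" "card U = Max (card ` \<U>)" by auto
      have Umax: "card U' \<le> card U" if "U' \<in> \<U>" for U'
        unfolding U(2) using that \<open>finite \<U>\<close> by simp
      have UV: "U0 - Z \<subseteq> U" "U \<subseteq> V - Z" "partite E U" using U(1) by (auto simp: \<U>_def)
      have fU: "finite U" using UV V by (meson finite_Diff finite_subset)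
      have fU0: "finite U0" using U0(1) V finite_subset by blast
      have "card U0 \<le> card (U0 - Z) + card Z"
        using card_mono[of "(U0 - Z) \<union> Z" U0] fU0 Z card_Un_le[of "U0 - Z" Z] by (simp add: Un_absorb2 le_trans)
      moreover have "card (U0 - Z) \<le> card U" using UV fU by (intro card_mono) auto
      ultimately have "real (card U0) \<le> real (card U) + real (card Z)" by linarith
      then have cU: "(1 - 3 * \<epsilon>) * real n \<le> real (card U)"
        using U0(3) cZ unfolding n_def by (simp add: algebra_simps)
      have "V - Z \<subseteq> U"
      proof (rule ccontr)
        assume "\<not> V - Z \<subseteq> U"
        then obtain v where v: "v \<in> V" "v \<notin> Z" "v \<notin> U" by blast
        obtain P where P: "disjoint_family_on P {..<m}" "U = (\<Union>j<m. P j)"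
          "\<forall>e\<in>E. e \<subseteq> U \<longrightarrow> (\<forall>j<m. card (e \<inter> P j) \<le> 1)"
          using UV(3) unfolding partite_def by (elim exE conjE)
        have "\<exists>i<m. \<forall>e\<in>E. e \<subseteq> insert v U \<longrightarrow> (\<forall>j<m. card (e \<inter> (P(i := insert v (P i))) j) \<le> 1)"
        proof (rule ext[rule_format, OF V E nc P(1,2)])
          show "U \<subseteq> V" using UV by auto
          show "card (e \<inter> P j) \<le> 1" if "e \<in> E" "e \<subseteq> U" "j < m" for e j using P(3) that by blast
          show "v \<in> V - U" using v by simp
          have "(1 - \<gamma>) * real n \<le> (1 - 3 * \<epsilon>) * real n"
            using eps by (intro mult_right_mono) auto
          then show "(1 - \<gamma>) * real (card V) \<le> real (card U)" using cU by (simp add: n_def)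
          fix w assume w: "w \<in> insert v U"
          then have wV: "w \<in> V" "w \<notin> Z" using v UV by auto
          have lk: "link E w \<subseteq> nsets V (Suc (r - 2))"
            using link_nsets[of E V "r - 1" w] E r2 by (force simp: nsets_def)
          have fl: "finite (link E w)" using finite_nsets_sub[OF V lk] .
          have "card {f\<in>link E w. \<not> f \<subseteq> U} \<le> card {f\<in>nsets V (Suc (r - 2)). f \<inter> (V - U) \<noteq> {}}"
            using lk V by (intro card_mono) (auto simp: nsets_def finite_imp_finite_nsets)
          also have "\<dots> \<le> card (V - U) * n ^ (r - 2)" unfolding n_def by (rule card_meeting_le[OF V]) auto
          finally have "real (card {f\<in>link E w. \<not> f \<subseteq> U}) \<le> real (card (V - U)) * real n ^ (r - 2)"
            by (simp flip: of_nat_mult of_nat_power)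
          also have "\<dots> \<le> (3 * \<epsilon> * real n) * real n ^ (r - 2)"
          proof (rule mult_right_mono)
            have "card (V - U) = n - card U" using fU UV by (auto simp: n_def intro: card_Diff_subset)
            moreover have "card U \<le> n" unfolding n_def using UV V by (intro card_mono) auto
            ultimately show "real (card (V - U)) \<le> 3 * \<epsilon> * real n" using cU by (simp add: of_nat_diff algebra_simps)
          qed simp
          also have "\<dots> = 3 * \<epsilon> * real n ^ Suc (r - 2)" by simp
          also have "Suc (r - 2) = r - 1" using r2 by simp
          finally have 1: "real (card {f\<in>link E w. \<not> f \<subseteq> U}) \<le> 3 * \<epsilon> * real n ^ (r - 1)" .
          have "3 * \<epsilon> * real n ^ (r - 1) \<le> \<gamma> / 2 * real n ^ (r - 1)"
            using eps by (intro mult_right_mono) auto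
          then have 2: "real (card {f\<in>link E w. \<not> f \<subseteq> U}) \<le> \<gamma> / 2 * real n ^ (r - 1)" using 1 by linarith
          have "link E w = {f\<in>link E w. f \<subseteq> U} \<union> {f\<in>link E w. \<not> f \<subseteq> U}" by auto
          then have "card (link E w) \<le> card {f\<in>link E w. f \<subseteq> U} + card {f\<in>link E w. \<not> f \<subseteq> U}"
            using card_Un_le by metis
          then have 3: "real (card (link E w)) \<le> real (card {f\<in>link E w. f \<subseteq> U}) + \<gamma> / 2 * real n ^ (r - 1)"
            using 2 by linarith
          have 4: "(L - \<gamma> / 2) * real n ^ (r - 1) \<le> real (card (link E w))" using wV by (auto simp: Z_def)
          have *: "(l - \<gamma>) * N = (l - \<gamma> / 2) * N - \<gamma> / 2 * N" for l N :: real by (simp add: algebra_simps)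
          have "(L - \<gamma>) * real n ^ (r - 1) = (L - \<gamma> / 2) * real n ^ (r - 1) - \<gamma> / 2 * real n ^ (r - 1)" by (rule *)
          also have "\<dots> \<le> real (card (link E w)) - \<gamma> / 2 * real n ^ (r - 1)"
            by (rule diff_right_mono[OF 4])
          also have "\<dots> \<le> real (card {f\<in>link E w. f \<subseteq> U})" using 3 by linarith
          finally show "(L - \<gamma>) * real (card V) ^ (r - 1) \<le> real (card {f\<in>link E w. f \<subseteq> U})"
            unfolding n_def .
        qed
        then obtain i where i: "i < m" "\<forall>e\<in>E. e \<subseteq> insert v U \<longrightarrow> (\<forall>j<m. card (e \<inter> (P(i := insert v (P i))) j) \<le> 1)"
          by blast
        have "partite E (insert v U)" unfolding partite_def
        proof (intro exI[of _ "P(i := insert v (P i))"] conjI)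
          have "v \<notin> P j" if "j < m" for j using v P(2) that by auto
          then show "disjoint_family_on (P(i := insert v (P i))) {..<m}"
            using P(1) by (auto simp: disjoint_family_on_def)
          show "insert v U = (\<Union>j<m. (P(i := insert v (P i))) j)"
            unfolding P(2) using i(1) by (auto split: if_splits)
        qed (rule i(2))
        then have "insert v U \<in> \<U>" using v UV by (auto simp: \<U>_def)
        from Umax[OF this] show False using v(3) fU by simp
      qed
      then have "card (V - Z) \<le> card U" using fU by (intro card_mono) auto
      moreover have "card (V - Z) = n - card Z" using Z by (simp add: card_Diff_subset n_def)
      ultimately have "(1 - \<epsilon>) * real n \<le> real (card U)" using cZ by (simp add: algebra_simps)
      then show "\<exists>U\<subseteq>V. partite E U \<and> (1 - \<epsilon>) * real (card V) \<le> real (card U)"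
        using UV unfolding n_def by blast
    qed (rule d)
  qed
qed

end

section \<open>Blow-ups and the move of a single vertex between fibres\<close>

lemma card_blowup_le:
  fixes V :: "'w set" and c :: "'w \<Rightarrow> 'v"
  assumes "finite V" "finite E" "n > 0" "E \<subseteq> nsets W r"
  shows "real (card (blowup V r c E)) \<le>
    real n ^ r * wsum {e\<in>E. e \<subseteq> c ` V} (\<lambda>s. real (card {u\<in>V. c u = s}) / real n)"
proof -
  define E' where "E' = {e\<in>E. e \<subseteq> c ` V}"
  define fib where "fib = (\<lambda>s. {u\<in>V. c u = s})"
  have fE': "finite E'" using assms(2) by (simp add: E'_def)
  have E'e: "finite e" "card e = r" if "e \<in> E'" for e using that assms(4) by (auto simp: E'_def nsets_def)
  have fP: "finite (PiE e fib)" if "e \<in> E'" for e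
    using E'e[OF that] assms(1) by (intro finite_PiE) (auto simp: fib_def)
  have "blowup V r c E \<subseteq> (\<Union>e\<in>E'. (\<lambda>g. g ` e) ` PiE e fib)"
  proof
    fix e assume e: "e \<in> blowup V r c E"
    then have e': "e \<subseteq> V" "inj_on c e" "c ` e \<in> E'" by (auto simp: blowup_def nsets_def E'_def)
    define g where "g = restrict (inv_into e c) (c ` e)"
    have "g ` (c ` e) = e" unfolding g_def using e'(2) by (simp add: image_image)
    moreover have "g \<in> PiE (c ` e) fib"
      unfolding g_def using e' by (auto simp: fib_def)
    ultimately show "e \<in> (\<Union>e\<in>E'. (\<lambda>g. g ` e) ` PiE e fib)" using e'(3) by blast
  qed
  then have "card (blowup V r c E) \<le> card (\<Union>e\<in>E'. (\<lambda>g. g ` e) ` PiE e fib)"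
    using fE' fP by (intro card_mono) auto
  also have "\<dots> \<le> (\<Sum>e\<in>E'. card ((\<lambda>g. g ` e) ` PiE e fib))" by (rule card_UN_le[OF fE'])
  also have "\<dots> \<le> (\<Sum>e\<in>E'. card (PiE e fib))" using fP by (intro sum_mono card_image_le)
  also have "\<dots> = (\<Sum>e\<in>E'. \<Prod>s\<in>e. card (fib s))" using E'e by (intro sum.cong) (auto simp: card_PiE)
  finally have "real (card (blowup V r c E)) \<le> real (\<Sum>e\<in>E'. \<Prod>s\<in>e. card (fib s))" by (rule of_nat_mono)
  also have "\<dots> = (\<Sum>e\<in>E'. \<Prod>s\<in>e. real (card (fib s)))" by simp
  also have "\<dots> = real n ^ r * wsum E' (\<lambda>s. real (card (fib s)) / real n)"
    unfolding wsum_def sum_distrib_left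
    using E'e assms(3) by (intro sum.cong) (auto simp: prod_dividef)
  finally show ?thesis by (simp add: E'_def fib_def)
qed

lemma card_split_link:
  assumes "finite E"
  shows "card E = card {e\<in>E. v \<notin> e} + card (link E v)"
proof -
  have "E = {e\<in>E. v \<notin> e} \<union> {e\<in>E. v \<in> e}" by auto
  then have "card E = card {e\<in>E. v \<notin> e} + card {e\<in>E. v \<in> e}"
    using card_Un_disjoint[of "{e\<in>E. v \<notin> e}" "{e\<in>E. v \<in> e}"] assms by auto
  also have "card {e\<in>E. v \<in> e} = card (link E v)"
    unfolding link_image by (rule card_image[OF inj_on_insert_link])
  finally show ?thesis .
qed

text \<open>Edges avoiding \<open>v\<close> are unaffected. A link set of \<open>u\<close> cannot
  contain \<open>v\<close>, as their fibres are not covered, so after the move it is a link set of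
  \<open>v\<close>: the old degree of \<open>v\<close> is exchanged for at least that of
  \<open>u\<close>.\<close>

lemma card_blowup_move:
  assumes "finite V" "u \<in> V" "v \<in> V" "\<not> cov E (c u) (c v)"
  shows "card (blowup V r c E) + card (link (blowup V r c E) u) \<le>
    card (blowup V r (c(v := c u)) E) + card (link (blowup V r c E) v)"
proof -
  define c' where "c' = c(v := c u)"
  have fin: "finite (blowup V r d E)" for d
    using finite_imp_finite_nsets[OF assms(1), of r] by (simp add: blowup_def)
  have "{e\<in>blowup V r c' E. v \<notin> e} = {e\<in>blowup V r c E. v \<notin> e}"
  proof -
    have "inj_on c' e = inj_on c e" "c' ` e = c ` e" if "v \<notin> e" for e
      using that by (auto simp: c'_def inj_on_def)
    then show ?thesis by (auto simp: blowup_def)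
  qed
  moreover have "link (blowup V r c E) u \<subseteq> link (blowup V r c' E) v"
  proof
    fix f assume f: "f \<in> link (blowup V r c E) u"
    then have f': "u \<notin> f" "insert u f \<in> nsets V r" "inj_on c (insert u f)" "insert (c u) (c ` f) \<in> E"
      by (auto simp: link_def blowup_def)
    have "v \<notin> f"
    proof
      assume "v \<in> f"
      then have "cov E (c u) (c v)" using f'(4) unfolding cov_def by (intro bexI[OF _ f'(4)]) auto
      with assms(4) show False by simp
    qed
    have cf: "c' ` f = c ` f" "c' v = c u" using \<open>v \<notin> f\<close> by (auto simp: c'_def)
    have "inj_on c' f" using f'(3) \<open>v \<notin> f\<close> by (auto simp: c'_def inj_on_def)
    moreover have "c u \<notin> c ` f" using f'(1,3) by (auto simp: inj_on_insert)
    ultimately have "inj_on c' (insert v f)" using cf \<open>v \<notin> f\<close> by (auto simp: inj_on_insert)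
    moreover have "insert v f \<in> nsets V r" using f'(1,2) \<open>v \<notin> f\<close> assms(3) by (auto simp: nsets_def)
    ultimately show "f \<in> link (blowup V r c' E) v"
      using \<open>v \<notin> f\<close> f'(4) cf by (simp add: link_def blowup_def)
  qed
  then have "card (link (blowup V r c E) u) \<le> card (link (blowup V r c' E) v)"
    by (intro card_mono finite_link fin)
  ultimately show ?thesis
    using card_split_link[OF fin[of c], of v] card_split_link[OF fin[of c'], of v]
    unfolding c'_def by simp
qed

text \<open>Moving a vertex to a fibre at least as large increases the sum of squares by convexity.
  This is the progress measure when the two degrees are equal.\<close>

lemma sum_fibre_squares_move:
  fixes c :: "'w \<Rightarrow> 'w"
  assumes "finite V" "u \<in> V" "v \<in> V" "c u \<noteq> c v" "c ` V \<subseteq> V"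
    and "card {x\<in>V. c x = c v} \<le> card {x\<in>V. c x = c u}"
  shows "(\<Sum>s\<in>V. (card {x\<in>V. c x = s})\<^sup>2) < (\<Sum>s\<in>V. (card {x\<in>V. (c(v := c u)) x = s})\<^sup>2)"
proof -
  define c' where "c' = c(v := c u)"
  define a b where "a = card {x\<in>V. c x = c u}" and "b = card {x\<in>V. c x = c v}"
  have cV: "c u \<in> V" "c v \<in> V" using assms(2,3,5) by (simp_all add: image_subset_iff)
  have split: "sum f V = f (c u) + (f (c v) + sum f (V - {c u, c v}))" for f :: "'w \<Rightarrow> nat"
  proof -
    have eq: "V - {c v} - {c u} = V - {c u, c v}" by blast
    have "sum f (V - {c v}) = f (c u) + sum f (V - {c v} - {c u})"
      by (rule sum.remove) (use assms(1,4) cV in blast)+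
    moreover have "sum f V = f (c v) + sum f (V - {c v})"
      by (rule sum.remove[OF assms(1) cV(2)])
    ultimately show ?thesis unfolding eq by linarith
  qed
  have same: "(\<Sum>s\<in>V - {c u, c v}. (card {x\<in>V. c' x = s})\<^sup>2) = (\<Sum>s\<in>V - {c u, c v}. (card {x\<in>V. c x = s})\<^sup>2)"
  proof (rule sum.cong[OF refl])
    fix s assume "s \<in> V - {c u, c v}"
    then have "{x\<in>V. c' x = s} = {x\<in>V. c x = s}" by (auto simp: c'_def)
    then show "(card {x\<in>V. c' x = s})\<^sup>2 = (card {x\<in>V. c x = s})\<^sup>2" by simp
  qed
  have "{x\<in>V. c' x = c u} = insert v {x\<in>V. c x = c u}" using assms(3) by (auto simp: c'_def)
  then have 1: "card {x\<in>V. c' x = c u} = Suc a" using assms(1,4) by (auto simp: a_def)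
  have "{x\<in>V. c' x = c v} = {x\<in>V. c x = c v} - {v}" using assms(4) by (auto simp: c'_def)
  then have 2: "card {x\<in>V. c' x = c v} = b - 1" using assms(1,3) by (simp add: b_def)
  have "v \<in> {x\<in>V. c x = c v}" using assms(3) by simp
  then have "b > 0" unfolding b_def using assms(1) by (auto simp: card_gt_0_iff)
  then obtain b' where b': "b = Suc b'" by (cases b) auto
  have "a\<^sup>2 + b\<^sup>2 < (Suc a)\<^sup>2 + (b - 1)\<^sup>2"
    using assms(6) unfolding a_def[symmetric] b_def[symmetric] b' by (simp add: power2_eq_square)
  moreover have "(\<Sum>s\<in>V. (card {x\<in>V. c x = s})\<^sup>2) = a\<^sup>2 + (b\<^sup>2 + (\<Sum>s\<in>V - {c u, c v}. (card {x\<in>V. c x = s})\<^sup>2))"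
    unfolding split a_def b_def ..
  moreover have "(\<Sum>s\<in>V. (card {x\<in>V. c' x = s})\<^sup>2) = (Suc a)\<^sup>2 + ((b - 1)\<^sup>2 + (\<Sum>s\<in>V - {c u, c v}. (card {x\<in>V. c' x = s})\<^sup>2))"
    unfolding split 1 2 ..
  ultimately show ?thesis unfolding same c'_def[symmetric] by linarith
qed

lemma sum_fibres:
  assumes "finite V" "finite B"
  shows "(\<Sum>s\<in>B. real (card {u\<in>V. c u = s})) = real (card {u\<in>V. c u \<in> B})"
proof -
  have "{u\<in>V. c u \<in> B} = (\<Union>s\<in>B. {u\<in>V. c u = s})" by auto
  also have "card \<dots> = (\<Sum>s\<in>B. card {u\<in>V. c u = s})"
    using assms by (intro card_UN_disjoint) auto
  finally show ?thesis by simp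
qed

text \<open>Converts a density relative to the binomial coefficient into one relative to
  \<open>n ^ r\<close>, with a relative error that vanishes for large \<open>n\<close>.\<close>

lemma choose_ge:
  assumes "r \<le> n" "n > 0"
  shows "(1 - real r ^ 2 / real n) * real n ^ r \<le> fact r * real (n choose r)"
proof -
  have "1 - real r ^ 2 / real n = 1 + real r * (- (real r / real n))" by (simp add: power2_eq_square)
  also have "\<dots> \<le> (1 + - (real r / real n)) ^ r"
    using assms by (intro Bernoulli_inequality) (simp add: field_simps)
  finally have "(1 - real r ^ 2 / real n) * real n ^ r \<le> (1 - real r / real n) ^ r * real n ^ r"
    by (intro mult_right_mono) auto
  also have "\<dots> = (real n - real r) ^ r"
    using assms by (simp add: field_simps flip: power_mult_distrib)
  also have "\<dots> = (\<Prod>i<r. real n - real r)" by simp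
  also have "\<dots> \<le> (\<Prod>i<r. real n - real i)"
    using assms by (intro prod_mono) auto
  also have "\<dots> = fact r * real (n choose r)"
    by (simp add: binomial_gbinomial gbinomial_prod_rev atLeast0LessThan)
  finally show ?thesis .
qed

context enlarged_tree
begin

text \<open>The relative fibre sizes are a nearly optimal weighting of a sparse hypergraph. At most
  \<open>m\<close> fibres thus hold nearly all vertices, and they are themselves the parts, since an
  edge of a blow-up meets each fibre at most once.\<close>

lemma partite_of_covered_fibres:
  fixes V :: "'w set" and c :: "'w \<Rightarrow> 'w" and \<delta> \<epsilon> :: real
  assumes "finite V" "V \<noteq> {}" "c ` V \<subseteq> V" "E \<subseteq> nsets V r" "\<not> core_copy F E"
    and "\<And>u v. u \<in> V \<Longrightarrow> v \<in> V \<Longrightarrow> c u \<noteq> c v \<Longrightarrow> cov E (c u) (c v)"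
    and stab: "\<forall>(S :: 'w set) E x. near_optimal k r \<delta> S E x \<longrightarrow> (\<exists>B\<subseteq>S. card B \<le> m \<and> 1 - \<epsilon> \<le> sum x B)"
    and big: "(lam k r - \<delta>) * real (card V) ^ r \<le> fact r * real (card (blowup V r c E))"
  shows "\<exists>U\<subseteq>V. partite (blowup V r c E) U \<and> (1 - \<epsilon>) * real (card V) \<le> real (card U)"
proof -
  define n where "n = card V"
  have n: "n > 0" using assms(1,2) by (auto simp: n_def card_gt_0_iff)
  define S where "S = c ` V"
  have S: "finite S" using assms(1) by (simp add: S_def)
  define x where "x = (\<lambda>s. real (card {u\<in>V. c u = s}) / real n)"
  have fE: "finite E" using finite_nsets_sub[OF assms(1,4)] .
  have sumx: "sum x B = real (card {u\<in>V. c u \<in> B}) / real n" if "finite B" for B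
    unfolding x_def using sum_fibres[OF assms(1) that, of c] by (simp flip: sum_divide_distrib)
  have "\<exists>B\<subseteq>S. card B \<le> m \<and> 1 - \<epsilon> \<le> sum x B"
  proof (rule stab[rule_format], unfold near_optimal_def, intro conjI S)
    show "{e\<in>E. e \<subseteq> S} \<subseteq> nsets S r" using assms(4) by (auto simp: nsets_def)
    show "sparse k r S {e\<in>E. e \<subseteq> S}"
      by (rule sparse_of_covered[OF assms(5) S]) (use assms(6) in \<open>auto simp: S_def\<close>)
    show "\<forall>i\<in>S. 0 \<le> x i" by (simp add: x_def)
    have "{u\<in>V. c u \<in> S} = V" by (auto simp: S_def)
    then show "sum x S = 1" using sumx[OF S] n by (simp add: n_def)
    have "fact r * real (card (blowup V r c E)) \<le> fact r * (real n ^ r * wsum {e\<in>E. e \<subseteq> S} x)"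
      using card_blowup_le[OF assms(1) fE n assms(4)] unfolding S_def x_def
      by (intro mult_left_mono) auto
    also have "\<dots> = (fact r * wsum {e\<in>E. e \<subseteq> S} x) * real n ^ r" by simp
    finally have "(lam k r - \<delta>) * real n ^ r \<le> (fact r * wsum {e\<in>E. e \<subseteq> S} x) * real n ^ r"
      using big unfolding n_def by (rule order_trans[rotated])
    then show "lam k r - \<delta> \<le> fact r * wsum {e\<in>E. e \<subseteq> S} x"
      using n by simp
  qed
  then obtain B where B: "B \<subseteq> S" "card B \<le> m" "1 - \<epsilon> \<le> sum x B" by blast
  have fB: "finite B" using B(1) S finite_subset by blast
  define U where "U = {u\<in>V. c u \<in> B}"
  have "(1 - \<epsilon>) * real n \<le> real (card U)"
    using B(3) n unfolding sumx[OF fB] U_def by (simp add: pos_le_divide_eq)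
  moreover have "partite (blowup V r c E) U"
  proof -
    obtain b where b: "bij_betw b {..<card B} B"
      using ex_bij_betw_nat_finite[OF fB] by (auto simp: atLeast0LessThan)
    have binj: "i = j" if "i < card B" "j < card B" "b i = b j" for i j
      using b that by (auto simp: bij_betw_def inj_on_def)
    define P where "P = (\<lambda>j. if j < card B then {u\<in>V. c u = b j} else {})"
    show ?thesis unfolding partite_def
    proof (intro exI[of _ P] conjI ballI impI allI)
      show "disjoint_family_on P {..<m}"
        using binj by (auto simp: disjoint_family_on_def P_def)
      show "U = (\<Union>j<m. P j)"
      proof
        show "U \<subseteq> (\<Union>j<m. P j)"
        proof
          fix u assume u: "u \<in> U"
          then have "c u \<in> b ` {..<card B}" using b by (auto simp: U_def bij_betw_def)
          then obtain j where "j < card B" "c u = b j" by auto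
          then show "u \<in> (\<Union>j<m. P j)" using u B(2) by (auto simp: P_def U_def intro!: bexI[of _ j])
        qed
        show "(\<Union>j<m. P j) \<subseteq> U" using b by (auto simp: P_def U_def bij_betw_def split: if_splits)
      qed
      fix e j assume e: "e \<in> blowup V r c E"
      then have inj: "inj_on c e" and fe: "finite e" by (auto simp: blowup_def nsets_def)
      have "x = y" if "x \<in> e \<inter> P j" "y \<in> e \<inter> P j" for x y
        using that inj by (auto simp: P_def inj_on_def split: if_splits)
      then show "card (e \<inter> P j) \<le> 1" using fe by (simp add: card_le_Suc0_iff_eq)
    qed
  qed
  moreover have "U \<subseteq> V" by (auto simp: U_def)
  ultimately show ?thesis unfolding n_def by (intro exI[of _ U] conjI)
qed

text \<open>Among the blow-ups \<open>blowup V r c E\<close> violating the claim, take one with the most edges and then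
  with the most concentrated fibres. Moving one vertex between two fibres that are not covered
  destroys the violation, hence reveals a large partite subgraph avoiding only that vertex.\<close>

lemma core_free_stability:
  "\<exists>\<epsilon>0>0. \<forall>\<epsilon>. 0 < \<epsilon> \<longrightarrow> \<epsilon> \<le> \<epsilon>0 \<longrightarrow> (\<exists>\<delta>>0. \<forall>(V :: 'v set) E. dense_core_free \<delta> V E \<longrightarrow> 1 / \<epsilon> \<le> real (card V) \<longrightarrow>
    (\<exists>U\<subseteq>V. partite E U \<and> (1 - \<epsilon>) * real (card V) \<le> real (card U)))"
proof -
  obtain \<epsilon>0 where e0: "\<epsilon>0 > 0" and imp: "\<forall>\<epsilon>. 0 < \<epsilon> \<longrightarrow> \<epsilon> \<le> \<epsilon>0 \<longrightarrow> (\<exists>\<delta>>0. \<forall>(V :: 'v set) E U0. dense_core_free \<delta> V E \<longrightarrow>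
    U0 \<subseteq> V \<longrightarrow> partite E U0 \<longrightarrow> (1 - 2 * \<epsilon>) * real (card V) \<le> real (card U0) \<longrightarrow>
    (\<exists>U\<subseteq>V. partite E U \<and> (1 - \<epsilon>) * real (card V) \<le> real (card U)))"
    using partite_improve[where 'v = 'v] by (elim exE conjE)
  show ?thesis
  proof (rule exI[of _ \<epsilon>0], intro conjI allI impI)
    fix \<epsilon> :: real assume eps: "0 < \<epsilon>" "\<epsilon> \<le> \<epsilon>0"
    obtain \<delta>1 where d1: "\<delta>1 > 0" and improve: "\<forall>(V :: 'v set) E U0. dense_core_free \<delta>1 V E \<longrightarrow>
      U0 \<subseteq> V \<longrightarrow> partite E U0 \<longrightarrow> (1 - 2 * \<epsilon>) * real (card V) \<le> real (card U0) \<longrightarrow>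
      (\<exists>U\<subseteq>V. partite E U \<and> (1 - \<epsilon>) * real (card V) \<le> real (card U))"
      using imp[rule_format, OF eps] by (elim exE conjE)
    obtain \<delta>2 where d2: "\<delta>2 > 0" and stab: "\<forall>(S :: 'v set) E x. near_optimal k r \<delta>2 S E x \<longrightarrow>
      (\<exists>B\<subseteq>S. card B \<le> m \<and> 1 - \<epsilon> \<le> sum x B)"
      using lagrangian_stability[OF k3 r2 condkr eps(1), where 'v = 'v] by (elim exE conjE)
    define \<delta> where "\<delta> = min \<delta>1 (\<delta>2 / fact r)"
    have d: "\<delta> > 0" "\<delta> \<le> \<delta>1" "\<delta> \<le> \<delta>2 / fact r" using d1 d2 by (auto simp: \<delta>_def)
    show "\<exists>\<delta>>0. \<forall>(V :: 'v set) E. dense_core_free \<delta> V E \<longrightarrow> 1 / \<epsilon> \<le> real (card V) \<longrightarrow>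
      (\<exists>U\<subseteq>V. partite E U \<and> (1 - \<epsilon>) * real (card V) \<le> real (card U))"
    proof (rule exI[of _ \<delta>], intro conjI allI impI)
      fix V :: "'v set" and E
      assume "dense_core_free \<delta> V E" and nbig: "1 / \<epsilon> \<le> real (card V)"
      then have V: "finite V" "V \<noteq> {}" and E: "E \<subseteq> nsets V r"
        and nc: "\<not> core_copy F E" and big: "(lam k r / fact r - \<delta>) * real (card V) ^ r \<le> real (card E)"
        by (simp_all add: dense_core_free_def)
      define n where "n = card V"
      define thr where "thr = (lam k r / fact r - \<delta>) * real n ^ r"
      define Eb where "Eb = (\<lambda>c. blowup V r c E)"
      define Good where "Good = (\<lambda>c. \<exists>U\<subseteq>V. partite (Eb c) U \<and> (1 - \<epsilon>) * real n \<le> real (card U))"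
      \<comment> \<open>Maps of \<open>V\<close> into itself form a finite set, so if there is a
        violation there is an extremal one.\<close>
      define Bad where "Bad = {c\<in>PiE V (\<lambda>_. V). thr \<le> real (card (Eb c)) \<and> \<not> Good c}"
      define \<Psi> where "\<Psi> = (\<lambda>c :: 'v \<Rightarrow> 'v. \<Sum>s\<in>V. (card {x\<in>V. c x = s})\<^sup>2)"
      \<comment> \<open>A lexicographic order in one number: the factor
        \<open>Suc (n * n\<^sup>2)\<close> exceeds every value of \<Psi>.\<close>
      define \<mu> where "\<mu> = (\<lambda>c. card (Eb c) * Suc (n * n\<^sup>2) + \<Psi> c)"
      have Ebs: "Eb c \<subseteq> nsets V r" for c by (auto simp: Eb_def blowup_def)
      have Ebnc: "\<not> core_copy F (Eb c)" for c using core_copy_blowup nc unfolding Eb_def by blast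
      have psi: "\<Psi> c \<le> n * n\<^sup>2" for c
      proof -
        have "\<Psi> c \<le> (\<Sum>s\<in>V. n\<^sup>2)" unfolding \<Psi>_def n_def
          using V(1) by (intro sum_mono power_mono card_mono) auto
        then show ?thesis by (simp add: n_def)
      qed
      have noBad: "Bad = {}"
      proof (rule ccontr)
        assume ne: "Bad \<noteq> {}"
        have fin: "finite Bad" using V(1) by (simp add: Bad_def finite_PiE)
        have "Max (\<mu> ` Bad) \<in> \<mu> ` Bad" using ne fin by (intro Max_in) auto
        then obtain c where c: "c \<in> Bad" "\<mu> c = Max (\<mu> ` Bad)" by auto
        have cmax: "\<mu> c' \<le> \<mu> c" if "c' \<in> Bad" for c' unfolding c(2) using that fin by simp
        have cPi: "c \<in> PiE V (\<lambda>_. V)" and cthr: "thr \<le> real (card (Eb c))" and cG: "\<not> Good c"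
          using c(1) by (auto simp: Bad_def)
        have cV: "c ` V \<subseteq> V" using cPi by auto
        show False
        proof (cases "\<forall>u\<in>V. \<forall>v\<in>V. c u \<noteq> c v \<longrightarrow> cov E (c u) (c v)")
          case True
          have "fact r * thr \<le> fact r * real (card (Eb c))" using cthr by (intro mult_left_mono) auto
          moreover have "(lam k r - \<delta>2) * real n ^ r \<le> fact r * thr"
          proof -
            have "fact r * \<delta> \<le> \<delta>2" using d(3) by (simp add: field_simps)
            then have "(lam k r - \<delta>2) * real n ^ r \<le> (lam k r - fact r * \<delta>) * real n ^ r"
              by (intro mult_right_mono) auto
            also have "\<dots> = fact r * thr" by (simp add: thr_def algebra_simps)
            finally show ?thesis .
          qed
          ultimately have "(lam k r - \<delta>2) * real (card V) ^ r \<le> fact r * real (card (blowup V r c E))"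
            unfolding Eb_def n_def by linarith
          then have "Good c" unfolding Good_def Eb_def n_def
            using True by (intro partite_of_covered_fibres[OF V cV E nc _ stab]) auto
          with cG show False by simp
        next
          case False
          then obtain a b where ab: "a \<in> V" "b \<in> V" "c a \<noteq> c b" "\<not> cov E (c a) (c b)" by blast
          define deg where "deg = (\<lambda>x. card (link (Eb c) x))"
          define fib where "fib = (\<lambda>x. card {y\<in>V. c y = c x})"
          have uv: "\<exists>u v. u \<in> V \<and> v \<in> V \<and> c u \<noteq> c v \<and> \<not> cov E (c u) (c v) \<and>
            (deg v < deg u \<or> deg v = deg u \<and> fib v \<le> fib u)"
          proof (cases "deg b < deg a \<or> deg b = deg a \<and> fib b \<le> fib a")
            case True
            then show ?thesis using ab by blast
          next
            case False
            then have "deg a < deg b \<or> deg a = deg b \<and> fib a \<le> fib b" by linarith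
            moreover have "\<not> cov E (c b) (c a)" using ab(4) cov_sym[of E "c a" "c b"] by simp
            moreover have "c b \<noteq> c a" using ab(3) by simp
            ultimately show ?thesis using ab(1,2) by blast
          qed
          then obtain u v where u: "u \<in> V" and v: "v \<in> V" and cuv: "c u \<noteq> c v" "\<not> cov E (c u) (c v)"
            and ord: "deg v < deg u \<or> deg v = deg u \<and> fib v \<le> fib u" by blast
          define c' where "c' = c(v := c u)"
          have c'Pi: "c' \<in> PiE V (\<lambda>_. V)" using cPi u v by (auto simp: c'_def PiE_def extensional_def)
          have mv: "card (Eb c) + deg u \<le> card (Eb c') + deg v"
            unfolding Eb_def deg_def c'_def by (rule card_blowup_move[where c = c, OF V(1) u v cuv(2)])
          have "\<mu> c < \<mu> c'"
          proof (cases "deg v < deg u")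
            case True
            then have "Suc (card (Eb c)) \<le> card (Eb c')" using mv by linarith
            then have "Suc (card (Eb c)) * Suc (n * n\<^sup>2) \<le> card (Eb c') * Suc (n * n\<^sup>2)"
              by (rule mult_le_mono1)
            moreover have "\<mu> c < Suc (card (Eb c)) * Suc (n * n\<^sup>2)" unfolding \<mu>_def using psi[of c] by simp
            moreover have "card (Eb c') * Suc (n * n\<^sup>2) \<le> \<mu> c'" unfolding \<mu>_def by simp
            ultimately show ?thesis by linarith
          next
            case False
            then have "card (Eb c) \<le> card (Eb c')" using mv ord by linarith
            then have "card (Eb c) * Suc (n * n\<^sup>2) \<le> card (Eb c') * Suc (n * n\<^sup>2)" by (rule mult_le_mono1)
            moreover have "\<Psi> c < \<Psi> c'" unfolding \<Psi>_def c'_def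
              by (rule sum_fibre_squares_move[OF V(1) u v cuv(1) cV]) (use ord False in \<open>auto simp: fib_def\<close>)
            ultimately show ?thesis unfolding \<mu>_def by linarith
          qed
          then have "c' \<notin> Bad" using cmax[of c'] by auto
          moreover have "card (Eb c) \<le> card (Eb c')" using mv ord by linarith
          then have "thr \<le> real (card (Eb c'))" using cthr by linarith
          ultimately have "Good c'" using c'Pi by (simp add: Bad_def)
          then obtain U where U: "U \<subseteq> V" "partite (Eb c') U" "(1 - \<epsilon>) * real n \<le> real (card U)"
            unfolding Good_def by (elim exE conjE)
          \<comment> \<open>Both blow-ups agree on the edges avoiding \<open>v\<close>, so the set
            found for \<open>c'\<close> works for \<open>c\<close> without \<open>v\<close>. As
            \<open>n\<close> is at least \<open>1 / \<epsilon>\<close>, the lost vertex is at most a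
            share \<epsilon>.\<close>
          define U0 where "U0 = U - {v}"
          have "partite (Eb c) U0"
          proof (rule partite_subset[OF U(2)])
            fix e assume e: "e \<in> Eb c" "e \<subseteq> U0"
            then have "v \<notin> e" by (auto simp: U0_def)
            then have "inj_on c' e = inj_on c e" "c' ` e = c ` e" by (auto simp: c'_def inj_on_def)
            then show "e \<in> Eb c'" using e(1) by (simp add: Eb_def blowup_def)
          qed (auto simp: U0_def)
          moreover have "(1 - 2 * \<epsilon>) * real (card V) \<le> real (card U0)"
          proof -
            have "card U \<le> Suc (card U0)" unfolding U0_def
              using card_Diff1_le[of U v] U(1) V(1) finite_subset by (cases "v \<in> U") (auto simp: card_Diff_singleton)
            then have "real (card U) - 1 \<le> real (card U0)" by linarith
            moreover have "1 \<le> \<epsilon> * real n" using nbig eps(1) by (simp add: n_def pos_divide_le_eq mult.commute)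
            ultimately show ?thesis using U(3) unfolding n_def by (simp add: algebra_simps)
          qed
          moreover have "dense_core_free \<delta>1 V (Eb c)"
            by (rule dense_core_free_mono[OF _ d(2)])
              (use V Ebs Ebnc cthr in \<open>simp add: dense_core_free_def thr_def n_def\<close>)
          moreover have "U0 \<subseteq> V" using U(1) by (auto simp: U0_def)
          ultimately have "Good c" unfolding Good_def n_def
            by (intro improve[rule_format])
          with cG show False by simp
        qed
      qed
      \<comment> \<open>The original hypergraph is the blow-up along the identity.\<close>
      define i where "i = restrict (\<lambda>x. x) V"
      have "Eb i = E"
      proof -
        have "inj_on i e" "i ` e = e" if "e \<in> nsets V r" for e
          using that by (auto simp: i_def nsets_def inj_on_def subset_iff image_iff)
        then show ?thesis using E by (auto simp: Eb_def blowup_def)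
      qed
      moreover have "i \<in> PiE V (\<lambda>_. V)" by (auto simp: i_def)
      ultimately have "Good i" using noBad big by (auto simp: Bad_def thr_def n_def)
      then show "\<exists>U\<subseteq>V. partite E U \<and> (1 - \<epsilon>) * real (card V) \<le> real (card U)"
        unfolding Good_def \<open>Eb i = E\<close> n_def .
    qed (rule d)
  qed (rule e0)
qed

text \<open>A hypergraph with such a copy is itself a member of the family and trivially contains
  itself.\<close>

lemma not_core_copy_of_family_free:
  fixes G :: "'v hypergraph"
  assumes "r_graph r G" "family_free (core_family r F (k + r - 2) :: 'v hypergraph set) G"
  shows "\<not> core_copy F (edges G)"
proof
  assume "core_copy F (edges G)"
  then obtain f where f: "inj_on f (verts F)" "\<forall>e\<in>edges F. f ` e \<in> edges G"
    "\<forall>u\<in>verts F. \<forall>v\<in>verts F. u \<noteq> v \<longrightarrow> cov (edges G) (f u) (f v)"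
    unfolding core_copy_def by (elim exE conjE)
  define C where "C = f ` verts F"
  have cC: "card C = k + r - 2" unfolding C_def card_image[OF f(1)] by (rule cardF)
  have CV: "C \<subseteq> verts G"
  proof
    fix y assume "y \<in> C"
    then obtain u where u: "u \<in> verts F" "y = f u" by (auto simp: C_def)
    have "\<not> verts F \<subseteq> {u}" using cardF k3 r2 card_mono[of "{u}" "verts F"] by auto
    then obtain v where v: "v \<in> verts F" "u \<noteq> v" by auto
    then obtain e where "e \<in> edges G" "y \<in> e" using f(3) u unfolding cov_def by meson
    then show "y \<in> verts G" using assms(1) by (auto simp: r_graph_def)
  qed
  have "G \<in> (core_family r F (k + r - 2) :: 'v hypergraph set)" unfolding core_family_def
  proof (intro CollectI conjI exI[of _ C] assms(1) CV cC ballI impI)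
    show "has_copy F (induced G C)" unfolding has_copy_def
    proof (intro exI[of _ f] conjI ballI f(1))
      show "f ` verts F \<subseteq> verts (induced G C)" using CV by (auto simp: induced_def C_def)
      fix e assume e: "e \<in> edges F"
      then have "e \<subseteq> verts F" using edgeT by (auto simp: vertsF edgesF)
      then show "f ` e \<in> edges (induced G C)" using f(2) e by (auto simp: induced_def C_def)
    qed
    fix x y assume xy: "x \<in> C" "y \<in> C" "x \<noteq> y"
    then obtain u v where "u \<in> verts F" "v \<in> verts F" "x = f u" "y = f v" by (auto simp: C_def)
    then show "covered G x y" using f(3) xy(3) unfolding covered_def cov_def by auto
  qed
  moreover have "has_copy G G" unfolding has_copy_def by (intro exI[of _ "\<lambda>x. x"]) auto
  ultimately show False using assms(2) unfolding family_free_def by blast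
qed

lemma stable: "m_stable r m (core_family r F (k + r - 2))"
  unfolding m_stable_def
proof (intro allI impI)
  fix \<epsilon>' :: real assume e': "\<epsilon>' > 0"
  obtain \<epsilon>0 where e0: "\<epsilon>0 > 0" and main: "\<forall>\<epsilon>. 0 < \<epsilon> \<longrightarrow> \<epsilon> \<le> \<epsilon>0 \<longrightarrow> (\<exists>\<delta>>0. \<forall>(V :: nat set) E. dense_core_free \<delta> V E \<longrightarrow> 1 / \<epsilon> \<le> real (card V) \<longrightarrow>
    (\<exists>U\<subseteq>V. partite E U \<and> (1 - \<epsilon>) * real (card V) \<le> real (card U)))"
    using core_free_stability[where 'v = nat] by (elim exE conjE)
  define \<epsilon> where "\<epsilon> = min \<epsilon>' \<epsilon>0"
  have eps: "0 < \<epsilon>" "\<epsilon> \<le> \<epsilon>0" "\<epsilon> \<le> \<epsilon>'" using e' e0 by (auto simp: \<epsilon>_def)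
  obtain \<delta> where d: "\<delta> > 0" and st: "\<forall>(V :: nat set) E. dense_core_free \<delta> V E \<longrightarrow> 1 / \<epsilon> \<le> real (card V) \<longrightarrow>
    (\<exists>U\<subseteq>V. partite E U \<and> (1 - \<epsilon>) * real (card V) \<le> real (card U))"
    using main[rule_format, OF eps(1,2)] by (elim exE conjE)
  define l where "l = lam k r"
  have l0: "l > 0" using lam_pos[OF k3, of r] r2 by (simp add: l_def)
  \<comment> \<open>Half of the available deficit is kept for the passage from binomials to powers,
    which costs at most \<open>fact r * \<delta> / 2\<close> for large \<open>n\<close>. The bound
    by \<open>l\<close> keeps the factor \<open>l - \<delta>'\<close> nonnegative when
    \<open>choose_ge\<close> is multiplied by it.\<close>
  define \<delta>' where "\<delta>' = min l (fact r * \<delta> / 2)"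
  have d': "\<delta>' > 0" "\<delta>' \<le> l" "\<delta>' \<le> fact r * \<delta> / 2" using l0 d by (auto simp: \<delta>'_def)
  define n1 where "n1 = Suc r + nat \<lceil>1 / \<epsilon>\<rceil> + nat \<lceil>l * real r ^ 2 * 2 / (fact r * \<delta>)\<rceil>"
  show "\<exists>\<delta>1 n1. \<delta>1 > 0 \<and> (\<forall>G :: nat hypergraph. r_graph r G \<and> family_free (core_family r F (k + r - 2) :: nat hypergraph set) G \<and>
     card (verts G) \<ge> n1 \<and>
     real (card (edges G)) > (falling_factorial m r / real m ^ r - \<delta>1) * real (card (verts G) choose r) \<longrightarrow>
     (\<exists>S\<subseteq>verts G. real (card S) \<le> \<epsilon>' * real (card (verts G)) \<and> m_partite m (induced G (verts G - S))))"
  proof (rule exI[of _ \<delta>'], rule exI[of _ n1], intro conjI allI impI d'(1), elim conjE)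
    fix G :: "nat hypergraph"
    assume G: "r_graph r G" and ff: "family_free (core_family r F (k + r - 2) :: nat hypergraph set) G"
      and nG: "n1 \<le> card (verts G)"
      and dens: "(falling_factorial m r / real m ^ r - \<delta>') * real (card (verts G) choose r) < real (card (edges G))"
    define V where "V = verts G"
    define n where "n = card V"
    have V: "finite V" using G by (simp add: r_graph_def V_def)
    have EV: "edges G \<subseteq> nsets V r" using G V by (auto simp: r_graph_def nsets_def V_def intro: finite_subset)
    have nn: "n \<ge> Suc r" "1 / \<epsilon> \<le> real n" "l * real r ^ 2 * 2 / (fact r * \<delta>) \<le> real n"
    proof -
      have *: "y \<le> real n" if "nat \<lceil>y\<rceil> \<le> n" for y :: real using that by linarith
      have "n1 \<le> n" using nG by (simp add: n_def V_def)
      then have "n \<ge> Suc r \<and> nat \<lceil>1 / \<epsilon>\<rceil> \<le> n \<and> nat \<lceil>l * real r ^ 2 * 2 / (fact r * \<delta>)\<rceil> \<le> n"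
        unfolding n1_def by linarith
      then show "n \<ge> Suc r" "1 / \<epsilon> \<le> real n" "l * real r ^ 2 * 2 / (fact r * \<delta>) \<le> real n" using * by blast+
    qed
    have n0: "real n > 0" using nn(1) by simp
    have "l * real r ^ 2 / real n \<le> fact r * \<delta> / 2"
    proof -
      have "l * real r ^ 2 * 2 \<le> real n * (fact r * \<delta>)" using nn(3) d by (simp add: pos_divide_le_eq)
      then show ?thesis using n0 by (simp add: pos_divide_le_eq mult.commute)
    qed
    then have "l - fact r * \<delta> \<le> l - \<delta>' - l * real r ^ 2 / real n" using d'(3) by linarith
    also have "\<dots> \<le> l - \<delta>' - l * real r ^ 2 / real n + \<delta>' * (real r ^ 2 / real n)"
      using d'(1) by simp
    also have "\<dots> = (l - \<delta>') * (1 - real r ^ 2 / real n)" by (simp add: algebra_simps diff_divide_distrib)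
    finally have "(l - fact r * \<delta>) * real n ^ r \<le> (l - \<delta>') * (1 - real r ^ 2 / real n) * real n ^ r"
      by (intro mult_right_mono) auto
    also have "\<dots> = (l - \<delta>') * ((1 - real r ^ 2 / real n) * real n ^ r)" by simp
    also have "\<dots> \<le> (l - \<delta>') * (fact r * real (n choose r))"
      using d'(2) nn(1) by (intro mult_left_mono choose_ge) auto
    also have "\<dots> = fact r * ((l - \<delta>') * real (n choose r))" by simp
    also have "\<dots> \<le> fact r * real (card (edges G))"
      using dens unfolding l_def lam_def n_def V_def by (intro mult_left_mono) auto
    finally have "fact r * ((l / fact r - \<delta>) * real n ^ r) \<le> fact r * real (card (edges G))"
      by (simp add: algebra_simps)
    then have thr: "(l / fact r - \<delta>) * real n ^ r \<le> real (card (edges G))" by simp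
    have "V \<noteq> {}" using nn(1) by (auto simp: n_def)
    then have "dense_core_free \<delta> V (edges G)"
      using V EV not_core_copy_of_family_free[OF G ff] thr unfolding dense_core_free_def l_def n_def by simp
    then have "\<exists>U\<subseteq>V. partite (edges G) U \<and> (1 - \<epsilon>) * real n \<le> real (card U)"
      using st[rule_format, of V "edges G"] nn(2) unfolding n_def by simp
    then obtain U where U: "U \<subseteq> V" "partite (edges G) U" "(1 - \<epsilon>) * real n \<le> real (card U)"
      by (elim exE conjE)
    obtain P where P: "disjoint_family_on P {..<m}" "U = (\<Union>j<m. P j)"
      "\<forall>e\<in>edges G. e \<subseteq> U \<longrightarrow> (\<forall>j<m. card (e \<inter> P j) \<le> 1)"
      using U(2) unfolding partite_def by (elim exE conjE)
    have VU: "V - (V - U) = U" using U(1) by blast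
    show "\<exists>S\<subseteq>verts G. real (card S) \<le> \<epsilon>' * real (card (verts G)) \<and> m_partite m (induced G (verts G - S))"
    proof (rule exI[of _ "V - U"], intro conjI)
      show "V - U \<subseteq> verts G" by (auto simp: V_def)
      have "card (V - U) = n - card U" "card U \<le> n"
        using U(1) V by (auto simp: n_def card_Diff_subset finite_subset card_mono)
      then have "real (card (V - U)) \<le> \<epsilon> * real n" using U(3) by (simp add: of_nat_diff algebra_simps)
      also have "\<dots> \<le> \<epsilon>' * real n" using eps(3) by (intro mult_right_mono) auto
      finally show "real (card (V - U)) \<le> \<epsilon>' * real (card (verts G))" by (simp add: n_def V_def)
      show "m_partite m (induced G (verts G - (V - U)))"
        unfolding m_partite_def V_def[symmetric] VU
        by (rule exI[of _ P]) (use P U(1) in \<open>auto simp: induced_def V_def\<close>)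
    qed
  qed
qed

end

theorem theorem6p7:
  fixes k r :: nat and T :: "'a hypergraph" and D :: "'a set"
  assumes "k \<ge> 3" and "r \<ge> 2" and "real k \<ge> M_last r"
    and "is_tree T" and "card (verts T) = k" and "satisfies_erdos_sos T"
    and "finite D" and "card D = r - 2" and "D \<inter> verts T = {}"
  shows "m_stable r (k + r - 3) (core_family r (enlargement T D) (k + r - 2))"
proof -
  interpret enlarged_tree k r T D using assms by unfold_locales
  show ?thesis by (rule stable)
qed

end
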